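(* Let $n,p,n_{w_p},n_{y_p}\ge1$, $L\ge m>0$, and let $A\in\mathbb{R}^{np\times np}$, $B\in\mathbb{R}^{np\times p}$, $C\in\mathbb{R}^{p\times np}$, $D\in\mathbb{R}^{p\times np}$, $D^\dagger\in\mathbb{R}^{np\times p}$ be given with $DD^\dagger=I_p$, $CD^\dagger=I_p$, $(A-I)D^\dagger=0$; let $B_p\in\mathbb{R}^{np\times n_{w_p}}$, $C_p\in\mathbb{R}^{n_{y_p}\times np}$. Consider $$\xi_{k+1}=(A+mBC)\xi_k+Bw_k+B_pw_{p,k},\quad y_k=C\xi_k,\quad y_{p,k}=C_p\xi_k,\quad w_k=\Delta_H(y)_k .\qquad(\ast)$$ Assume that $A+mBC$ has all eigenvalues in the open unit disk. Let $\ell_+,\ell_-\in\mathbb{N}$, $n_c=p(n+\ell_-+\ell_+)$ and $N^\top=\begin{bmatrix}0_{np\times(\ell_-+\ell_+)p}&I_{np}\end{bmatrix}$. If there exist $P_p=P_p^\top\in\mathbb{R}^{n_c\times n_c}$, $M_+\in\mathbb{R}^{p\times p\ell_+}$, $M_-\in\mathbb{R}^{p\times p\ell_-}$, $M_0\in\mathbb{R}^{p\times p}$, $\gamma>0$ such that $$\begin{bmatrix}\mathbf{A}_c&\mathbf{B}_{c,1}\\ I&0\\ \mathbf{C}_{c,1}&\mathbf{D}_{c,11}\\ \mathbf{C}_{c,2}&0\end{bmatrix}^\top\begin{bmatrix}P_p&0&0&0\\ 0&-P_p&0&0\\ 0&0&M_\Delta&0\\ 0&0&0&I_{n_{y_p}}\end{bmatrix}\begin{bmatrix}\mathbf{A}_c&\mathbf{B}_{c,1}\\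 I&0\\ \mathbf{C}_{c,1}&\mathbf{D}_{c,11}\\ \mathbf{C}_{c,2}&0\end{bmatrix}\prec0,$$ $$\mathrm{tr}\big(\mathbf{B}_{c,2}^\top NN^\top P_pNN^\top\mathbf{B}_{c,2}\big)\le\gamma^2,\qquad P_p\succ0,\qquad\begin{bmatrix}M_-&M_0&M_+\end{bmatrix}\in\mathbb{M}(1,\ell_+,\ell_-,p),$$ then the interconnection $(\ast)$ is robustly stable against $\{\Delta_H:H\in\mathcal{S}_{m,L}\}$ and achieves a robust $H_2$-performance level of $\gamma$ against $\{\Delta_H:H\in\mathcal{S}_{m,L}\}$.
   Context: $\mathbb{N}$ includes $0$. $\mathcal{S}_{m,L}$: functions $H:\mathbb{R}^p\to\mathbb{R}$, $H\in\mathcal{C}^2$, with $(\nabla H(x)-\nabla H(y))^\top(x-y)\ge m\|x-y\|^2$ and $\|\nabla H(x)-\nabla H(y)\|\le L\|x-y\|$ for all $x,y$; $z^\star$ is the unique minimizer of $H$; $\Delta_H(y)_k=\nabla H(y_k+z^\star)-my_k$ for sequences $y$ in $\mathbb{R}^p$. Robust stability: let $G_{yw}$ be the linear system with state-space realization $(A+mBC,B,C,0)$. With $w_p=0$ the interconnection $y=G_{yw}w+y_{\mathrm{in}}$, $w=\Delta_H(y)$ is robustly stable if for every $H\in\mathcal{S}_{m,L}$ it is well-posed (the map $q\mapsto(I-G_{yw}\Delta_H)q$ has a causal inverse) and the map $y_{\mathrm{in}}\mapsto y$ has bounded $\ell_2$-gain. Robust $H_2$-performance level $\gamma$: the interconnection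 is robustly stable and, for all $H\in\mathcal{S}_{m,L}$, if $(w_{p,k})_{k\in\mathbb{N}}$ is a discrete-time white noise process (mutually independent, zero mean, identity covariance) and $(y_{p,k})$ is the response of $(\ast)$ with $\xi_0=0$, then $\limsup_{k_{\max}\to\infty}\sqrt{\tfrac1{k_{\max}}\sum_{k=0}^{k_{\max}}\mathrm{E}(y_{p,k}^\top y_{p,k})}\le\gamma$. $\mathbb{M}(\rho,\ell_+,\ell_-,p)$ is the set of $[M_{-\ell_-}\cdots M_{\ell_+}]$ with $M_i=m_iI_p$, $m_i\le0$ for $i\neq0$, $(\sum_iM_i\rho^{-i})\mathbf{1}\ge0$, $\mathbf{1}^\top(\sum_iM_i\rho^i)\ge0$ (elementwise); here $\rho=1$. $M_-=[M_{-\ell_-}\cdots M_{-1}]$, $M_+=[M_1^\top\cdots M_{\ell_+}^\top]$. $$M_\Delta=\mathrm{blkdiag}\left(\begin{bmatrix}0&M_0^\top\\ M_0&0\end{bmatrix},\begin{bmatrix}0&M_-^\top\\ M_-&0\end{bmatrix},\begin{bmatrix}0&M_+\\ M_+^\top&0\end{bmatrix}\right),$$ with block sizes $(p,p,\ell_-p,p,p,\ell_+p)$. Let $S_\ell\in\mathbb{R}^{\ell\times\ell}$ have ones on the first superdiagonal and zeros elsewhere, $e_\ell=[0,\dots,0,1]^\top\in\mathbb{R}^\ell$, $J_\ell$ the $\ell\times\ell$ matrix with ones on the antidiagonal and zeros elsewhere (blocks of dimension zero are omitted). Put $\widehat W=\begin{bmatrix}(L-m)I_p&-I_p\\ 0&I_p\end{bmatrix}$,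 $$A_\Delta=\begin{bmatrix}S_{\ell_-}&0\\ 0&S_{\ell_+}\end{bmatrix}\otimes I_p,\quad B_\Delta=\begin{bmatrix}e_{\ell_-}\otimes I_p&0\\ 0&e_{\ell_+}\otimes I_p\end{bmatrix}\widehat W,\quad C_\Delta=\begin{bmatrix}0&0\\ 0&0\\ I_{\ell_-p}&0\\ 0&0\\ 0&0\\ 0&J_{\ell_+}\otimes I_p\end{bmatrix},\quad D_\Delta=\begin{bmatrix}I_p&0\\ 0&I_p\\ 0&0\\ 0&I_p\\ I_p&0\\ 0&0\end{bmatrix}\widehat W,$$ block rows of $C_\Delta,D_\Delta$ having sizes $(p,p,\ell_-p,p,p,\ell_+p)$. Then $$\mathbf{A}_c=\begin{bmatrix}A_\Delta&B_\Delta\begin{bmatrix}C\\ 0\end{bmatrix}\\ 0&A+mBC\end{bmatrix},\ \mathbf{B}_{c,1}=\begin{bmatrix}B_\Delta\begin{bmatrix}0\\ I_p\end{bmatrix}\\ B\end{bmatrix},\ \mathbf{B}_{c,2}=\begin{bmatrix}0\\ B_p\end{bmatrix},\ \mathbf{C}_{c,1}=\begin{bmatrix}C_\Delta&D_\Delta\begin{bmatrix}C\\ 0\end{bmatrix}\end{bmatrix},\ \mathbf{C}_{c,2}=\begin{bmatrix}0&C_p\end{bmatrix},\ \mathbf{D}_{c,11}=D_\Delta\begin{bmatrix}0\\ I_p\end{bmatrix}.$$ *)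

theory Defs
  imports
    "HOL-Probability.Probability"
    "Jordan_Normal_Form.Char_Poly"
begin

(* Matrices (real mat) have dimensions given by natural numbers, since the filter lengths may be 0.
   Signals on which a nonlinearity or a probability measure acts live in real ^ 'p, where the
   library provides derivatives and Borel sets.  The two are linked by one fixed enumeration of
   the index type; the class of nonlinearities and the white noise assumption are both invariant
   under permutation of coordinates. *)

definition to_jvec :: "real ^ 'p::finite \<Rightarrow> real Matrix.vec" where
  "to_jvec x = Matrix.vec CARD('p) (\<lambda>i. vec_nth x (from_nat_into (UNIV :: 'p set) i))"

definition of_jvec :: "real Matrix.vec \<Rightarrow> real ^ 'p::finite" where
  "of_jvec v = (\<chi> i. vec_index v (to_nat_on (UNIV :: 'p set) i))"

section \<open>The class of objective functions and the associated operators\<close>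

definition grad :: "('a::euclidean_space \<Rightarrow> real) \<Rightarrow> 'a \<Rightarrow> 'a" where
  "grad H x = (THE D. GDERIV H x :> D)"

definition twice_cont_diff :: "('a::euclidean_space \<Rightarrow> real) \<Rightarrow> bool" where
  "twice_cont_diff H \<longleftrightarrow>
     (\<forall>x. \<exists>D. GDERIV H x :> D) \<and>
     (\<exists>H2 :: 'a \<Rightarrow> 'a \<Rightarrow>\<^sub>L 'a.
        (\<forall>x. (grad H has_derivative blinfun_apply (H2 x)) (at x)) \<and> continuous_on UNIV H2)"

definition S_class :: "real \<Rightarrow> real \<Rightarrow> ('a::euclidean_space \<Rightarrow> real) set" where
  "S_class m L = {H. twice_cont_diff H \<and>
     (\<forall>x y. inner (grad H x - grad H y) (x - y) \<ge> m * (norm (x - y))\<^sup>2) \<and>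
     (\<forall>x y. norm (grad H x - grad H y) \<le> L * norm (x - y))}"

definition minimizer :: "('a::euclidean_space \<Rightarrow> real) \<Rightarrow> 'a" where
  "minimizer H = (THE z. \<forall>x. H z \<le> H x)"

definition Delta :: "real \<Rightarrow> ('a::euclidean_space \<Rightarrow> real) \<Rightarrow> (nat \<Rightarrow> 'a) \<Rightarrow> (nat \<Rightarrow> 'a)" where
  "Delta m H y k = grad H (y k + minimizer H) - m *\<^sub>R y k"

section \<open>Robust stability\<close>

fun lti_state ::
  "real mat \<Rightarrow> real mat \<Rightarrow> (nat \<Rightarrow> real ^ 'w::finite) \<Rightarrow> nat \<Rightarrow> real Matrix.vec" where
  "lti_state A B w 0 = 0\<^sub>v (dim_row A)"
| "lti_state A B w (Suc k) = A *\<^sub>v lti_state A B w k + B *\<^sub>v to_jvec (w k)"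

definition lti ::
  "real mat \<Rightarrow> real mat \<Rightarrow> real mat \<Rightarrow> real mat \<Rightarrow>
   (nat \<Rightarrow> real ^ 'w::finite) \<Rightarrow> (nat \<Rightarrow> real ^ 'y::finite)" where
  "lti A B C D w k = of_jvec (C *\<^sub>v lti_state A B w k + D *\<^sub>v to_jvec (w k))"

definition causal :: "((nat \<Rightarrow> 'a) \<Rightarrow> (nat \<Rightarrow> 'b)) \<Rightarrow> bool" where
  "causal F \<longleftrightarrow> (\<forall>u v T. (\<forall>k\<le>T. u k = v k) \<longrightarrow> (\<forall>k\<le>T. F u k = F v k))"

definition bounded_l2_gain ::
  "((nat \<Rightarrow> 'a::real_normed_vector) \<Rightarrow> (nat \<Rightarrow> 'b::real_normed_vector)) \<Rightarrow> bool" where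
  "bounded_l2_gain F \<longleftrightarrow>
     (\<exists>c. \<forall>u. summable (\<lambda>k. (norm (u k))\<^sup>2) \<longrightarrow>
        summable (\<lambda>k. (norm (F u k))\<^sup>2) \<and>
        sqrt (\<Sum>k. (norm (F u k))\<^sup>2) \<le> c * sqrt (\<Sum>k. (norm (u k))\<^sup>2))"

definition loop_map ::
  "((nat \<Rightarrow> 'b) \<Rightarrow> (nat \<Rightarrow> 'a::real_normed_vector)) \<Rightarrow> ((nat \<Rightarrow> 'a) \<Rightarrow> (nat \<Rightarrow> 'b)) \<Rightarrow>
   (nat \<Rightarrow> 'a) \<Rightarrow> (nat \<Rightarrow> 'a)" where
  "loop_map G F q = (\<lambda>k. q k - G (F q) k)"

definition well_posed ::
  "((nat \<Rightarrow> 'b) \<Rightarrow> (nat \<Rightarrow> 'a::real_normed_vector)) \<Rightarrow> ((nat \<Rightarrow> 'a) \<Rightarrow> (nat \<Rightarrow> 'b)) \<Rightarrow> bool" where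
  "well_posed G F \<longleftrightarrow> bij (loop_map G F) \<and> causal (inv_into UNIV (loop_map G F))"

(* y = G w + y_in with w = F y means loop_map G F y = y_in, so that y_in \<mapsto> y is the inverse of
   loop_map G F. *)

definition robustly_stable ::
  "((nat \<Rightarrow> 'b) \<Rightarrow> (nat \<Rightarrow> 'a::real_normed_vector)) \<Rightarrow> ((nat \<Rightarrow> 'a) \<Rightarrow> (nat \<Rightarrow> 'b)) set \<Rightarrow> bool" where
  "robustly_stable G Fs \<longleftrightarrow>
     (\<forall>F\<in>Fs. well_posed G F \<and> bounded_l2_gain (inv_into UNIV (loop_map G F)))"

section \<open>Robust performance\<close>

definition white_noise :: "'o measure \<Rightarrow> (nat \<Rightarrow> 'o \<Rightarrow> real ^ 'w::finite) \<Rightarrow> bool" where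
  "white_noise M wp \<longleftrightarrow>
     prob_space M \<and>
     prob_space.indep_vars M (\<lambda>_. borel) wp UNIV \<and>
     (\<forall>k. integrable M (\<lambda>\<omega>. (norm (wp k \<omega>))\<^sup>2)) \<and>
     (\<forall>k. (LINT \<omega>|M. wp k \<omega>) = 0) \<and>
     (\<forall>k i j. (LINT \<omega>|M. vec_nth (wp k \<omega>) i * vec_nth (wp k \<omega>) j) = (if i = j then 1 else 0))"

definition zero_state_response ::
  "real mat \<Rightarrow> real mat \<Rightarrow> real mat \<Rightarrow> real mat \<Rightarrow> real mat \<Rightarrow>
   ((nat \<Rightarrow> real ^ 'p::finite) \<Rightarrow> (nat \<Rightarrow> real ^ 'p)) \<Rightarrow>
   (nat \<Rightarrow> real ^ 'w::finite) \<Rightarrow> (nat \<Rightarrow> real Matrix.vec) \<Rightarrow> bool" where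
  "zero_state_response Acl B Bp C Cp F wp yp \<longleftrightarrow>
     (\<exists>\<xi> w y. \<xi> 0 = 0\<^sub>v (dim_row Acl) \<and> w = F y \<and>
        (\<forall>k. \<xi> (Suc k) = Acl *\<^sub>v \<xi> k + B *\<^sub>v to_jvec (w k) + Bp *\<^sub>v to_jvec (wp k) \<and>
             y k = of_jvec (C *\<^sub>v \<xi> k) \<and>
             yp k = Cp *\<^sub>v \<xi> k))"

(* The type arguments are the sample space and the index type of the noise.  Integrability is
   stated because a non-integrable function has Bochner integral 0, whereas
   E(y_p^T y_p) = \<infinity> has to violate the bound. *)

definition robust_H2_performance ::
  "'o itself \<Rightarrow> 'w::finite itself \<Rightarrow>
   real mat \<Rightarrow> real mat \<Rightarrow> real mat \<Rightarrow> real mat \<Rightarrow> real mat \<Rightarrow>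
   ((nat \<Rightarrow> real ^ 'p::finite) \<Rightarrow> (nat \<Rightarrow> real ^ 'p)) set \<Rightarrow> real \<Rightarrow> bool" where
  "robust_H2_performance _ _ Acl B Bp C Cp Fs \<gamma> \<longleftrightarrow>
     robustly_stable (lti Acl B C (0\<^sub>m CARD('p) CARD('p))) Fs \<and>
     (\<forall>F\<in>Fs. \<forall>(M :: 'o measure) (wp :: nat \<Rightarrow> 'o \<Rightarrow> real ^ 'w) yp.
        white_noise M wp \<and>
        (\<forall>\<omega>\<in>space M. zero_state_response Acl B Bp C Cp F (\<lambda>k. wp k \<omega>) (\<lambda>k. yp k \<omega>)) \<longrightarrow>
        (\<forall>k. integrable M (\<lambda>\<omega>. scalar_prod (yp k \<omega>) (yp k \<omega>))) \<and>
        limsup (\<lambda>K. ereal (sqrt (1 / real K *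
          (\<Sum>k=0..K. LINT \<omega>|M. scalar_prod (yp k \<omega>) (yp k \<omega>))))) \<le> ereal \<gamma>)"

section \<open>Matrix notions\<close>

definition append_cols :: "real mat \<Rightarrow> real mat \<Rightarrow> real mat" (infixr "@\<^sub>c" 65) where
  "X @\<^sub>c Y = four_block_mat X Y (0\<^sub>m 0 (dim_col X)) (0\<^sub>m 0 (dim_col Y))"

definition mat_trace :: "real mat \<Rightarrow> real" where
  "mat_trace X = (\<Sum>i<dim_row X. X $$ (i, i))"

definition kronecker :: "real mat \<Rightarrow> real mat \<Rightarrow> real mat" (infixl "\<otimes>\<^sub>k" 75) where
  "X \<otimes>\<^sub>k Y = mat (dim_row X * dim_row Y) (dim_col X * dim_col Y)
     (\<lambda>(i, j). X $$ (i div dim_row Y, j div dim_col Y) * Y $$ (i mod dim_row Y, j mod dim_col Y))"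

definition pos_definite :: "real mat \<Rightarrow> bool" where
  "pos_definite X \<longleftrightarrow> square_mat X \<and> transpose_mat X = X \<and>
     (\<forall>v\<in>carrier_vec (dim_row X). v \<noteq> 0\<^sub>v (dim_row X) \<longrightarrow> scalar_prod v (X *\<^sub>v v) > 0)"

definition neg_definite :: "real mat \<Rightarrow> bool" where
  "neg_definite X \<longleftrightarrow> square_mat X \<and> transpose_mat X = X \<and>
     (\<forall>v\<in>carrier_vec (dim_row X). v \<noteq> 0\<^sub>v (dim_row X) \<longrightarrow> scalar_prod v (X *\<^sub>v v) < 0)"

section \<open>Multipliers\<close>

(* lp and lm are the lengths l_+ and l_-.  Mi is indexed by -lm, ..., lp; block c div p of the block row is Mi (c div p - lm). *)

definition multiplier_sum :: "real \<Rightarrow> nat \<Rightarrow> nat \<Rightarrow> nat \<Rightarrow> (int \<Rightarrow> real mat) \<Rightarrow> real mat" where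
  "multiplier_sum \<rho> lp lm p Mi =
     mat p p (\<lambda>(r, c). \<Sum>i=-int lm..int lp. Mi i $$ (r, c) * \<rho> powi i)"

definition multiplier_set :: "real \<Rightarrow> nat \<Rightarrow> nat \<Rightarrow> nat \<Rightarrow> real mat set" where
  "multiplier_set \<rho> lp lm p =
     {mat p ((lm + 1 + lp) * p) (\<lambda>(r, c). Mi (int (c div p) - int lm) $$ (r, c mod p)) | Mi.
        (\<forall>i\<in>{-int lm..int lp}. \<exists>mi. Mi i = mi \<cdot>\<^sub>m 1\<^sub>m p \<and> (i \<noteq> 0 \<longrightarrow> mi \<le> 0)) \<and>
        0\<^sub>v p \<le> multiplier_sum (inverse \<rho>) lp lm p Mi *\<^sub>v Matrix.vec p (\<lambda>_. 1) \<and>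
        0\<^sub>v p \<le> transpose_mat (multiplier_sum \<rho> lp lm p Mi) *\<^sub>v Matrix.vec p (\<lambda>_. 1)}"

definition M_Delta :: "nat \<Rightarrow> nat \<Rightarrow> nat \<Rightarrow> real mat \<Rightarrow> real mat \<Rightarrow> real mat \<Rightarrow> real mat" where
  "M_Delta p lp lm Mm M0 Mp = diag_block_mat
     [four_block_mat (0\<^sub>m p p) (transpose_mat M0) M0 (0\<^sub>m p p),
      four_block_mat (0\<^sub>m (lm * p) (lm * p)) (transpose_mat Mm) Mm (0\<^sub>m p p),
      four_block_mat (0\<^sub>m p p) Mp (transpose_mat Mp) (0\<^sub>m (lp * p) (lp * p))]"

section \<open>The filter and the extended plant\<close>

definition shift_mat :: "nat \<Rightarrow> real mat" where
  "shift_mat l = mat l l (\<lambda>(i, j). if j = i + 1 then 1 else 0)"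

definition last_unit :: "nat \<Rightarrow> real mat" where
  "last_unit l = mat l 1 (\<lambda>(i, j). if i + 1 = l then 1 else 0)"

definition flip_mat :: "nat \<Rightarrow> real mat" where
  "flip_mat l = mat l l (\<lambda>(i, j). if i + j + 1 = l then 1 else 0)"

definition W_hat :: "nat \<Rightarrow> real \<Rightarrow> real \<Rightarrow> real mat" where
  "W_hat p m L = four_block_mat ((L - m) \<cdot>\<^sub>m 1\<^sub>m p) (- 1\<^sub>m p) (0\<^sub>m p p) (1\<^sub>m p)"

definition A_Delta :: "nat \<Rightarrow> nat \<Rightarrow> nat \<Rightarrow> real mat" where
  "A_Delta p lp lm =
     four_block_mat (shift_mat lm) (0\<^sub>m lm lp) (0\<^sub>m lp lm) (shift_mat lp) \<otimes>\<^sub>k 1\<^sub>m p"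

definition B_Delta :: "nat \<Rightarrow> nat \<Rightarrow> nat \<Rightarrow> real \<Rightarrow> real \<Rightarrow> real mat" where
  "B_Delta p lp lm m L =
     four_block_mat (last_unit lm \<otimes>\<^sub>k 1\<^sub>m p) (0\<^sub>m (lm * p) p)
                    (0\<^sub>m (lp * p) p) (last_unit lp \<otimes>\<^sub>k 1\<^sub>m p) * W_hat p m L"

definition C_Delta :: "nat \<Rightarrow> nat \<Rightarrow> nat \<Rightarrow> real mat" where
  "C_Delta p lp lm =
        (0\<^sub>m p (lm * p) @\<^sub>c 0\<^sub>m p (lp * p))
     @\<^sub>r (0\<^sub>m p (lm * p) @\<^sub>c 0\<^sub>m p (lp * p))
     @\<^sub>r (1\<^sub>m (lm * p) @\<^sub>c 0\<^sub>m (lm * p) (lp * p))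
     @\<^sub>r (0\<^sub>m p (lm * p) @\<^sub>c 0\<^sub>m p (lp * p))
     @\<^sub>r (0\<^sub>m p (lm * p) @\<^sub>c 0\<^sub>m p (lp * p))
     @\<^sub>r (0\<^sub>m (lp * p) (lm * p) @\<^sub>c (flip_mat lp \<otimes>\<^sub>k 1\<^sub>m p))"

definition D_Delta :: "nat \<Rightarrow> nat \<Rightarrow> nat \<Rightarrow> real \<Rightarrow> real \<Rightarrow> real mat" where
  "D_Delta p lp lm m L =
       ((1\<^sub>m p @\<^sub>c 0\<^sub>m p p)
     @\<^sub>r (0\<^sub>m p p @\<^sub>c 1\<^sub>m p)
     @\<^sub>r (0\<^sub>m (lm * p) p @\<^sub>c 0\<^sub>m (lm * p) p)
     @\<^sub>r (0\<^sub>m p p @\<^sub>c 1\<^sub>m p)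
     @\<^sub>r (1\<^sub>m p @\<^sub>c 0\<^sub>m p p)
     @\<^sub>r (0\<^sub>m (lp * p) p @\<^sub>c 0\<^sub>m (lp * p) p)) * W_hat p m L"

(* In the following definitions np is the dimension n * p of the plant state and
   Acl = A + m B C. *)

definition A_c ::
  "nat \<Rightarrow> nat \<Rightarrow> nat \<Rightarrow> nat \<Rightarrow> real \<Rightarrow> real \<Rightarrow> real mat \<Rightarrow> real mat \<Rightarrow> real mat" where
  "A_c p np lp lm m L Acl C =
     four_block_mat (A_Delta p lp lm) (B_Delta p lp lm m L * (C @\<^sub>r 0\<^sub>m p np))
                    (0\<^sub>m np ((lm + lp) * p)) Acl"

definition B_c1 :: "nat \<Rightarrow> nat \<Rightarrow> nat \<Rightarrow> real \<Rightarrow> real \<Rightarrow> real mat \<Rightarrow> real mat" where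
  "B_c1 p lp lm m L B = (B_Delta p lp lm m L * (0\<^sub>m p p @\<^sub>r 1\<^sub>m p)) @\<^sub>r B"

definition B_c2 :: "nat \<Rightarrow> nat \<Rightarrow> nat \<Rightarrow> real mat \<Rightarrow> real mat" where
  "B_c2 p lp lm Bp = 0\<^sub>m ((lm + lp) * p) (dim_col Bp) @\<^sub>r Bp"

definition C_c1 :: "nat \<Rightarrow> nat \<Rightarrow> nat \<Rightarrow> nat \<Rightarrow> real \<Rightarrow> real \<Rightarrow> real mat \<Rightarrow> real mat" where
  "C_c1 p np lp lm m L C = C_Delta p lp lm @\<^sub>c (D_Delta p lp lm m L * (C @\<^sub>r 0\<^sub>m p np))"

definition C_c2 :: "nat \<Rightarrow> nat \<Rightarrow> nat \<Rightarrow> real mat \<Rightarrow> real mat" where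
  "C_c2 p lp lm Cp = 0\<^sub>m (dim_row Cp) ((lm + lp) * p) @\<^sub>c Cp"

definition D_c11 :: "nat \<Rightarrow> nat \<Rightarrow> nat \<Rightarrow> real \<Rightarrow> real \<Rightarrow> real mat" where
  "D_c11 p lp lm m L = D_Delta p lp lm m L * (0\<^sub>m p p @\<^sub>r 1\<^sub>m p)"

definition lmi_outer ::
  "nat \<Rightarrow> nat \<Rightarrow> nat \<Rightarrow> nat \<Rightarrow> real \<Rightarrow> real \<Rightarrow>
   real mat \<Rightarrow> real mat \<Rightarrow> real mat \<Rightarrow> real mat \<Rightarrow> real mat" where
  "lmi_outer p np lp lm m L Acl B C Cp =
     (let nc = (lm + lp) * p + np in
        (A_c p np lp lm m L Acl C @\<^sub>c B_c1 p lp lm m L B)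
     @\<^sub>r (1\<^sub>m nc @\<^sub>c 0\<^sub>m nc p)
     @\<^sub>r (C_c1 p np lp lm m L C @\<^sub>c D_c11 p lp lm m L)
     @\<^sub>r (C_c2 p lp lm Cp @\<^sub>c 0\<^sub>m (dim_row Cp) p))"

end

theory Submission
  imports Defs
begin

text \<open>Write \<open>\<phi> y = \<nabla>H (y + z\<^sup>\<star>) - m y\<close>, \<open>w = \<phi> y\<close> and \<open>u = (L - m) y - w\<close>. Interpolation of the convex function
  \<open>h\<close> with gradient \<open>\<phi>\<close> gives a storage function \<open>\<psi> = (L - m) h - \<parallel>\<phi>\<parallel>\<^sup>2 / 2 \<ge> 0\<close> with
  \<open>\<langle>w\<^sub>i, u\<^sub>i - u\<^sub>j\<rangle> \<ge> \<psi>(y\<^sub>i) - \<psi>(y\<^sub>j)\<close>; telescoping yields the Zames--Falb inequality on every finite horizon,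
  for a filter started at zero. The state of the filter consists of past values of \<open>u\<close> and \<open>w\<close>, so the
  matrix inequality says that \<open>x\<^sup>T P x\<close> decreases along unperturbed steps, up to the multiplier term, by at least
  \<open>\<parallel>y\<^sub>p\<parallel>\<^sup>2 + \<epsilon> (\<parallel>x\<parallel>\<^sup>2 + \<parallel>w\<parallel>\<^sup>2)\<close>. Summing with an additive state perturbation gives both claims: the
  perturbation is square summable for the gain bound, and for white noise its cross term has mean zero while
  its quadratic term has mean \<open>tr (B\<^sup>T P B)\<close>.\<close>

section \<open>The nonlinearity\<close>

text \<open>The same summed inequality serves both claims, but its cross term between drift and
  perturbation needs opposite treatment. For the gain any constant will do: Young's inequality
  splits the term, and half of the margin \<epsilon> absorbs the part in the state. For the H2 level
  the constant \<gamma> must come out exactly, so the term may not be estimated and has to vanish in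
  expectation. This is why drift and perturbation are kept apart (\<open>ext_drift\<close>,
  \<open>inject\<close>) and why states are treated as functionals of finitely many earlier noise
  values: dependence on the past alone gives independence from the current noise, linear growth
  gives the second moments. Signals are not known in advance to be square summable, so the
  multiplier inequality must hold on truncated sums. There the delayed storage terms do not cancel
  completely; what remains has a favourable sign because the storage is nonnegative and the filter
  starts at zero. Likewise the terminal value of the quadratic form of \<open>P\<close> is discarded
  by its sign and not by a limit.\<close>

lemma grad_eqI:
  assumes "GDERIV H x :> D" shows "grad H x = D"
  unfolding grad_def
proof (rule the_equality, rule assms)
  fix D' assume "GDERIV H x :> D'"
  then have "(\<lambda>h. inner h D') = (\<lambda>h. inner h D)"
    using assms unfolding gderiv_def by (rule has_derivative_unique)
  then have "inner (D' - D) D' = inner (D' - D) D" by (rule fun_cong)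
  then have "inner (D' - D) (D' - D) = 0" by (simp add: inner_diff_right)
  then show "D' = D" by simp
qed

text \<open>Along the segment from \<open>x\<close> to \<open>y\<close>, the gap
  \<open>\<theta>\<close> between \<open>f\<close> and the quadratic has a nonnegative derivative.
  The modulus \<mu> may be negative, so the same lemma also yields upper bounds when applied to
  \<open>- f\<close>.\<close>

lemma grad_lower_quadratic_bound:
  fixes f :: "'a::real_inner \<Rightarrow> real"
  assumes f': "\<And>x. GDERIV f x :> g x"
    and mono: "\<And>x y. inner (g x - g y) (x - y) \<ge> \<mu> * (norm (x - y))\<^sup>2"
  shows "f y \<ge> f x + inner (g x) (y - x) + \<mu> / 2 * (norm (y - x))\<^sup>2"
proof -
  define d where "d = y - x"
  define \<theta> where "\<theta> t = f (x + t *\<^sub>R d) - t * inner (g x) d - \<mu> / 2 * t\<^sup>2 * (norm d)\<^sup>2" for t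
  have "\<theta> 0 \<le> \<theta> 1"
  proof (rule DERIV_nonneg_imp_nondecreasing, simp)
    fix t :: real assume t: "0 \<le> t" "t \<le> 1"
    let ?D = "inner (g (x + t *\<^sub>R d)) d - inner (g x) d - \<mu> * t * (norm d)\<^sup>2"
    have 1: "((\<lambda>t. f (x + t *\<^sub>R d)) has_derivative (\<lambda>h. inner (h *\<^sub>R d) (g (x + t *\<^sub>R d)))) (at t)"
      by (rule has_derivative_compose[where f = "\<lambda>t. x + t *\<^sub>R d" and g = f, OF _ f'[unfolded gderiv_def]])
        (auto intro!: derivative_eq_intros)
    have 2: "((\<lambda>t. f (x + t *\<^sub>R d)) has_real_derivative inner (g (x + t *\<^sub>R d)) d) (at t)"
      using 1 unfolding has_field_derivative_def
      by (rule has_derivative_eq_rhs) (auto simp: fun_eq_iff inner_commute)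
    have "(\<theta> has_real_derivative ?D) (at t)"
      unfolding \<theta>_def by (rule 2 derivative_eq_intros refl | simp)+
    moreover have "?D \<ge> 0"
    proof (cases "t = 0")
      case False
      \<comment> \<open>Monotonicity compares two points that differ by \<open>t *\<^sub>R d\<close>
        and hence gives the claim multiplied by \<open>t\<close>; this is why \<open>t = 0\<close>
        is a separate case.\<close>
      have "t * (\<mu> * t * (norm d)\<^sup>2) \<le> t * (inner (g (x + t *\<^sub>R d)) d - inner (g x) d)"
        using mono[of x "x + t *\<^sub>R d"] mono[of "x + t *\<^sub>R d" x] t
        by (simp add: inner_diff_left algebra_simps power2_eq_square)
      then show ?thesis using False t by (simp add: mult_le_cancel_left)
    qed simp
    ultimately show "\<exists>D. (\<theta> has_real_derivative D) (at t) \<and> 0 \<le> D" by blast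
  qed
  then show ?thesis unfolding \<theta>_def d_def by simp
qed

section \<open>Quadratic bounds and the minimizer for a function in \<open>S_class\<close>\<close>

context
  fixes H :: "'a::euclidean_space \<Rightarrow> real" and m L :: real
  assumes H: "H \<in> S_class m L" and m: "0 < m" and mL: "m \<le> L"
begin

lemma S_class_GDERIV: "GDERIV H x :> grad H x"
proof -
  obtain D where "GDERIV H x :> D"
    using H unfolding S_class_def twice_cont_diff_def by blast
  then show ?thesis using grad_eqI by metis
qed

lemma S_class_strong_mono: "inner (grad H x - grad H y) (x - y) \<ge> m * (norm (x - y))\<^sup>2"
  using H unfolding S_class_def by auto

lemma S_class_Lipschitz: "norm (grad H x - grad H y) \<le> L * norm (x - y)"
  using H unfolding S_class_def by auto

lemma S_class_lower: "H y \<ge> H x + inner (grad H x) (y - x) + m / 2 * (norm (y - x))\<^sup>2"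
  by (rule grad_lower_quadratic_bound[OF S_class_GDERIV S_class_strong_mono])

text \<open>By Cauchy-Schwarz, a Lipschitz gradient makes \<open>- H\<close> monotone with modulus
  \<open>- L\<close>, so this is the lower bound for \<open>- H\<close>.\<close>

lemma S_class_upper: "H y \<le> H x + inner (grad H x) (y - x) + L / 2 * (norm (y - x))\<^sup>2"
proof -
  have "- H y \<ge> - H x + inner (- grad H x) (y - x) + (- L) / 2 * (norm (y - x))\<^sup>2"
  proof (rule grad_lower_quadratic_bound)
    show "GDERIV (\<lambda>x. - H x) x :> - grad H x" for x
      using S_class_GDERIV by (rule GDERIV_minus)
    show "inner (- grad H x - - grad H y) (x - y) \<ge> (- L) * (norm (x - y))\<^sup>2" for x y
    proof -
      have "inner (grad H x - grad H y) (x - y) \<le> L * norm (x - y) * norm (x - y)"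
        by (rule order.trans[OF norm_cauchy_schwarz mult_right_mono[OF S_class_Lipschitz]]) simp
      then show ?thesis by (simp add: inner_diff_left power2_eq_square)
    qed
  qed
  then show ?thesis by simp
qed

text \<open>A gradient step is a contraction, and its fixed point is a zero of the gradient.
  Existence has to be shown because \<open>minimizer\<close> is a definite description.\<close>

lemma S_class_grad_zero: "\<exists>z. grad H z = 0"
proof -
  \<comment> \<open>This step size minimises
    \<open>1 - 2 * \<alpha> * m + \<alpha>\<^sup>2 * L\<^sup>2\<close>, the bound on the squared
    contraction factor; the minimum is \<open>c\<^sup>2\<close>.\<close>
  define \<alpha> where "\<alpha> = m / L\<^sup>2"
  define c where "c = sqrt (1 - m\<^sup>2 / L\<^sup>2)"
  have L: "L > 0" using m mL by simp
  have mL2: "m\<^sup>2 / L\<^sup>2 \<le> 1" "m\<^sup>2 / L\<^sup>2 > 0" using m mL L by (auto simp: power_mono)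
  have a: "\<alpha> > 0" using m L by (simp add: \<alpha>_def)
  have "\<exists>!x. x - \<alpha> *\<^sub>R grad H x = x"
  proof (rule banach_fix_type)
    show "0 \<le> c" "c < 1" using mL2 by (auto simp: c_def)
    show "\<forall>x y. dist (x - \<alpha> *\<^sub>R grad H x) (y - \<alpha> *\<^sub>R grad H y) \<le> c * dist x y"
    proof (intro allI)
      fix x y
      let ?d = "x - y" and ?g = "grad H x - grad H y"
      have "(norm (?d - \<alpha> *\<^sub>R ?g))\<^sup>2 = (norm ?d)\<^sup>2 - 2 * \<alpha> * inner ?g ?d + \<alpha>\<^sup>2 * (norm ?g)\<^sup>2"
        unfolding power2_norm_eq_inner
        by (simp add: inner_diff_left inner_diff_right inner_commute algebra_simps power2_eq_square)
      also have "\<dots> \<le> (norm ?d)\<^sup>2 - 2 * \<alpha> * (m * (norm ?d)\<^sup>2) + \<alpha>\<^sup>2 * (L * norm ?d)\<^sup>2"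
        using a S_class_strong_mono[of x y] S_class_Lipschitz[of x y]
        by (intro add_mono diff_mono mult_left_mono power_mono) auto
      also have "\<dots> = (c * norm ?d)\<^sup>2"
      proof -
        have "\<alpha> * m = m\<^sup>2 / L\<^sup>2" "\<alpha>\<^sup>2 * L\<^sup>2 = m\<^sup>2 / L\<^sup>2" "c\<^sup>2 = 1 - m\<^sup>2 / L\<^sup>2"
          using mL2 L by (simp_all add: \<alpha>_def c_def power2_eq_square)
        then have "(c * norm ?d)\<^sup>2 = (norm ?d)\<^sup>2 - 2 * (\<alpha> * m) * (norm ?d)\<^sup>2 + (\<alpha>\<^sup>2 * L\<^sup>2) * (norm ?d)\<^sup>2"
          unfolding power_mult_distrib by (simp add: left_diff_distrib)
        then show ?thesis by (simp add: power_mult_distrib mult.assoc)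
      qed
      finally have "norm (?d - \<alpha> *\<^sub>R ?g) \<le> c * norm ?d"
        by (rule power2_le_imp_le) (use mL2 in \<open>simp add: c_def\<close>)
      then show "dist (x - \<alpha> *\<^sub>R grad H x) (y - \<alpha> *\<^sub>R grad H y) \<le> c * dist x y"
        unfolding dist_norm by (simp add: algebra_simps)
    qed
  qed
  then show ?thesis using a by auto
qed

text \<open>At a zero of the gradient the strong convexity bound has no linear term, so that point
  is the unique minimizer and the description picks it.\<close>

lemma grad_minimizer: "grad H (minimizer H) = 0"
proof -
  obtain z where z: "grad H z = 0" using S_class_grad_zero by blast
  have quad: "H x \<ge> H z + m / 2 * (norm (x - z))\<^sup>2" for x
    using S_class_lower[of z x] z by simp
  have "minimizer H = z"
    unfolding minimizer_def
  proof (rule the_equality)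
    show "\<forall>x. H z \<le> H x"
    proof
      fix x
      have "0 \<le> m / 2 * (norm (x - z))\<^sup>2" using m by simp
      then show "H z \<le> H x" using quad[of x] by linarith
    qed
    fix z' assume "\<forall>x. H z' \<le> H x"
    then have "H z' \<le> H z" by blast
    then have "m / 2 * (norm (z' - z))\<^sup>2 \<le> 0" using quad[of z'] by linarith
    then show "z' = z" using m by (simp add: mult_le_0_iff)
  qed
  with z show ?thesis by simp
qed

text \<open>The static map that \<open>Delta\<close> applies at each time. It is the gradient of
  \<open>H\<close> recentred at its minimizer with the curvature \<open>m\<close> removed, hence it
  vanishes at the origin.\<close>

definition slope :: "'a \<Rightarrow> 'a" where
  "slope x = grad H (x + minimizer H) - m *\<^sub>R x"

lemma Delta_eq_slope: "Delta m H y k = slope (y k)"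
  by (simp add: Delta_def slope_def)

lemma slope_zero: "slope 0 = 0"
  by (simp add: slope_def grad_minimizer)

lemma slope_Lipschitz: "norm (slope x - slope y) \<le> (L + m) * norm (x - y)"
proof -
  have "slope x - slope y = (grad H (x + minimizer H) - grad H (y + minimizer H)) - m *\<^sub>R (x - y)"
    by (simp add: slope_def algebra_simps)
  also have "norm \<dots> \<le> L * norm (x - y) + m * norm (x - y)"
    using S_class_Lipschitz[of "x + minimizer H" "y + minimizer H"] m
      norm_triangle_ineq4[of "grad H (x + minimizer H) - grad H (y + minimizer H)" "m *\<^sub>R (x - y)"]
    by simp
  finally show ?thesis by (simp add: algebra_simps)
qed

text \<open>Here \<open>h\<close> is convex with an (L - m)-Lipschitz gradient, and this is the
  interpolation inequality of that class. Multiplying by \<open>L - m\<close> instead of dividing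
  keeps it meaningful for \<open>L = m\<close>.\<close>

lemma slope_interpolation:
  defines "h \<equiv> \<lambda>x. H (x + minimizer H) - m / 2 * (norm x)\<^sup>2"
  shows "(L - m) * (h y - h x - inner (slope x) (y - x)) \<ge> (norm (slope y - slope x))\<^sup>2 / 2"
proof -
  have expand: "m / 2 * (norm b)\<^sup>2 = m / 2 * (norm a)\<^sup>2 + m * inner a (b - a) + m / 2 * (norm (b - a))\<^sup>2"
    for a b :: 'a
    unfolding power2_norm_eq_inner by (simp add: inner_diff_left inner_diff_right inner_commute algebra_simps)
  have lower: "h b \<ge> h a + inner (slope a) (b - a)" for a b
    using S_class_lower[of "a + minimizer H" "b + minimizer H"] expand[of b a]
    unfolding h_def slope_def inner_diff_left inner_scaleR_left left_diff_distrib diff_divide_distrib add_diff_cancel_right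
    by linarith
  have upper: "h b \<le> h a + inner (slope a) (b - a) + (L - m) / 2 * (norm (b - a))\<^sup>2" for a b
    using S_class_upper[of "b + minimizer H" "a + minimizer H"] expand[of b a]
    unfolding h_def slope_def inner_diff_left inner_scaleR_left left_diff_distrib diff_divide_distrib add_diff_cancel_right
    by linarith
  define \<delta> where "\<delta> = slope y - slope x"
  show ?thesis
  proof (cases "L = m")
    case True
    \<comment> \<open>For \<open>L = m\<close> the left side is 0, so \<open>slope\<close> must be
      constant. Indeed equal monotonicity and Lipschitz constants force
      \<open>?g = m *\<^sub>R (y - x)\<close>.\<close>
    let ?g = "grad H (y + minimizer H) - grad H (x + minimizer H)"
    have "(norm \<delta>)\<^sup>2 = (norm (?g - m *\<^sub>R (y - x)))\<^sup>2"
      by (simp add: \<delta>_def slope_def algebra_simps)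
    also have "\<dots> = (norm ?g)\<^sup>2 - 2 * m * inner ?g (y - x) + m\<^sup>2 * (norm (y - x))\<^sup>2"
      unfolding power2_norm_eq_inner
      by (simp add: inner_diff_left inner_diff_right inner_commute algebra_simps power2_eq_square)
    also have "\<dots> \<le> (m * norm (y - x))\<^sup>2 - 2 * m * (m * (norm (y - x))\<^sup>2) + m\<^sup>2 * (norm (y - x))\<^sup>2"
      using m True S_class_Lipschitz[of "y + minimizer H" "x + minimizer H"]
        S_class_strong_mono[of "y + minimizer H" "x + minimizer H"]
      by (intro add_mono diff_mono mult_left_mono power_mono) auto
    also have "\<dots> = 0" by (simp add: power_mult_distrib power2_eq_square)
    finally show ?thesis using True by (simp add: \<delta>_def)
  next
    case False
    define c where "c = L - m"
    have c: "c > 0" using False mL by (simp add: c_def)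
    \<comment> \<open>The tangent at \<open>x\<close> lies below \<open>h\<close> and the parabola
      at \<open>y\<close> lies above it; \<open>?z\<close> is the point where the parabola minus the
      tangent is smallest.\<close>
    let ?z = "y - (1 / c) *\<^sub>R \<delta>"
    have zx: "?z - x = (y - x) - (1 / c) *\<^sub>R \<delta>" by simp
    have "h x + inner (slope x) (y - x) - inner (slope x) \<delta> / c \<le> h ?z"
      using lower[of x ?z] unfolding zx by (simp add: inner_diff_right)
    also have "\<dots> \<le> h y - inner (slope y) \<delta> / c + c / 2 * (norm ((1 / c) *\<^sub>R \<delta>))\<^sup>2"
      using upper[of ?z y] by (simp add: c_def)
    also have "c / 2 * (norm ((1 / c) *\<^sub>R \<delta>))\<^sup>2 = (norm \<delta>)\<^sup>2 / (2 * c)"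
      using c by (simp add: power_divide power2_eq_square)
    finally have "h y - h x - inner (slope x) (y - x) \<ge>
        (inner (slope y) \<delta> - inner (slope x) \<delta>) / c - (norm \<delta>)\<^sup>2 / (2 * c)"
      by (simp add: diff_divide_distrib)
    also have "inner (slope y) \<delta> - inner (slope x) \<delta> = (norm \<delta>)\<^sup>2"
      by (simp add: \<delta>_def power2_norm_eq_inner inner_diff_left)
    also have "(norm \<delta>)\<^sup>2 / c - (norm \<delta>)\<^sup>2 / (2 * c) = (norm \<delta>)\<^sup>2 / 2 / c"
      using c by (simp add: field_simps)
    finally have "(norm \<delta>)\<^sup>2 / 2 \<le> (h y - h x - inner (slope x) (y - x)) * c"
      using c by (subst (asm) pos_divide_le_eq) auto
    then show ?thesis unfolding \<delta>_def c_def by (simp only: mult.commute)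
  qed
qed

text \<open>Expanding the square in the interpolation inequality distributes it over the two points,
  and subtracting half the squared slope from \<open>(L - m) * h\<close> makes each share part of
  \<open>\<psi>\<close>. The result is a subgradient inequality: in the variable
  \<open>(L - m) *\<^sub>R x - slope x\<close>, the vector \<open>slope x\<close> is a subgradient
  for the values \<open>\<psi>\<close>. Nonnegativity is the case of base point 0, where the slope
  vanishes.\<close>

lemma slope_storage:
  obtains \<psi> :: "'a \<Rightarrow> real" where "\<And>x. \<psi> x \<ge> 0" and "\<psi> 0 = 0"
    and "\<And>x y. inner (slope x) (((L - m) *\<^sub>R x - slope x) - ((L - m) *\<^sub>R y - slope y)) \<ge> \<psi> x - \<psi> y"
proof -
  define h where "h x = H (x + minimizer H) - m / 2 * (norm x)\<^sup>2" for x
  define \<psi> where "\<psi> x = (L - m) * (h x - h 0) - (norm (slope x))\<^sup>2 / 2" for x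
  have main: "inner (slope x) (((L - m) *\<^sub>R x - slope x) - ((L - m) *\<^sub>R y - slope y)) \<ge> \<psi> x - \<psi> y" for x y
  proof -
    have "(norm (slope y - slope x))\<^sup>2 / 2 = (norm (slope y))\<^sup>2 / 2 - inner (slope x) (slope y) + (norm (slope x))\<^sup>2 / 2"
      unfolding power2_norm_eq_inner by (simp add: inner_diff_left inner_diff_right inner_commute field_simps)
    then show ?thesis
      using slope_interpolation[of y x, folded h_def] unfolding \<psi>_def
      by (simp add: inner_diff_left inner_diff_right right_diff_distrib power2_norm_eq_inner algebra_simps)
  qed
  show thesis
  proof
    show "\<psi> 0 = 0" by (simp add: \<psi>_def slope_zero)
    then show "\<psi> x \<ge> 0" for x using main[of 0 x] by (simp add: slope_zero)
  qed (rule main)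
qed

end

section \<open>The finite-horizon Zames--Falb inequality\<close>

text \<open>The value 0 before time 0 is the initial content of the filter.\<close>

definition delayed :: "(nat \<Rightarrow> 'a::zero) \<Rightarrow> nat \<Rightarrow> nat \<Rightarrow> 'a" where
  "delayed u k j = (if j \<le> k then u (k - j) else 0)"

lemma delayed_Suc: "delayed u (Suc k) (Suc j) = delayed u k j"
  by (simp add: delayed_def)

lemma delayed_zero: "delayed u k 0 = u k"
  by (simp add: delayed_def)

lemma delayed_initial: "j > 0 \<Longrightarrow> delayed u 0 j = 0"
  by (simp add: delayed_def)

context
  fixes u v :: "nat \<Rightarrow> 'a::real_inner" and s :: "nat \<Rightarrow> real"
  assumes s_nonneg: "\<And>i. s i \<ge> 0"
    and diss: "\<And>i j. inner (v i) (u i - u j) \<ge> s i - s j"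
    and diss0: "\<And>i. inner (v i) (u i) \<ge> s i"
begin

text \<open>Each term loses \<open>s k\<close> and gains the delayed \<open>s\<close>. The delayed
  values add up to a shorter partial sum of \<open>s\<close>, which is no larger because
  \<open>s\<close> is nonnegative. Times before the delay has elapsed are covered by
  \<open>diss0\<close>.\<close>

lemma sum_delayed_input_le:
  "(\<Sum>k<T. inner (v k) (delayed u k j)) \<le> (\<Sum>k<T. inner (v k) (u k))"
proof -
  have "inner (v k) (delayed u k j) \<le> inner (v k) (u k) - s k + delayed s k j" for k
    using diss[of k "k - j"] diss0[of k] by (simp add: delayed_def inner_diff_right)
  then have "(\<Sum>k<T. inner (v k) (delayed u k j)) \<le> (\<Sum>k<T. inner (v k) (u k)) - (\<Sum>k<T. s k) + (\<Sum>k<T. delayed s k j)"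
    unfolding sum_subtractf[symmetric] sum.distrib[symmetric] by (intro sum_mono)
  moreover have "(\<Sum>k<T. delayed s k j) \<le> (\<Sum>k<T. s k)"
  proof -
    have "(\<Sum>k<T. delayed s k j) = (\<Sum>k\<in>{j..<T}. s (k - j))"
      unfolding delayed_def by (subst sum.inter_filter[symmetric]) (auto intro!: sum.cong)
    also have "\<dots> = (\<Sum>i<T - j. s i)"
      by (rule sum.reindex_bij_witness[of _ "\<lambda>i. i + j" "\<lambda>k. k - j"]) auto
    also have "\<dots> \<le> (\<Sum>k<T. s k)" using s_nonneg by (intro sum_mono2) auto
    finally show ?thesis .
  qed
  ultimately show ?thesis by simp
qed

text \<open>Now the dissipation inequality is used at the earlier time \<open>k - j\<close> against
  the input at \<open>k\<close>. Besides \<open>s\<close> also the products are shifted, so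
  extending the shorter sum to the full horizon uses that \<open>inner (v i) (u i) - s i\<close> is
  nonnegative.\<close>

lemma sum_delayed_output_le:
  "(\<Sum>k<T. inner (u k) (delayed v k j)) \<le> (\<Sum>k<T. inner (v k) (u k))"
proof -
  have nn: "inner (v i) (u i) - s i \<ge> 0" for i using diss0[of i] by simp
  have "inner (u k) (delayed v k j) \<le> delayed (\<lambda>i. inner (v i) (u i) - s i) k j + (if j \<le> k then s k else 0)" for k
    using diss[of "k - j" k] by (simp add: delayed_def inner_diff_right inner_commute)
  then have "(\<Sum>k<T. inner (u k) (delayed v k j)) \<le>
      (\<Sum>k<T. delayed (\<lambda>i. inner (v i) (u i) - s i) k j) + (\<Sum>k<T. if j \<le> k then s k else 0)"
    unfolding sum.distrib[symmetric] by (intro sum_mono)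
  also have "(\<Sum>k<T. delayed (\<lambda>i. inner (v i) (u i) - s i) k j) = (\<Sum>k\<in>{j..<T}. inner (v (k - j)) (u (k - j)) - s (k - j))"
    unfolding delayed_def by (subst sum.inter_filter[symmetric]) (auto intro!: sum.cong)
  also have "\<dots> = (\<Sum>i<T - j. inner (v i) (u i) - s i)"
    by (rule sum.reindex_bij_witness[of _ "\<lambda>i. i + j" "\<lambda>k. k - j"]) auto
  also have "\<dots> \<le> (\<Sum>i<T. inner (v i) (u i) - s i)" using nn by (intro sum_mono2) auto
  also have "(\<Sum>k<T. if j \<le> k then s k else 0) \<le> (\<Sum>k<T. s k)" using s_nonneg by (intro sum_mono) auto
  finally show ?thesis by (simp add: sum_subtractf)
qed

text \<open>Every delayed correlation is at most the undelayed one \<open>S\<close>, and the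
  coefficients \<open>a\<close>, \<open>b\<close> are nonpositive, so replacing all correlations by
  \<open>S\<close> only decreases the sum; \<open>dom\<close> makes the remaining multiple of
  \<open>S\<close> nonnegative.\<close>

lemma zames_falb_nonneg:
  assumes a: "\<And>i. i < lm \<Longrightarrow> a i \<le> 0" and b: "\<And>i. i < lp \<Longrightarrow> b i \<le> 0"
    and dom: "c + (\<Sum>i<lm. a i) + (\<Sum>i<lp. b i) \<ge> 0"
  shows "(\<Sum>k<T. c * inner (v k) (u k) + (\<Sum>i<lm. a i * inner (v k) (delayed u k (d i)))
           + (\<Sum>i<lp. b i * inner (u k) (delayed v k (e i)))) \<ge> 0"
proof -
  define S where "S = (\<Sum>k<T. inner (v k) (u k))"
  have S: "S \<ge> 0" unfolding S_def
    using diss0 s_nonneg by (intro sum_nonneg) (meson order.trans)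
  have "(\<Sum>k<T. c * inner (v k) (u k) + (\<Sum>i<lm. a i * inner (v k) (delayed u k (d i)))
           + (\<Sum>i<lp. b i * inner (u k) (delayed v k (e i))))
      = c * S + (\<Sum>i<lm. a i * (\<Sum>k<T. inner (v k) (delayed u k (d i))))
           + (\<Sum>i<lp. b i * (\<Sum>k<T. inner (u k) (delayed v k (e i))))"
    unfolding S_def sum.distrib sum_distrib_left by (simp add: sum.swap[of _ _ "{..<T}"])
  also have "\<dots> \<ge> c * S + (\<Sum>i<lm. a i * S) + (\<Sum>i<lp. b i * S)"
    using a b unfolding S_def
    by (intro add_mono order.refl sum_mono mult_left_mono_neg[OF sum_delayed_input_le]
        mult_left_mono_neg[OF sum_delayed_output_le]) auto
  also have "c * S + (\<Sum>i<lm. a i * S) + (\<Sum>i<lp. b i * S) = (c + (\<Sum>i<lm. a i) + (\<Sum>i<lp. b i)) * S"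
    by (simp add: distrib_right sum_distrib_right)
  finally show ?thesis using dom S by (meson mult_nonneg_nonneg order.trans)
qed

end

section \<open>Block matrices\<close>

lemma append_cols_carrier [simp, intro]:
  "X \<in> carrier_mat r c1 \<Longrightarrow> Y \<in> carrier_mat r c2 \<Longrightarrow> X @\<^sub>c Y \<in> carrier_mat r (c1 + c2)"
  unfolding append_cols_def using four_block_carrier_mat[of X r c1 "0\<^sub>m 0 (dim_col Y)" 0 c2] by auto

lemma append_cols_mult_vec:
  assumes "X \<in> carrier_mat r c1" "Y \<in> carrier_mat r c2" "a \<in> carrier_vec c1" "b \<in> carrier_vec c2"
  shows "(X @\<^sub>c Y) *\<^sub>v (a @\<^sub>v b) = X *\<^sub>v a + Y *\<^sub>v b"
  unfolding append_cols_def
  by (subst four_block_mat_mult_vec[of X r c1 Y c2 _ 0]) (use assms in \<open>auto intro!: eq_vecI\<close>)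

lemma append_cols_index:
  assumes "X \<in> carrier_mat r c1" "Y \<in> carrier_mat r c2" "i < r" "j < c1 + c2"
  shows "(X @\<^sub>c Y) $$ (i, j) = (if j < c1 then X $$ (i, j) else Y $$ (i, j - c1))"
  using assms unfolding append_cols_def by (subst index_mat_four_block) auto

lemma append_vec_assoc: "(u @\<^sub>v v) @\<^sub>v w = u @\<^sub>v (v @\<^sub>v w)"
  by (intro eq_vecI) auto

lemma zero_append_zero_vec: "0\<^sub>v a @\<^sub>v 0\<^sub>v b = (0\<^sub>v (a + b) :: 'a::zero Matrix.vec)"
  by (intro eq_vecI) auto

text \<open>A stack of \<open>l\<close> blocks of size \<open>p\<close>, indexed by block number and
  offset; this is the form in which the Kronecker products with an identity on the right act
  transparently.\<close>

definition block_vec :: "nat \<Rightarrow> nat \<Rightarrow> (nat \<Rightarrow> nat \<Rightarrow> real) \<Rightarrow> real Matrix.vec" where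
  "block_vec p l f = Matrix.vec (l * p) (\<lambda>i. f (i div p) (i mod p))"

lemma block_vec_carrier [simp, intro]: "block_vec p l f \<in> carrier_vec (l * p)"
  by (simp add: block_vec_def)

lemma dim_block_vec [simp]: "dim_vec (block_vec p l f) = l * p"
  by (simp add: block_vec_def)

lemma block_vec_index: "i < l * p \<Longrightarrow> block_vec p l f $ i = f (i div p) (i mod p)"
  by (simp add: block_vec_def)

lemma block_index_div: "(i::nat) < l * p \<Longrightarrow> i div p < l"
  by (simp add: less_mult_imp_div_less)

lemma block_index_mod: "(i::nat) < l * p \<Longrightarrow> i mod p < p"
  by (cases "p = 0") auto

lemma block_vec_cong:
  assumes "\<And>j r. j < l \<Longrightarrow> r < p \<Longrightarrow> f j r = g j r"
  shows "block_vec p l f = block_vec p l g"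
  using assms by (intro eq_vecI) (auto simp: block_vec_index block_index_div block_index_mod)

lemma block_vec_append: "block_vec p (a + b) f = block_vec p a f @\<^sub>v block_vec p b (\<lambda>i. f (a + i))"
proof (intro eq_vecI)
  fix i assume "i < dim_vec (block_vec p a f @\<^sub>v block_vec p b (\<lambda>i. f (a + i)))"
  then have i: "i < (a + b) * p" by (simp add: distrib_right)
  show "block_vec p (a + b) f $ i = (block_vec p a f @\<^sub>v block_vec p b (\<lambda>i. f (a + i))) $ i"
  proof (cases "i < a * p")
    case False
    then obtain j where j: "i = a * p + j" by (metis le_Suc_ex not_less)
    have p: "p > 0" using i by (cases p) auto
    have "j < b * p" using i j by (simp add: distrib_right)
    then show ?thesis using i j p by (simp add: block_vec_index)
  qed (use i in \<open>simp add: block_vec_index\<close>)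
qed (simp add: distrib_right)

lemma block_vec_one: "v \<in> carrier_vec p \<Longrightarrow> v = block_vec p 1 (\<lambda>_ r. v $ r)"
  by (intro eq_vecI) (auto simp: block_vec_index)

lemma block_vec_zero: "block_vec p l (\<lambda>_ _. 0) = 0\<^sub>v (l * p)"
  by (intro eq_vecI) (auto simp: block_vec_index)

lemma block_vec_add: "block_vec p l f + block_vec p l g = block_vec p l (\<lambda>j r. f j r + g j r)"
  by (intro eq_vecI) (auto simp: block_vec_index)

lemma sum_blocks: "(\<Sum>i<l * p. f i) = (\<Sum>j<l. \<Sum>r<p. f (j * p + r :: nat) :: real)"
proof -
  have "(\<Sum>i<l * p. f i) = (\<Sum>j<l. sum f {j * p..<j * p + p})"
    by (simp add: sum.nat_group)
  also have "\<dots> = (\<Sum>j<l. \<Sum>r<p. f (j * p + r))"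
  proof (rule sum.cong[OF refl])
    fix j show "sum f {j * p..<j * p + p} = (\<Sum>r<p. f (j * p + r))"
      by (rule sum.reindex_bij_witness[of _ "\<lambda>r. j * p + r" "\<lambda>i. i - j * p"]) auto
  qed
  finally show ?thesis .
qed

lemma scalar_prod_block_vec:
  "scalar_prod (block_vec p l f) (block_vec p l g) = (\<Sum>j<l. \<Sum>r<p. f j r * g j r)"
proof -
  have "scalar_prod (block_vec p l f) (block_vec p l g) = (\<Sum>i<l * p. f (i div p) (i mod p) * g (i div p) (i mod p))"
    by (auto simp: scalar_prod_def block_vec_index lessThan_atLeast0 intro!: sum.cong)
  then show ?thesis by (simp add: sum_blocks)
qed

lemma kronecker_one_carrier [simp, intro]:
  "X \<in> carrier_mat a b \<Longrightarrow> X \<otimes>\<^sub>k 1\<^sub>m p \<in> carrier_mat (a * p) (b * p)"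
  by (auto simp: kronecker_def)

text \<open>The identity factor forces equal offsets, so only the block numbers are mixed, with the
  coefficients of \<open>X\<close>.\<close>

lemma kronecker_one_mult_block_vec:
  assumes X: "X \<in> carrier_mat a b"
  shows "(X \<otimes>\<^sub>k 1\<^sub>m p) *\<^sub>v block_vec p b f = block_vec p a (\<lambda>i r. \<Sum>j<b. X $$ (i, j) * f j r)"
proof (intro eq_vecI)
  fix i assume "i < dim_vec (block_vec p a (\<lambda>i r. \<Sum>j<b. X $$ (i, j) * f j r))"
  then have i: "i < a * p" by simp
  have mod: "i mod p < p" using i by (rule block_index_mod)
  have "((X \<otimes>\<^sub>k 1\<^sub>m p) *\<^sub>v block_vec p b f) $ i
      = (\<Sum>k<b * p. X $$ (i div p, k div p) * (1\<^sub>m p) $$ (i mod p, k mod p) * f (k div p) (k mod p))"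
    using X i by (auto simp: scalar_prod_def kronecker_def block_vec_index lessThan_atLeast0 intro!: sum.cong)
  also have "\<dots> = (\<Sum>j<b. \<Sum>r<p. X $$ (i div p, j) * (if i mod p = r then 1 else 0) * f j r)"
    unfolding sum_blocks using mod by (intro sum.cong refl) auto
  also have "\<dots> = (\<Sum>j<b. X $$ (i div p, j) * f j (i mod p))"
    using mod by (intro sum.cong refl) (simp add: if_distrib[of "\<lambda>x. _ * x * _"] cong: if_cong)
  finally show "((X \<otimes>\<^sub>k 1\<^sub>m p) *\<^sub>v block_vec p b f) $ i = block_vec p a (\<lambda>i r. \<Sum>j<b. X $$ (i, j) * f j r) $ i"
    using i by (simp add: block_vec_index)
qed (use X in \<open>auto simp: kronecker_def\<close>)

section \<open>The filter\<close>

lemma shift_filter_step: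
  "A_Delta p lp lm *\<^sub>v (block_vec p lm f @\<^sub>v block_vec p lp g) =
     block_vec p lm (\<lambda>i r. if i + 1 < lm then f (i + 1) r else 0) @\<^sub>v
     block_vec p lp (\<lambda>i r. if i + 1 < lp then g (i + 1) r else 0)"
proof -
  define h where "h i = (if i < lm then f i else g (i - lm))" for i
  let ?X = "four_block_mat (shift_mat lm) (0\<^sub>m lm lp) (0\<^sub>m lp lm) (shift_mat lp)"
  have X: "?X \<in> carrier_mat (lm + lp) (lm + lp)" by (auto simp: shift_mat_def)
  have fg: "block_vec p lm f @\<^sub>v block_vec p lp g = block_vec p (lm + lp) h"
    unfolding block_vec_append by (intro arg_cong2[of _ _ _ _ append_vec] block_vec_cong) (auto simp: h_def)
  \<comment> \<open>Two shifts on the diagonal are one long shift with the single entry across the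
    boundary removed, so both delay lines can be treated as one.\<close>
  have entry: "?X $$ (i, j) = (if j = i + 1 \<and> i + 1 \<noteq> lm then 1 else 0)" if "i < lm + lp" "j < lm + lp" for i j
    using that by (auto simp: shift_mat_def)
  have "A_Delta p lp lm *\<^sub>v (block_vec p lm f @\<^sub>v block_vec p lp g) =
      block_vec p (lm + lp) (\<lambda>i r. \<Sum>j<lm + lp. ?X $$ (i, j) * h j r)"
    unfolding A_Delta_def fg by (rule kronecker_one_mult_block_vec[OF X])
  also have "\<dots> = block_vec p (lm + lp) (\<lambda>i r. if i + 1 \<noteq> lm \<and> i + 1 < lm + lp then h (i + 1) r else 0)"
  proof (rule block_vec_cong)
    fix i r assume "i < lm + lp"
    then have "(\<Sum>j<lm + lp. ?X $$ (i, j) * h j r) = (\<Sum>j<lm + lp. if j = i + 1 then (if i + 1 \<noteq> lm then h j r else 0) else 0)"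
      by (intro sum.cong refl) (subst entry, auto)
    also have "\<dots> = (if i + 1 \<noteq> lm \<and> i + 1 < lm + lp then h (i + 1) r else 0)"
      by (subst sum.delta) auto
    finally show "(\<Sum>j<lm + lp. ?X $$ (i, j) * h j r) = (if i + 1 \<noteq> lm \<and> i + 1 < lm + lp then h (i + 1) r else 0)" .
  qed
  also have "\<dots> = block_vec p lm (\<lambda>i r. if i + 1 < lm then f (i + 1) r else 0) @\<^sub>v
      block_vec p lp (\<lambda>i r. if i + 1 < lp then g (i + 1) r else 0)"
    unfolding block_vec_append by (intro arg_cong2[of _ _ _ _ append_vec] block_vec_cong) (auto simp: h_def)
  finally show ?thesis .
qed

lemma last_unit_kronecker:
  assumes "v \<in> carrier_vec p"
  shows "(last_unit l \<otimes>\<^sub>k 1\<^sub>m p) *\<^sub>v v = block_vec p l (\<lambda>i r. if i + 1 = l then v $ r else 0)"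
proof -
  have "(last_unit l \<otimes>\<^sub>k 1\<^sub>m p) *\<^sub>v block_vec p 1 (\<lambda>_ r. v $ r)
      = block_vec p l (\<lambda>i r. \<Sum>j<1. last_unit l $$ (i, j) * v $ r)"
    by (rule kronecker_one_mult_block_vec) (auto simp: last_unit_def)
  also have "\<dots> = block_vec p l (\<lambda>i r. if i + 1 = l then v $ r else 0)"
    by (rule block_vec_cong) (auto simp: last_unit_def)
  finally show ?thesis using block_vec_one[OF assms] by simp
qed

lemma flip_kronecker:
  "(flip_mat l \<otimes>\<^sub>k 1\<^sub>m p) *\<^sub>v block_vec p l f = block_vec p l (\<lambda>i. f (l - 1 - i))"
proof -
  have "(flip_mat l \<otimes>\<^sub>k 1\<^sub>m p) *\<^sub>v block_vec p l f = block_vec p l (\<lambda>i r. \<Sum>j<l. flip_mat l $$ (i, j) * f j r)"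
    by (rule kronecker_one_mult_block_vec) (auto simp: flip_mat_def)
  also have "\<dots> = block_vec p l (\<lambda>i. f (l - 1 - i))"
  proof (rule block_vec_cong)
    fix i r assume i: "i < l"
    then have "(\<Sum>j<l. flip_mat l $$ (i, j) * f j r) = (\<Sum>j<l. if j = l - 1 - i then f j r else 0)"
      by (intro sum.cong refl) (auto simp: flip_mat_def)
    also have "\<dots> = f (l - 1 - i) r" using i by (subst sum.delta) auto
    finally show "(\<Sum>j<l. flip_mat l $$ (i, j) * f j r) = f (l - 1 - i) r" .
  qed
  finally show ?thesis .
qed

lemma W_hat_carrier [simp, intro]: "W_hat p m L \<in> carrier_mat (p + p) (p + p)"
  unfolding W_hat_def by (rule four_block_carrier_mat) auto

lemma W_hat_mult:
  assumes "y \<in> carrier_vec p" "w \<in> carrier_vec p"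
  shows "W_hat p m L *\<^sub>v (y @\<^sub>v w) = ((L - m) \<cdot>\<^sub>v y - w) @\<^sub>v w"
  unfolding W_hat_def
  by (subst four_block_mat_mult_vec[of _ p p _ p _ p]) (use assms in \<open>auto intro!: eq_vecI arg_cong2[of _ _ _ _ append_vec]\<close>)

lemma B_Delta_carrier [simp, intro]: "B_Delta p lp lm m L \<in> carrier_mat (lm * p + lp * p) (p + p)"
  unfolding B_Delta_def
  by (rule mult_carrier_mat[OF four_block_carrier_mat W_hat_carrier])
    (use kronecker_one_carrier[of "last_unit lm" lm 1 p] kronecker_one_carrier[of "last_unit lp" lp 1 p]
      in \<open>auto simp: last_unit_def\<close>)

lemma B_Delta_mult:
  assumes y: "y \<in> carrier_vec p" and w: "w \<in> carrier_vec p"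
  shows "B_Delta p lp lm m L *\<^sub>v (y @\<^sub>v w) =
     block_vec p lm (\<lambda>i r. if i + 1 = lm then ((L - m) \<cdot>\<^sub>v y - w) $ r else 0) @\<^sub>v
     block_vec p lp (\<lambda>i r. if i + 1 = lp then w $ r else 0)"
proof -
  have e: "last_unit l \<otimes>\<^sub>k 1\<^sub>m p \<in> carrier_mat (l * p) p" for l
    using kronecker_one_carrier[of "last_unit l" l 1 p] by (auto simp: last_unit_def)
  let ?u = "(L - m) \<cdot>\<^sub>v y - w"
  have u: "?u \<in> carrier_vec p" using y w by auto
  have "B_Delta p lp lm m L *\<^sub>v (y @\<^sub>v w) =
     four_block_mat (last_unit lm \<otimes>\<^sub>k 1\<^sub>m p) (0\<^sub>m (lm * p) p) (0\<^sub>m (lp * p) p) (last_unit lp \<otimes>\<^sub>k 1\<^sub>m p) *\<^sub>v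
       (?u @\<^sub>v w)"
    unfolding B_Delta_def
    by (subst assoc_mult_mat_vec[of _ "lm * p + lp * p" "p + p" _ "p + p"])
      (use y w e[of lm] e[of lp] in \<open>auto simp: W_hat_mult intro!: four_block_carrier_mat\<close>)
  also have "\<dots> = ((last_unit lm \<otimes>\<^sub>k 1\<^sub>m p) *\<^sub>v ?u + 0\<^sub>m (lm * p) p *\<^sub>v w) @\<^sub>v
      (0\<^sub>m (lp * p) p *\<^sub>v ?u + (last_unit lp \<otimes>\<^sub>k 1\<^sub>m p) *\<^sub>v w)"
    by (rule four_block_mat_mult_vec[of _ "lm * p" p _ p _ "lp * p"]) (use u w e in auto)
  also have "(last_unit lm \<otimes>\<^sub>k 1\<^sub>m p) *\<^sub>v ?u + 0\<^sub>m (lm * p) p *\<^sub>v w = (last_unit lm \<otimes>\<^sub>k 1\<^sub>m p) *\<^sub>v ?u"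
    using u w e[of lm] by (intro eq_vecI) auto
  also have "0\<^sub>m (lp * p) p *\<^sub>v ?u + (last_unit lp \<otimes>\<^sub>k 1\<^sub>m p) *\<^sub>v w = (last_unit lp \<otimes>\<^sub>k 1\<^sub>m p) *\<^sub>v w"
    using u w e[of lp] by (intro eq_vecI) auto
  finally show ?thesis by (simp add: last_unit_kronecker[OF u] last_unit_kronecker[OF w])
qed

lemma append_rows6_mult_vec:
  assumes 1: "X1 \<in> carrier_mat r1 c" and 2: "X2 \<in> carrier_mat r2 c" and 3: "X3 \<in> carrier_mat r3 c"
    and 4: "X4 \<in> carrier_mat r4 c" and 5: "X5 \<in> carrier_mat r5 c" and 6: "X6 \<in> carrier_mat r6 c"
    and v: "v \<in> carrier_vec c"
  shows "(X1 @\<^sub>r X2 @\<^sub>r X3 @\<^sub>r X4 @\<^sub>r X5 @\<^sub>r X6) *\<^sub>v v =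
    X1 *\<^sub>v v @\<^sub>v X2 *\<^sub>v v @\<^sub>v X3 *\<^sub>v v @\<^sub>v X4 *\<^sub>v v @\<^sub>v X5 *\<^sub>v v @\<^sub>v X6 *\<^sub>v v"
proof -
  note c5 = carrier_append_rows[OF 5 6]
  note c4 = carrier_append_rows[OF 4 c5]
  note c3 = carrier_append_rows[OF 3 c4]
  note c2 = carrier_append_rows[OF 2 c3]
  show ?thesis
    unfolding mat_mult_append[OF 1 c2 v] mat_mult_append[OF 2 c3 v] mat_mult_append[OF 3 c4 v]
      mat_mult_append[OF 4 c5 v] mat_mult_append[OF 5 6 v] ..
qed

lemma C_Delta_carrier [simp, intro]:
  "C_Delta p lp lm \<in> carrier_mat (p + (p + (lm * p + (p + (p + lp * p))))) (lm * p + lp * p)"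
  unfolding C_Delta_def
  by (intro carrier_append_rows append_cols_carrier zero_carrier_mat one_carrier_mat kronecker_one_carrier)
    (simp add: flip_mat_def)

lemma C_Delta_mult:
  "C_Delta p lp lm *\<^sub>v (block_vec p lm f @\<^sub>v block_vec p lp g) =
    0\<^sub>v p @\<^sub>v 0\<^sub>v p @\<^sub>v block_vec p lm f @\<^sub>v 0\<^sub>v p @\<^sub>v 0\<^sub>v p @\<^sub>v block_vec p lp (\<lambda>i. g (lp - 1 - i))"
proof -
  let ?s = "block_vec p lm f" and ?t = "block_vec p lp g"
  let ?x = "?s @\<^sub>v ?t"
  have x: "?x \<in> carrier_vec (lm * p + lp * p)" by auto
  have J: "flip_mat lp \<otimes>\<^sub>k 1\<^sub>m p \<in> carrier_mat (lp * p) (lp * p)"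
    by (rule kronecker_one_carrier) (simp add: flip_mat_def)
  have mult: "(X @\<^sub>c Y) *\<^sub>v ?x = X *\<^sub>v ?s + Y *\<^sub>v ?t"
    if "X \<in> carrier_mat r (lm * p)" "Y \<in> carrier_mat r (lp * p)" for X Y r
    by (rule append_cols_mult_vec[OF that]) auto
  have z: "(0\<^sub>m p (lm * p) @\<^sub>c 0\<^sub>m p (lp * p)) *\<^sub>v ?x = 0\<^sub>v p"
    by (subst mult) (auto intro!: eq_vecI)
  have s: "(1\<^sub>m (lm * p) @\<^sub>c 0\<^sub>m (lm * p) (lp * p)) *\<^sub>v ?x = ?s"
    by (subst mult[of _ "lm * p"]) (auto intro!: eq_vecI)
  have t: "(0\<^sub>m (lp * p) (lm * p) @\<^sub>c (flip_mat lp \<otimes>\<^sub>k 1\<^sub>m p)) *\<^sub>v ?x = block_vec p lp (\<lambda>i. g (lp - 1 - i))"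
    by (subst mult[of _ "lp * p"]) (use J in \<open>auto simp: flip_kronecker intro!: eq_vecI\<close>)
  show ?thesis
    unfolding C_Delta_def
    by (subst append_rows6_mult_vec[of _ p "lm * p + lp * p" _ p _ "lm * p" _ p _ p _ "lp * p"])
      (use J x in \<open>simp_all add: z s t append_cols_carrier\<close>)
qed

lemma D_Delta_carrier [simp, intro]:
  "D_Delta p lp lm m L \<in> carrier_mat (p + (p + (lm * p + (p + (p + lp * p))))) (p + p)"
  unfolding D_Delta_def
  by (rule mult_carrier_mat[OF _ W_hat_carrier])
    (intro carrier_append_rows append_cols_carrier zero_carrier_mat one_carrier_mat)

lemma D_Delta_mult:
  fixes m L :: real
  assumes y: "y \<in> carrier_vec p" and w: "w \<in> carrier_vec p"
  defines "u \<equiv> (L - m) \<cdot>\<^sub>v y - w"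
  shows "D_Delta p lp lm m L *\<^sub>v (y @\<^sub>v w) =
    u @\<^sub>v w @\<^sub>v 0\<^sub>v (lm * p) @\<^sub>v w @\<^sub>v u @\<^sub>v 0\<^sub>v (lp * p)"
proof -
  let ?x = "u @\<^sub>v w"
  have u: "u \<in> carrier_vec p" using y w by (simp add: u_def)
  have x: "?x \<in> carrier_vec (p + p)" using u w by auto
  have mult: "(X @\<^sub>c Y) *\<^sub>v ?x = X *\<^sub>v u + Y *\<^sub>v w"
    if "X \<in> carrier_mat r p" "Y \<in> carrier_mat r p" for X Y r
    by (rule append_cols_mult_vec[OF that]) (use u w in auto)
  have 1: "(1\<^sub>m p @\<^sub>c 0\<^sub>m p p) *\<^sub>v ?x = u"
    by (subst mult[of _ p]) (use u w in \<open>auto intro!: eq_vecI\<close>)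
  have 2: "(0\<^sub>m p p @\<^sub>c 1\<^sub>m p) *\<^sub>v ?x = w"
    by (subst mult[of _ p]) (use u w in \<open>auto intro!: eq_vecI\<close>)
  have 3: "(0\<^sub>m (l * p) p @\<^sub>c 0\<^sub>m (l * p) p) *\<^sub>v ?x = 0\<^sub>v (l * p)" for l
    by (subst mult[of _ "l * p"]) (use u w in \<open>auto intro!: eq_vecI\<close>)
  let ?R = "(1\<^sub>m p @\<^sub>c 0\<^sub>m p p) @\<^sub>r (0\<^sub>m p p @\<^sub>c 1\<^sub>m p) @\<^sub>r (0\<^sub>m (lm * p) p @\<^sub>c 0\<^sub>m (lm * p) p)
     @\<^sub>r (0\<^sub>m p p @\<^sub>c 1\<^sub>m p) @\<^sub>r (1\<^sub>m p @\<^sub>c 0\<^sub>m p p) @\<^sub>r (0\<^sub>m (lp * p) p @\<^sub>c 0\<^sub>m (lp * p) p) :: real mat"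
  have R: "?R \<in> carrier_mat (p + (p + (lm * p + (p + (p + lp * p))))) (p + p)"
    by (intro carrier_append_rows append_cols_carrier zero_carrier_mat one_carrier_mat)
  have "D_Delta p lp lm m L *\<^sub>v (y @\<^sub>v w) = ?R *\<^sub>v (W_hat p m L *\<^sub>v (y @\<^sub>v w))"
    unfolding D_Delta_def by (rule assoc_mult_mat_vec[OF R W_hat_carrier]) (use y w in auto)
  also have "W_hat p m L *\<^sub>v (y @\<^sub>v w) = ?x" unfolding u_def by (rule W_hat_mult[OF y w])
  also have "?R *\<^sub>v ?x = u @\<^sub>v w @\<^sub>v 0\<^sub>v (lm * p) @\<^sub>v w @\<^sub>v u @\<^sub>v 0\<^sub>v (lp * p)"
    by (subst append_rows6_mult_vec[of _ p "p + p" _ p _ "lm * p" _ p _ p _ "lp * p"])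
      (use x in \<open>simp_all add: 1 2 3 append_cols_carrier\<close>)
  finally show ?thesis .
qed

text \<open>The bracketing into three pairs follows the three diagonal blocks of
  \<open>M_Delta\<close>. The flip reverses the second delay line, which stores the oldest value at
  the top, so that its output starts with delay one, as the order of the coefficients in
  \<open>M_+\<close> requires.\<close>

lemma filter_output:
  fixes m L :: real
  assumes y: "y \<in> carrier_vec p" and w: "w \<in> carrier_vec p"
  defines "u \<equiv> (L - m) \<cdot>\<^sub>v y - w"
  shows "C_Delta p lp lm *\<^sub>v (block_vec p lm f @\<^sub>v block_vec p lp g) + D_Delta p lp lm m L *\<^sub>v (y @\<^sub>v w) =
    (u @\<^sub>v w) @\<^sub>v (block_vec p lm f @\<^sub>v w) @\<^sub>v (u @\<^sub>v block_vec p lp (\<lambda>i. g (lp - 1 - i)))"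
proof -
  have u: "u \<in> carrier_vec p" using y w by (simp add: u_def)
  have add: "(a @\<^sub>v b) + (a' @\<^sub>v b') = (a + a') @\<^sub>v (b + b')"
    if "dim_vec a = dim_vec a'" "dim_vec b = dim_vec b'" for a b a' b' :: "real Matrix.vec"
    by (rule append_vec_add[of _ "dim_vec a" _ _ "dim_vec b"]) (use that in \<open>auto intro: carrier_vecI\<close>)
  show ?thesis
    unfolding C_Delta_mult D_Delta_mult[OF y w] u_def[symmetric]
    using u w by (simp add: add append_vec_assoc left_zero_vec[of _ p] right_zero_vec[OF block_vec_carrier])
qed

lemma filter_step:
  fixes m L :: real
  assumes y: "y \<in> carrier_vec p" and w: "w \<in> carrier_vec p"
  defines "u \<equiv> (L - m) \<cdot>\<^sub>v y - w"
  shows "A_Delta p lp lm *\<^sub>v (block_vec p lm f @\<^sub>v block_vec p lp g) + B_Delta p lp lm m L *\<^sub>v (y @\<^sub>v w) =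
    block_vec p lm (\<lambda>i r. if i + 1 < lm then f (i + 1) r else u $ r) @\<^sub>v
    block_vec p lp (\<lambda>i r. if i + 1 < lp then g (i + 1) r else w $ r)"
  unfolding shift_filter_step B_Delta_mult[OF y w] u_def[symmetric]
  by (subst append_vec_add[OF block_vec_carrier block_vec_carrier block_vec_carrier block_vec_carrier])
    (auto simp: block_vec_add intro!: arg_cong2[of _ _ _ _ append_vec] block_vec_cong)

section \<open>Quadratic forms\<close>

abbreviation quad_form :: "real mat \<Rightarrow> real Matrix.vec \<Rightarrow> real" where
  "quad_form X v \<equiv> scalar_prod v (X *\<^sub>v v)"

lemma quad_form_block_diag:
  assumes "X \<in> carrier_mat a a" "Y \<in> carrier_mat b b" "v \<in> carrier_vec a" "w \<in> carrier_vec b"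
  shows "quad_form (four_block_mat X (0\<^sub>m a b) (0\<^sub>m b a) Y) (v @\<^sub>v w) = quad_form X v + quad_form Y w"
  by (subst mult_mat_vec_split[OF assms]) (use assms in \<open>simp add: scalar_prod_append[of _ a _ b]\<close>)

lemma quad_form_diag_block_Cons:
  assumes "X \<in> carrier_mat a a" "diag_block_mat Xs \<in> carrier_mat b b" "v \<in> carrier_vec a" "w \<in> carrier_vec b"
  shows "quad_form (diag_block_mat (X # Xs)) (v @\<^sub>v w) = quad_form X v + quad_form (diag_block_mat Xs) w"
  using quad_form_block_diag[OF assms] assms by (simp add: Let_def)

lemma diag_block_Cons_carrier:
  assumes "X \<in> carrier_mat a a" "diag_block_mat Xs \<in> carrier_mat b b"
  shows "diag_block_mat (X # Xs) \<in> carrier_mat (a + b) (a + b)"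
  using assms by (auto simp: Let_def)

lemma diag_block_singleton_carrier: "X \<in> carrier_mat a a \<Longrightarrow> diag_block_mat [X] \<in> carrier_mat a a"
  by (subst diag_block_mat_singleton)

lemma quad_form_antidiag:
  assumes X: "X \<in> carrier_mat b a" and v: "v \<in> carrier_vec a" and w: "w \<in> carrier_vec b"
  shows "quad_form (four_block_mat (0\<^sub>m a a) (transpose_mat X) X (0\<^sub>m b b)) (v @\<^sub>v w) = 2 * scalar_prod w (X *\<^sub>v v)"
proof -
  have "four_block_mat (0\<^sub>m a a) (transpose_mat X) X (0\<^sub>m b b) *\<^sub>v (v @\<^sub>v w)
      = (0\<^sub>m a a *\<^sub>v v + transpose_mat X *\<^sub>v w) @\<^sub>v (X *\<^sub>v v + 0\<^sub>m b b *\<^sub>v w)"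
    by (rule four_block_mat_mult_vec[of _ a a _ b _ b]) (use assms in auto)
  also have "\<dots> = transpose_mat X *\<^sub>v w @\<^sub>v X *\<^sub>v v"
    using assms by (auto intro!: eq_vecI arg_cong2[of _ _ _ _ append_vec])
  finally have "quad_form (four_block_mat (0\<^sub>m a a) (transpose_mat X) X (0\<^sub>m b b)) (v @\<^sub>v w)
      = scalar_prod v (transpose_mat X *\<^sub>v w) + scalar_prod w (X *\<^sub>v v)"
    using assms by (simp add: scalar_prod_append[of _ a _ b])
  also have "scalar_prod v (transpose_mat X *\<^sub>v w) = scalar_prod w (X *\<^sub>v v)"
    using transpose_vec_mult_scalar[OF X v w] X v w by (simp add: comm_scalar_prod[of v a])
  finally show ?thesis by simp
qed

lemma quad_form_M_Delta:
  assumes M: "Mm \<in> carrier_mat p (lm * p)" "M0 \<in> carrier_mat p p" "Mp \<in> carrier_mat p (lp * p)"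
    and v: "u \<in> carrier_vec p" "w \<in> carrier_vec p" "s \<in> carrier_vec (lm * p)" "t \<in> carrier_vec (lp * p)"
  shows "M_Delta p lp lm Mm M0 Mp \<in> carrier_mat (p + p + (lm * p + p + (p + lp * p))) (p + p + (lm * p + p + (p + lp * p)))"
    and "quad_form (M_Delta p lp lm Mm M0 Mp) ((u @\<^sub>v w) @\<^sub>v (s @\<^sub>v w) @\<^sub>v (u @\<^sub>v t)) =
      2 * (scalar_prod w (M0 *\<^sub>v u) + scalar_prod w (Mm *\<^sub>v s) + scalar_prod u (Mp *\<^sub>v t))"
proof -
  let ?X1 = "four_block_mat (0\<^sub>m p p) (transpose_mat M0) M0 (0\<^sub>m p p)"
  let ?X2 = "four_block_mat (0\<^sub>m (lm * p) (lm * p)) (transpose_mat Mm) Mm (0\<^sub>m p p)"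
  let ?X3 = "four_block_mat (0\<^sub>m p p) Mp (transpose_mat Mp) (0\<^sub>m (lp * p) (lp * p))"
  have c: "?X1 \<in> carrier_mat (p + p) (p + p)" "?X2 \<in> carrier_mat (lm * p + p) (lm * p + p)"
    "?X3 \<in> carrier_mat (p + lp * p) (p + lp * p)"
    by (auto intro!: four_block_carrier_mat)
  note c3 = diag_block_singleton_carrier[OF c(3)]
  note c2 = diag_block_Cons_carrier[OF c(2) c3]
  show "M_Delta p lp lm Mm M0 Mp \<in> carrier_mat (p + p + (lm * p + p + (p + lp * p))) (p + p + (lm * p + p + (p + lp * p)))"
    unfolding M_Delta_def by (rule diag_block_Cons_carrier[OF c(1) c2])
  \<comment> \<open>In the third block the multiplier stands above the diagonal, so the antidiagonal
    lemma applies to its transpose.\<close>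
  have 3: "quad_form ?X3 (u @\<^sub>v t) = 2 * scalar_prod u (Mp *\<^sub>v t)"
  proof -
    have "quad_form ?X3 (u @\<^sub>v t) = 2 * scalar_prod t (transpose_mat Mp *\<^sub>v u)"
      using quad_form_antidiag[of "transpose_mat Mp" "lp * p" p u t] M v by simp
    also have "scalar_prod t (transpose_mat Mp *\<^sub>v u) = scalar_prod u (Mp *\<^sub>v t)"
      using transpose_vec_mult_scalar[OF M(3) v(4,1)] M v by (simp add: comm_scalar_prod[of t "lp * p"])
    finally show ?thesis .
  qed
  have "quad_form (M_Delta p lp lm Mm M0 Mp) ((u @\<^sub>v w) @\<^sub>v (s @\<^sub>v w) @\<^sub>v (u @\<^sub>v t)) =
      quad_form ?X1 (u @\<^sub>v w) + quad_form (diag_block_mat [?X2, ?X3]) ((s @\<^sub>v w) @\<^sub>v (u @\<^sub>v t))"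
    unfolding M_Delta_def by (rule quad_form_diag_block_Cons[OF c(1) c2]) (use v in auto)
  also have "quad_form (diag_block_mat [?X2, ?X3]) ((s @\<^sub>v w) @\<^sub>v (u @\<^sub>v t)) =
      quad_form ?X2 (s @\<^sub>v w) + quad_form ?X3 (u @\<^sub>v t)"
    unfolding quad_form_diag_block_Cons[OF c(2) c3 append_carrier_vec[OF v(3,2)] append_carrier_vec[OF v(1,4)]]
    by (simp only: diag_block_mat_singleton)
  also have "quad_form ?X1 (u @\<^sub>v w) = 2 * scalar_prod w (M0 *\<^sub>v u)"
    by (rule quad_form_antidiag) (use M v in auto)
  also have "quad_form ?X2 (s @\<^sub>v w) = 2 * scalar_prod w (Mm *\<^sub>v s)"
    by (rule quad_form_antidiag) (use M v in auto)
  finally show "quad_form (M_Delta p lp lm Mm M0 Mp) ((u @\<^sub>v w) @\<^sub>v (s @\<^sub>v w) @\<^sub>v (u @\<^sub>v t)) =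
      2 * (scalar_prod w (M0 *\<^sub>v u) + scalar_prod w (Mm *\<^sub>v s) + scalar_prod u (Mp *\<^sub>v t))"
    unfolding 3 by simp
qed

section \<open>The outer factor of the matrix inequality\<close>

lemma mult_mat_vec_append_zero:
  assumes X: "X \<in> carrier_mat r (a + b)" and v: "v \<in> carrier_vec a" and w: "w \<in> carrier_vec b"
  shows "X *\<^sub>v (v @\<^sub>v 0\<^sub>v b) + X *\<^sub>v (0\<^sub>v a @\<^sub>v w) = X *\<^sub>v (v @\<^sub>v w)"
proof -
  have "(v @\<^sub>v 0\<^sub>v b) + (0\<^sub>v a @\<^sub>v w) = v @\<^sub>v w"
    by (subst append_vec_add[of _ a _ _ b]) (use v w in auto)
  then show ?thesis
    by (subst mult_add_distrib_mat_vec[OF X, symmetric]) (use v w in auto)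
qed

lemma A_Delta_carrier [simp, intro]: "A_Delta p lp lm \<in> carrier_mat (lm * p + lp * p) (lm * p + lp * p)"
proof -
  have "four_block_mat (shift_mat lm) (0\<^sub>m lm lp) (0\<^sub>m lp lm) (shift_mat lp) \<in> carrier_mat (lm + lp) (lm + lp)"
    by (auto simp: shift_mat_def)
  from kronecker_one_carrier[OF this, of p] show ?thesis by (simp add: A_Delta_def distrib_right)
qed

text \<open>Read as dynamics, the outer factor sends extended state and input to the undisturbed
  successor state, the state itself, the filter output and the performance output, in the order of
  the diagonal blocks of the middle matrix. Its quadratic form is therefore a dissipation
  inequality.\<close>

lemma lmi_outer_mult:
  fixes m L :: real and lm lp :: nat and f g :: "nat \<Rightarrow> nat \<Rightarrow> real"
  assumes Acl: "Acl \<in> carrier_mat np np" and B: "B \<in> carrier_mat np p" and C: "C \<in> carrier_mat p np"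
    and Cp: "Cp \<in> carrier_mat ny np" and \<xi>: "\<xi> \<in> carrier_vec np" and w: "w \<in> carrier_vec p"
  defines "y \<equiv> C *\<^sub>v \<xi>"
  defines "u \<equiv> (L - m) \<cdot>\<^sub>v y - w"
  defines "x \<equiv> (block_vec p lm f @\<^sub>v block_vec p lp g) @\<^sub>v \<xi>"
  defines "x' \<equiv> (block_vec p lm (\<lambda>i r. if i + 1 < lm then f (i + 1) r else u $ r) @\<^sub>v
                block_vec p lp (\<lambda>i r. if i + 1 < lp then g (i + 1) r else w $ r)) @\<^sub>v (Acl *\<^sub>v \<xi> + B *\<^sub>v w)"
  defines "z \<equiv> (u @\<^sub>v w) @\<^sub>v (block_vec p lm f @\<^sub>v w) @\<^sub>v (u @\<^sub>v block_vec p lp (\<lambda>i. g (lp - 1 - i)))"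
  defines "d \<equiv> (lm * p + lp * p) + np"
  shows "lmi_outer p np lp lm m L Acl B C Cp \<in>
      carrier_mat (d + (d + (p + p + (lm * p + p + (p + lp * p)) + ny))) (d + p)"
    and "lmi_outer p np lp lm m L Acl B C Cp *\<^sub>v (x @\<^sub>v w) = x' @\<^sub>v x @\<^sub>v z @\<^sub>v (Cp *\<^sub>v \<xi>)"
proof -
  let ?k = "lm * p + lp * p" and ?q = "p + p + (lm * p + p + (p + lp * p))"
  have k: "(lm + lp) * p = ?k" by (simp add: distrib_right)
  have q: "p + (p + (lm * p + (p + (p + lp * p)))) = ?q" by simp
  let ?\<psi> = "block_vec p lm f @\<^sub>v block_vec p lp g"
  have \<psi>: "?\<psi> \<in> carrier_vec ?k" by auto
  have y: "y \<in> carrier_vec p" using C \<xi> by (simp add: y_def)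
  have x: "x \<in> carrier_vec d" using \<psi> \<xi> by (auto simp: x_def d_def)
  have DD: "D_Delta p lp lm m L \<in> carrier_mat ?q (p + p)" using D_Delta_carrier[of p lp lm m L] unfolding q .
  have CD: "C_Delta p lp lm \<in> carrier_mat ?q ?k" using C_Delta_carrier[of p lp lm] unfolding q .
  have C0: "C @\<^sub>r 0\<^sub>m p np \<in> carrier_mat (p + p) np" using C by auto
  have I0: "0\<^sub>m p p @\<^sub>r 1\<^sub>m p \<in> carrier_mat (p + p) p" by auto
  \<comment> \<open>The plant output and \<open>w\<close> enter the filter through separate block
    columns; the two halves formed here are rejoined by
    \<open>mult_mat_vec_append_zero\<close>.\<close>
  have C0v: "(C @\<^sub>r 0\<^sub>m p np) *\<^sub>v \<xi> = y @\<^sub>v 0\<^sub>v p"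
    by (subst mat_mult_append[OF C _ \<xi>]) (use \<xi> in \<open>auto simp: y_def intro!: eq_vecI\<close>)
  have I0v: "(0\<^sub>m p p @\<^sub>r 1\<^sub>m p) *\<^sub>v w = 0\<^sub>v p @\<^sub>v w"
    by (subst mat_mult_append[of _ p p _ p]) (use w in \<open>auto intro!: eq_vecI\<close>)
  have BC: "(B_Delta p lp lm m L * (C @\<^sub>r 0\<^sub>m p np)) *\<^sub>v \<xi> = B_Delta p lp lm m L *\<^sub>v (y @\<^sub>v 0\<^sub>v p)"
    by (subst assoc_mult_mat_vec[OF B_Delta_carrier C0 \<xi>]) (simp add: C0v)
  have BI: "(B_Delta p lp lm m L * (0\<^sub>m p p @\<^sub>r 1\<^sub>m p)) *\<^sub>v w = B_Delta p lp lm m L *\<^sub>v (0\<^sub>v p @\<^sub>v w)"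
    by (subst assoc_mult_mat_vec[OF B_Delta_carrier I0 w]) (simp add: I0v)
  have DC: "(D_Delta p lp lm m L * (C @\<^sub>r 0\<^sub>m p np)) *\<^sub>v \<xi> = D_Delta p lp lm m L *\<^sub>v (y @\<^sub>v 0\<^sub>v p)"
    by (subst assoc_mult_mat_vec[OF DD C0 \<xi>]) (simp add: C0v)
  have DI: "D_c11 p lp lm m L *\<^sub>v w = D_Delta p lp lm m L *\<^sub>v (0\<^sub>v p @\<^sub>v w)"
    unfolding D_c11_def by (subst assoc_mult_mat_vec[OF DD I0 w]) (simp add: I0v)
  have Ac: "A_c p np lp lm m L Acl C \<in> carrier_mat d d"
    unfolding A_c_def k d_def by (rule four_block_carrier_mat) (use Acl in auto)
  have Bc: "B_c1 p lp lm m L B \<in> carrier_mat d p"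
    unfolding B_c1_def d_def by (rule carrier_append_rows[OF mult_carrier_mat[OF B_Delta_carrier I0] B])
  have Cc: "C_c1 p np lp lm m L C \<in> carrier_mat ?q d"
    unfolding C_c1_def d_def by (rule append_cols_carrier[OF CD mult_carrier_mat[OF DD C0]])
  have Cc2: "C_c2 p lp lm Cp \<in> carrier_mat ny d"
    using append_cols_carrier[OF zero_carrier_mat Cp, of ?k] Cp unfolding C_c2_def d_def k by simp
  have Dc: "D_c11 p lp lm m L \<in> carrier_mat ?q p"
    unfolding D_c11_def by (rule mult_carrier_mat[OF DD I0])
  have Aw: "A_c p np lp lm m L Acl C *\<^sub>v x =
      (A_Delta p lp lm *\<^sub>v ?\<psi> + B_Delta p lp lm m L *\<^sub>v (y @\<^sub>v 0\<^sub>v p)) @\<^sub>v (Acl *\<^sub>v \<xi>)"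
  proof -
    have "A_c p np lp lm m L Acl C *\<^sub>v x =
        (A_Delta p lp lm *\<^sub>v ?\<psi> + (B_Delta p lp lm m L * (C @\<^sub>r 0\<^sub>m p np)) *\<^sub>v \<xi>) @\<^sub>v (0\<^sub>m np ?k *\<^sub>v ?\<psi> + Acl *\<^sub>v \<xi>)"
      unfolding A_c_def k x_def
      by (rule four_block_mat_mult_vec[OF A_Delta_carrier mult_carrier_mat[OF B_Delta_carrier C0] _ Acl \<psi> \<xi>]) auto
    also have "0\<^sub>m np ?k *\<^sub>v ?\<psi> + Acl *\<^sub>v \<xi> = Acl *\<^sub>v \<xi>" using Acl \<xi> \<psi> by (intro eq_vecI) auto
    finally show ?thesis by (simp add: BC)
  qed
  have Bw: "B_c1 p lp lm m L B *\<^sub>v w = B_Delta p lp lm m L *\<^sub>v (0\<^sub>v p @\<^sub>v w) @\<^sub>v (B *\<^sub>v w)"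
    unfolding B_c1_def by (subst mat_mult_append[OF mult_carrier_mat[OF B_Delta_carrier I0] B w]) (simp add: BI)
  have top: "A_c p np lp lm m L Acl C *\<^sub>v x + B_c1 p lp lm m L B *\<^sub>v w = x'"
  proof -
    have "A_c p np lp lm m L Acl C *\<^sub>v x + B_c1 p lp lm m L B *\<^sub>v w =
       (A_Delta p lp lm *\<^sub>v ?\<psi> + B_Delta p lp lm m L *\<^sub>v (y @\<^sub>v 0\<^sub>v p) + B_Delta p lp lm m L *\<^sub>v (0\<^sub>v p @\<^sub>v w))
         @\<^sub>v (Acl *\<^sub>v \<xi> + B *\<^sub>v w)"
      unfolding Aw Bw
      by (rule append_vec_add[of _ ?k _ _ np])
        (auto intro!: add_carrier_vec mult_mat_vec_carrier[OF A_Delta_carrier] mult_mat_vec_carrier[OF B_Delta_carrier]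
          mult_mat_vec_carrier[OF Acl \<xi>] mult_mat_vec_carrier[OF B w] \<psi> y w)
    also have "A_Delta p lp lm *\<^sub>v ?\<psi> + B_Delta p lp lm m L *\<^sub>v (y @\<^sub>v 0\<^sub>v p) + B_Delta p lp lm m L *\<^sub>v (0\<^sub>v p @\<^sub>v w)
        = A_Delta p lp lm *\<^sub>v ?\<psi> + (B_Delta p lp lm m L *\<^sub>v (y @\<^sub>v 0\<^sub>v p) + B_Delta p lp lm m L *\<^sub>v (0\<^sub>v p @\<^sub>v w))"
      by (rule assoc_add_vec[of _ ?k])
        (auto intro!: mult_mat_vec_carrier[OF A_Delta_carrier] mult_mat_vec_carrier[OF B_Delta_carrier] \<psi> y w)
    finally show ?thesis
      unfolding mult_mat_vec_append_zero[OF B_Delta_carrier y w] filter_step[OF y w] x'_def u_def .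
  qed
  have mid: "C_c1 p np lp lm m L C *\<^sub>v x + D_c11 p lp lm m L *\<^sub>v w = z"
  proof -
    have "C_c1 p np lp lm m L C *\<^sub>v x = C_Delta p lp lm *\<^sub>v ?\<psi> + D_Delta p lp lm m L *\<^sub>v (y @\<^sub>v 0\<^sub>v p)"
      unfolding C_c1_def x_def by (subst append_cols_mult_vec[OF CD mult_carrier_mat[OF DD C0] \<psi> \<xi>]) (simp add: DC)
    then have "C_c1 p np lp lm m L C *\<^sub>v x + D_c11 p lp lm m L *\<^sub>v w =
        C_Delta p lp lm *\<^sub>v ?\<psi> + (D_Delta p lp lm m L *\<^sub>v (y @\<^sub>v 0\<^sub>v p) + D_Delta p lp lm m L *\<^sub>v (0\<^sub>v p @\<^sub>v w))"
      unfolding DI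
      by (simp only:) (rule assoc_add_vec[of _ ?q];
          auto intro!: mult_mat_vec_carrier[OF CD] mult_mat_vec_carrier[OF DD] \<psi> y w)
    then show ?thesis unfolding mult_mat_vec_append_zero[OF DD y w] filter_output[OF y w] z_def u_def .
  qed
  have bot: "C_c2 p lp lm Cp *\<^sub>v x = Cp *\<^sub>v \<xi>"
  proof -
    have "C_c2 p lp lm Cp *\<^sub>v x = 0\<^sub>m ny ?k *\<^sub>v ?\<psi> + Cp *\<^sub>v \<xi>"
      unfolding C_c2_def x_def k using Cp append_cols_mult_vec[OF zero_carrier_mat[of ny ?k] Cp \<psi> \<xi>] by simp
    also have "\<dots> = Cp *\<^sub>v \<xi>" using Cp \<xi> \<psi> by (intro eq_vecI) auto
    finally show ?thesis .
  qed
  have nc: "(lm + lp) * p + np = d" by (simp add: d_def k)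
  have dimCp: "dim_row Cp = ny" using Cp by auto
  note c1 = append_cols_carrier[OF Ac Bc]
  note c2 = append_cols_carrier[OF one_carrier_mat[of d] zero_carrier_mat[of d p]]
  note c3 = append_cols_carrier[OF Cc Dc]
  note c4 = append_cols_carrier[OF Cc2 zero_carrier_mat[of ny p]]
  note c34 = carrier_append_rows[OF c3 c4]
  note c234 = carrier_append_rows[OF c2 c34]
  show "lmi_outer p np lp lm m L Acl B C Cp \<in> carrier_mat (d + (d + (?q + ny))) (d + p)"
    unfolding lmi_outer_def Let_def nc dimCp by (rule carrier_append_rows[OF c1 c234])
  have xw: "x @\<^sub>v w \<in> carrier_vec (d + p)" using x w by auto
  have "lmi_outer p np lp lm m L Acl B C Cp *\<^sub>v (x @\<^sub>v w) =
     (A_c p np lp lm m L Acl C *\<^sub>v x + B_c1 p lp lm m L B *\<^sub>v w) @\<^sub>v (1\<^sub>m d *\<^sub>v x + 0\<^sub>m d p *\<^sub>v w) @\<^sub>v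
     (C_c1 p np lp lm m L C *\<^sub>v x + D_c11 p lp lm m L *\<^sub>v w) @\<^sub>v (C_c2 p lp lm Cp *\<^sub>v x + 0\<^sub>m ny p *\<^sub>v w)"
    unfolding lmi_outer_def Let_def nc dimCp mat_mult_append[OF c1 c234 xw] mat_mult_append[OF c2 c34 xw]
      mat_mult_append[OF c3 c4 xw] append_cols_mult_vec[OF Ac Bc x w] append_cols_mult_vec[OF Cc Dc x w]
      append_cols_mult_vec[OF one_carrier_mat zero_carrier_mat x w] append_cols_mult_vec[OF Cc2 zero_carrier_mat x w] ..
  also have "1\<^sub>m d *\<^sub>v x + 0\<^sub>m d p *\<^sub>v w = x" using x w by (intro eq_vecI) auto
  also have "C_c2 p lp lm Cp *\<^sub>v x + 0\<^sub>m ny p *\<^sub>v w = Cp *\<^sub>v \<xi>" unfolding bot using Cp \<xi> w by (intro eq_vecI) auto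
  finally show "lmi_outer p np lp lm m L Acl B C Cp *\<^sub>v (x @\<^sub>v w) = x' @\<^sub>v x @\<^sub>v z @\<^sub>v (Cp *\<^sub>v \<xi>)"
    unfolding top mid .
qed

lemma quad_form_congruence:
  assumes F: "F \<in> carrier_mat a b" and Q: "Q \<in> carrier_mat a a" and v: "v \<in> carrier_vec b"
  shows "quad_form (transpose_mat F * Q * F) v = quad_form Q (F *\<^sub>v v)"
proof -
  have Fv: "F *\<^sub>v v \<in> carrier_vec a" using F v by simp
  have "(transpose_mat F * Q * F) *\<^sub>v v = transpose_mat F *\<^sub>v (Q *\<^sub>v (F *\<^sub>v v))"
    using F Q v by (subst assoc_mult_mat_vec[of _ b a _ b])
      (auto intro!: mult_carrier_mat[of _ b a] assoc_mult_mat_vec[of _ b a _ a])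
  then have "quad_form (transpose_mat F * Q * F) v = scalar_prod (transpose_mat F *\<^sub>v (Q *\<^sub>v (F *\<^sub>v v))) v"
    using F Q v by (simp add: comm_scalar_prod[of v b])
  also have "\<dots> = scalar_prod (Q *\<^sub>v (F *\<^sub>v v)) (F *\<^sub>v v)"
    by (rule transpose_vec_mult_scalar[OF F v]) (use Q Fv in auto)
  also have "\<dots> = quad_form Q (F *\<^sub>v v)"
    by (rule comm_scalar_prod[OF _ Fv]) (use Q Fv in auto)
  finally show ?thesis .
qed

lemma quad_form_uminus:
  assumes "P \<in> carrier_mat d d" "x \<in> carrier_vec d"
  shows "quad_form (- P) x = - quad_form P x"
proof -
  have "(- P) *\<^sub>v x = - (P *\<^sub>v x)" using assms by (intro eq_vecI) auto
  then show ?thesis using assms by simp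
qed

lemma quad_form_outer:
  assumes P: "P \<in> carrier_mat d d" and M: "M \<in> carrier_mat q q"
    and x: "x' \<in> carrier_vec d" "x \<in> carrier_vec d" and z: "z \<in> carrier_vec q" and e: "e \<in> carrier_vec r"
  shows "quad_form (diag_block_mat [P, - P, M, 1\<^sub>m r]) (x' @\<^sub>v x @\<^sub>v z @\<^sub>v e) =
     quad_form P x' - quad_form P x + quad_form M z + scalar_prod e e"
    and "diag_block_mat [P, - P, M, 1\<^sub>m r] \<in> carrier_mat (d + (d + (q + r))) (d + (d + (q + r)))"
proof -
  have nP: "- P \<in> carrier_mat d d" using P by simp
  note c4 = diag_block_singleton_carrier[OF one_carrier_mat[of r]]
  note c3 = diag_block_Cons_carrier[OF M c4]
  note c2 = diag_block_Cons_carrier[OF nP c3]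
  show "diag_block_mat [P, - P, M, 1\<^sub>m r] \<in> carrier_mat (d + (d + (q + r))) (d + (d + (q + r)))"
    by (rule diag_block_Cons_carrier[OF P c2])
  have ze: "z @\<^sub>v e \<in> carrier_vec (q + r)" and xze: "x @\<^sub>v z @\<^sub>v e \<in> carrier_vec (d + (q + r))"
    using x z e by auto
  show "quad_form (diag_block_mat [P, - P, M, 1\<^sub>m r]) (x' @\<^sub>v x @\<^sub>v z @\<^sub>v e) =
     quad_form P x' - quad_form P x + quad_form M z + scalar_prod e e"
    unfolding quad_form_diag_block_Cons[OF P c2 x(1) xze] quad_form_diag_block_Cons[OF nP c3 x(2) ze]
      quad_form_diag_block_Cons[OF M c4 z e] quad_form_uminus[OF P x(2)] diag_block_mat_singleton
    using e by simp
qed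

section \<open>From multiplier matrices to scalar coefficients\<close>

lemma scalar_block_row:
  assumes X: "X \<in> carrier_mat p (l * p)"
    and entry: "\<And>r k. r < p \<Longrightarrow> k < l * p \<Longrightarrow> X $$ (r, k) = c (k div p) * (if r = k mod p then 1 else 0)"
    and w: "w \<in> carrier_vec p"
  shows "scalar_prod w (X *\<^sub>v block_vec p l f) = (\<Sum>j<l. c j * (\<Sum>r<p. w $ r * f j r))"
proof -
  let ?R = "mat 1 l (\<lambda>(_, j). c j)"
  have "X = ?R \<otimes>\<^sub>k 1\<^sub>m p"
    using X by (intro eq_matI) (auto simp: kronecker_def entry block_index_div block_index_mod)
  then have "X *\<^sub>v block_vec p l f = block_vec p 1 (\<lambda>i r. \<Sum>j<l. ?R $$ (i, j) * f j r)"
    using kronecker_one_mult_block_vec[of ?R 1 l p f] by simp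
  also have "\<dots> = block_vec p 1 (\<lambda>i r. \<Sum>j<l. c j * f j r)"
    by (rule block_vec_cong) auto
  finally have "scalar_prod w (X *\<^sub>v block_vec p l f)
      = scalar_prod (block_vec p 1 (\<lambda>_ r. w $ r)) (block_vec p 1 (\<lambda>i r. \<Sum>j<l. c j * f j r))"
    using block_vec_one[OF w] by simp
  also have "\<dots> = (\<Sum>r<p. \<Sum>j<l. c j * (w $ r * f j r))"
    unfolding scalar_prod_block_vec by (simp add: sum_distrib_left mult.left_commute)
  also have "\<dots> = (\<Sum>j<l. c j * (\<Sum>r<p. w $ r * f j r))"
    by (subst sum.swap) (simp add: sum_distrib_left)
  finally show ?thesis .
qed

lemma sum_int_interval_split:
  fixes c :: "int \<Rightarrow> real"
  shows "(\<Sum>i=-int lm..int lp. c i) = c 0 + (\<Sum>i<lm. c (int i - int lm)) + (\<Sum>i<lp. c (int i + 1))"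
proof -
  have "{-int lm..int lp} = insert 0 ({-int lm..<0} \<union> {1..int lp})" "{-int lm..<0} \<inter> {1..int lp} = {}" by auto
  then have "(\<Sum>i=-int lm..int lp. c i) = c 0 + sum c {-int lm..<0} + sum c {1..int lp}"
    by (simp add: sum.union_disjoint)
  also have "sum c {-int lm..<0} = (\<Sum>i<lm. c (int i - int lm))"
    by (rule sum.reindex_bij_witness[of _ "\<lambda>i. int i - int lm" "\<lambda>i. nat (i + int lm)"]) auto
  also have "sum c {1..int lp} = (\<Sum>i<lp. c (int i + 1))"
    by (rule sum.reindex_bij_witness[of _ "\<lambda>i. int i + 1" "\<lambda>i. nat (i - 1)"]) auto
  finally show ?thesis .
qed

text \<open>All blocks are multiples of the identity, so each of the three matrices is a row of
  scalars tensored with \<open>1\<^sub>m p\<close> and its bilinear forms are weighted sums of inner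
  products. These are the coefficients that \<open>zames_falb_nonneg\<close> expects.\<close>

lemma multiplier_scalars:
  assumes M: "Mm @\<^sub>c M0 @\<^sub>c Mp \<in> multiplier_set 1 lp lm p" and p: "p > 0"
    and Mm: "Mm \<in> carrier_mat p (lm * p)" and M0: "M0 \<in> carrier_mat p p" and Mp: "Mp \<in> carrier_mat p (lp * p)"
  obtains c :: "int \<Rightarrow> real" where
    "\<And>i. i < lm \<Longrightarrow> c (int i - int lm) \<le> 0" "\<And>i. i < lp \<Longrightarrow> c (int i + 1) \<le> 0"
    "c 0 + (\<Sum>i<lm. c (int i - int lm)) + (\<Sum>i<lp. c (int i + 1)) \<ge> 0"
    "\<And>u w. u \<in> carrier_vec p \<Longrightarrow> w \<in> carrier_vec p \<Longrightarrow> scalar_prod w (M0 *\<^sub>v u) = c 0 * scalar_prod w u"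
    "\<And>f w. w \<in> carrier_vec p \<Longrightarrow>
      scalar_prod w (Mm *\<^sub>v block_vec p lm f) = (\<Sum>j<lm. c (int j - int lm) * (\<Sum>r<p. w $ r * f j r))"
    "\<And>f w. w \<in> carrier_vec p \<Longrightarrow>
      scalar_prod w (Mp *\<^sub>v block_vec p lp f) = (\<Sum>j<lp. c (int j + 1) * (\<Sum>r<p. w $ r * f j r))"
proof -
  from M obtain Mi where eq: "Mm @\<^sub>c M0 @\<^sub>c Mp =
      mat p ((lm + 1 + lp) * p) (\<lambda>(r, c). Mi (int (c div p) - int lm) $$ (r, c mod p))"
    and Mi: "\<forall>i\<in>{-int lm..int lp}. \<exists>mi. Mi i = mi \<cdot>\<^sub>m 1\<^sub>m p \<and> (i \<noteq> 0 \<longrightarrow> mi \<le> 0)"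
    and dom: "0\<^sub>v p \<le> multiplier_sum (inverse 1) lp lm p Mi *\<^sub>v Matrix.vec p (\<lambda>_. 1)"
    unfolding multiplier_set_def by blast
  from bchoice[OF Mi] obtain c where c: "\<And>i. i \<in> {-int lm..int lp} \<Longrightarrow> Mi i = c i \<cdot>\<^sub>m 1\<^sub>m p \<and> (i \<noteq> 0 \<longrightarrow> c i \<le> 0)"
    by blast
  have entry: "(Mm @\<^sub>c M0 @\<^sub>c Mp) $$ (r, k) = c (int (k div p) - int lm) * (if r = k mod p then 1 else 0)"
    if "r < p" "k < (lm + 1 + lp) * p" for r k
  proof -
    have "k div p < lm + 1 + lp" "k mod p < p" using that block_index_div block_index_mod by blast+
    then have "int (k div p) - int lm \<in> {-int lm..int lp}" by auto
    then show ?thesis using that c unfolding eq by simp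
  qed
  have X: "(Mm @\<^sub>c M0 @\<^sub>c Mp) $$ (r, k) = (if k < lm * p then Mm $$ (r, k)
      else if k - lm * p < p then M0 $$ (r, k - lm * p) else Mp $$ (r, k - lm * p - p))"
    if "r < p" "k < lm * p + (p + lp * p)" for r k
    using that append_cols_index[OF Mm append_cols_carrier[OF M0 Mp], of r k]
      append_cols_index[OF M0 Mp, of r "k - lm * p"] by auto
  have m: "Mm $$ (r, k) = c (int (k div p) - int lm) * (if r = k mod p then 1 else 0)" if "r < p" "k < lm * p" for r k
    using entry[of r k] X[of r k] that by (simp add: distrib_right)
  have 0: "M0 $$ (r, k) = c 0 * (if r = k mod p then 1 else 0)" if "r < p" "k < 1 * p" for r k
    using entry[of r "lm * p + k"] X[of r "lm * p + k"] that by (simp add: distrib_right)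
  have pl: "Mp $$ (r, k) = c (int (k div p) + 1) * (if r = k mod p then 1 else 0)" if "r < p" "k < lp * p" for r k
  proof -
    have e: "lm * p + p + k = k + (lm + 1) * p" by simp
    have "(lm * p + p + k) div p = lm + 1 + k div p" "(lm * p + p + k) mod p = k mod p"
      unfolding e using p by (simp_all only: div_mult_self1 mod_mult_self1)
    then show ?thesis
      using entry[of r "lm * p + p + k"] X[of r "lm * p + p + k"] that by (auto simp: distrib_right add.commute)
  qed
  show thesis
  proof (rule that[of c])
    show "c (int i - int lm) \<le> 0" if "i < lm" for i using that c[of "int i - int lm"] by auto
    show "c (int i + 1) \<le> 0" if "i < lp" for i using that c[of "int i + 1"] by auto
    \<comment> \<open>For scalar blocks every component of the row sum equals the sum of all
      coefficients; component 0 exists since \<open>p > 0\<close>.\<close>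
    have "0 \<le> (multiplier_sum (inverse 1) lp lm p Mi *\<^sub>v Matrix.vec p (\<lambda>_. 1)) $ 0"
    proof -
      have "dim_vec (multiplier_sum (inverse 1) lp lm p Mi *\<^sub>v Matrix.vec p (\<lambda>_. 1)) = p"
        by (simp add: multiplier_sum_def)
      then have "(0\<^sub>v p :: real Matrix.vec) $ 0 \<le> (multiplier_sum (inverse 1) lp lm p Mi *\<^sub>v Matrix.vec p (\<lambda>_. 1)) $ 0"
        using dom p unfolding less_eq_vec_def by metis
      then show ?thesis using p by simp
    qed
    also have "\<dots> = (\<Sum>k<p. \<Sum>i=-int lm..int lp. Mi i $$ (0, k))"
      using p by (simp add: multiplier_sum_def scalar_prod_def lessThan_atLeast0)
    also have "\<dots> = (\<Sum>k<p. \<Sum>i=-int lm..int lp. c i * (if k = 0 then 1 else 0))"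
      using c p by (intro sum.cong refl) auto
    also have "\<dots> = (\<Sum>i=-int lm..int lp. c i)"
      using p by (subst sum.swap) (simp add: if_distrib[of "\<lambda>x. _ * x"] cong: if_cong)
    finally show "c 0 + (\<Sum>i<lm. c (int i - int lm)) + (\<Sum>i<lp. c (int i + 1)) \<ge> 0"
      unfolding sum_int_interval_split .
    show "scalar_prod w (M0 *\<^sub>v u) = c 0 * scalar_prod w u" if "u \<in> carrier_vec p" "w \<in> carrier_vec p" for u w
    proof -
      have "scalar_prod w (M0 *\<^sub>v block_vec p 1 (\<lambda>_ r. u $ r)) = (\<Sum>j<1::nat. c 0 * (\<Sum>r<p. w $ r * u $ r))"
        by (rule scalar_block_row[where l = 1 and c = "\<lambda>_. c 0"]) (use M0 0 that in auto)
      also have "\<dots> = c 0 * scalar_prod w u"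
        using that by (simp add: scalar_prod_def lessThan_atLeast0)
      finally show ?thesis unfolding block_vec_one[OF that(1), symmetric] .
    qed
    show "scalar_prod w (Mm *\<^sub>v block_vec p lm f) = (\<Sum>j<lm. c (int j - int lm) * (\<Sum>r<p. w $ r * f j r))"
      if "w \<in> carrier_vec p" for f w by (rule scalar_block_row[OF Mm m that])
    show "scalar_prod w (Mp *\<^sub>v block_vec p lp f) = (\<Sum>j<lp. c (int j + 1) * (\<Sum>r<p. w $ r * f j r))"
      if "w \<in> carrier_vec p" for f w by (rule scalar_block_row[OF Mp pl that])
  qed
qed

section \<open>Coercivity and norm bounds\<close>

abbreviation sq_norm :: "real Matrix.vec \<Rightarrow> real" where
  "sq_norm v \<equiv> scalar_prod v v"

lemma sq_norm_eq: "v \<in> carrier_vec n \<Longrightarrow> sq_norm v = (\<Sum>i<n. (v $ i)\<^sup>2)"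
  by (auto simp: scalar_prod_def power2_eq_square lessThan_atLeast0)

lemma sq_norm_nonneg: "sq_norm v \<ge> 0"
  by (simp add: scalar_prod_def sum_nonneg)

lemma quad_form_eq_sum:
  assumes "X \<in> carrier_mat n n" "v \<in> carrier_vec n"
  shows "quad_form X v = (\<Sum>i<n. \<Sum>j<n. v $ i * X $$ (i, j) * v $ j)"
  using assms by (auto simp: scalar_prod_def lessThan_atLeast0 sum_distrib_left mult.assoc intro!: sum.cong)

text \<open>The form attains its maximum on the compact unit sphere, where it is negative;
  homogeneity extends the margin to all vectors.\<close>

lemma neg_definite_coercive:
  assumes X: "neg_definite X" "X \<in> carrier_mat n n"
  obtains \<epsilon> where "\<epsilon> > 0" "\<And>v. v \<in> carrier_vec n \<Longrightarrow> quad_form X v \<le> - \<epsilon> * sq_norm v"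
proof -
  \<comment> \<open>The unit sphere, modelled by functions that vanish from \<open>n\<close> on. As
    a subset of a product of compact intervals and points it is compact in the product
    topology.\<close>
  define K where "K = (PiE UNIV (\<lambda>i. if i < n then {-1..1} else {0}) :: (nat \<Rightarrow> real) set) \<inter> {f. (\<Sum>i<n. (f i)\<^sup>2) = 1}"
  define q where "q f = (\<Sum>i<n. \<Sum>j<n. f i * X $$ (i, j) * f j)" for f :: "nat \<Rightarrow> real"
  have cont: "continuous_on S (\<lambda>f :: nat \<Rightarrow> real. f i)" for S i
    by (rule continuous_on_subset[OF continuous_on_product_coordinates subset_UNIV])
  have "compact (PiE UNIV (\<lambda>i. if i < n then {-1..1} else {0}) :: (nat \<Rightarrow> real) set)"
    unfolding compactin_euclidean_iff[symmetric] euclidean_product_topology[symmetric]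
    by (subst compactin_PiE) (auto simp: compactin_euclidean_iff)
  moreover have "closed {f :: nat \<Rightarrow> real. (\<Sum>i<n. (f i)\<^sup>2) = 1}"
    by (intro closed_Collect_eq continuous_intros cont)
  ultimately have K: "compact K" unfolding K_def by (rule compact_Int_closed)
  have q: "continuous_on K q" unfolding q_def by (intro continuous_intros cont)
  have qv: "quad_form X v = q (\<lambda>i. if i < n then v $ i else 0)" if "v \<in> carrier_vec n" for v
    using quad_form_eq_sum[OF X(2) that] by (auto simp: q_def intro!: sum.cong)
  have memK: "(\<lambda>i. if i < n then v $ i else 0) \<in> K" if v: "v \<in> carrier_vec n" "sq_norm v = 1" for v
  proof -
    have "(v $ i)\<^sup>2 \<le> 1" if "i < n" for i
      using v that member_le_sum[of i "{..<n}" "\<lambda>i. (v $ i)\<^sup>2"] by (simp add: sq_norm_eq)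
    then show ?thesis using v by (auto simp: K_def PiE_def abs_le_square_iff[symmetric] abs_le_iff sq_norm_eq
      abs_square_le_1)
  qed
  obtain \<epsilon> where \<epsilon>: "\<epsilon> > 0" "\<And>f. f \<in> K \<Longrightarrow> q f \<le> - \<epsilon>"
  proof (cases "K = {}")
    \<comment> \<open>This happens for \<open>n = 0\<close>, where every margin works.\<close>
    case True
    then show ?thesis using that[of 1] by auto
  next
    case False
    from continuous_attains_sup[OF K False q] obtain f0 where f0: "f0 \<in> K" "\<And>f. f \<in> K \<Longrightarrow> q f \<le> q f0" by blast
    let ?v = "Matrix.vec n f0"
    have "?v \<noteq> 0\<^sub>v n"
    proof
      assume "?v = 0\<^sub>v n"
      then have "f0 i = 0" if "i < n" for i using that by (metis index_vec index_zero_vec(1))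
      then show False using f0(1) by (simp add: K_def)
    qed
    then have "quad_form X ?v < 0" using X unfolding neg_definite_def by auto
    moreover have "(\<lambda>i. if i < n then ?v $ i else 0) = f0"
      using f0(1) by (auto simp: K_def fun_eq_iff PiE_def Pi_def split: if_splits)
    ultimately have "q f0 < 0" using qv[of ?v] by simp
    then show ?thesis using f0 that[of "- q f0"] by auto
  qed
  show ?thesis
  proof (rule that[OF \<epsilon>(1)])
    fix v :: "real Matrix.vec" assume v: "v \<in> carrier_vec n"
    show "quad_form X v \<le> - \<epsilon> * sq_norm v"
    proof (cases "sq_norm v = 0")
      case True
      then have "\<And>i. i < n \<Longrightarrow> v $ i = 0"
        using v by (auto simp: sq_norm_eq sum_nonneg_eq_0_iff)
      then show ?thesis using True v X by (simp add: quad_form_eq_sum)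
    next
      case False
      define s where "s = sqrt (sq_norm v)"
      have s: "s > 0" "s\<^sup>2 = sq_norm v" using False sq_norm_nonneg[of v] by (auto simp: s_def)
      let ?u = "(1 / s) \<cdot>\<^sub>v v"
      have u: "?u \<in> carrier_vec n" using v by simp
      have "sq_norm ?u = s\<^sup>2 / s\<^sup>2" using v s(2) by (simp add: power2_eq_square)
      then have u1: "sq_norm ?u = 1" using s(1) False by simp
      have "quad_form X ?u \<le> - \<epsilon>" unfolding qv[OF u] by (rule \<epsilon>(2)[OF memK[OF u u1]])
      moreover have "quad_form X ?u = quad_form X v / s\<^sup>2"
        using v X s by (simp add: mult_mat_vec[of _ n n] power2_eq_square)
      ultimately show ?thesis using s False sq_norm_nonneg[of v] by (simp add: pos_divide_le_eq)
    qed
  qed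
qed

text \<open>Cauchy-Schwarz in each row; the constant is the squared Frobenius norm.\<close>

lemma mat_mult_bound:
  assumes X: "X \<in> carrier_mat a b"
  obtains c where "c \<ge> 0" "\<And>v. v \<in> carrier_vec b \<Longrightarrow> sq_norm (X *\<^sub>v v) \<le> c * sq_norm v"
proof (rule that)
  let ?c = "\<Sum>i<a. \<Sum>j<b. (X $$ (i, j))\<^sup>2"
  show "?c \<ge> 0" by (intro sum_nonneg) auto
  fix v :: "real Matrix.vec" assume v: "v \<in> carrier_vec b"
  have "sq_norm (X *\<^sub>v v) = (\<Sum>i<a. (\<Sum>j<b. X $$ (i, j) * v $ j)\<^sup>2)"
    using X v by (subst sq_norm_eq[of _ a]) (auto simp: scalar_prod_def lessThan_atLeast0 intro!: sum.cong)
  also have "\<dots> \<le> (\<Sum>i<a. (\<Sum>j<b. (X $$ (i, j))\<^sup>2) * (\<Sum>j<b. (v $ j)\<^sup>2))"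
    by (intro sum_mono Cauchy_Schwarz_ineq_sum)
  also have "\<dots> = ?c * sq_norm v" using v by (simp add: sq_norm_eq sum_distrib_right)
  finally show "sq_norm (X *\<^sub>v v) \<le> ?c * sq_norm v" .
qed

lemma scalar_prod_Young:
  assumes "v \<in> carrier_vec n" "w \<in> carrier_vec n" and \<delta>: "\<delta> > 0"
  shows "2 * scalar_prod v w \<le> \<delta> * sq_norm v + sq_norm w / \<delta>"
proof -
  have "2 * (v $ i * w $ i) \<le> \<delta> * (v $ i)\<^sup>2 + (w $ i)\<^sup>2 / \<delta>" for i
  proof -
    have "0 \<le> (\<delta> * v $ i - w $ i)\<^sup>2 / \<delta>" using \<delta> by simp
    also have "\<dots> = \<delta> * (v $ i)\<^sup>2 + (w $ i)\<^sup>2 / \<delta> - 2 * (v $ i * w $ i)"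
      using \<delta> by (simp add: power2_diff power_mult_distrib diff_divide_distrib add_divide_distrib)
        (simp add: power2_eq_square)
    finally show ?thesis by simp
  qed
  then have "(\<Sum>i<n. 2 * (v $ i * w $ i)) \<le> (\<Sum>i<n. \<delta> * (v $ i)\<^sup>2 + (w $ i)\<^sup>2 / \<delta>)"
    by (intro sum_mono)
  moreover have "scalar_prod v w = (\<Sum>i<n. v $ i * w $ i)"
    using assms by (simp add: scalar_prod_def lessThan_atLeast0)
  ultimately show ?thesis
    using assms by (simp add: sq_norm_eq sum.distrib sum_distrib_left sum_divide_distrib)
qed

lemma sq_norm_add_le:
  assumes "v \<in> carrier_vec n" "w \<in> carrier_vec n"
  shows "sq_norm (v + w) \<le> 2 * sq_norm v + 2 * sq_norm w"
proof -
  have "sq_norm (v + w) = (\<Sum>i<n. (v $ i + w $ i)\<^sup>2)" using assms by (subst sq_norm_eq[of _ n]) auto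
  also have "\<dots> \<le> (\<Sum>i<n. 2 * (v $ i)\<^sup>2 + 2 * (w $ i)\<^sup>2)"
    by (intro sum_mono) (use sum_squares_bound in \<open>auto simp: power2_sum algebra_simps\<close>)
  finally show ?thesis using assms by (simp add: sq_norm_eq sum.distrib sum_distrib_left)
qed

section \<open>Coordinates\<close>

lemma to_jvec_carrier [simp, intro]: "to_jvec (x :: real ^ 'p::finite) \<in> carrier_vec CARD('p)"
  by (simp add: to_jvec_def)

lemma dim_to_jvec [simp]: "dim_vec (to_jvec (x :: real ^ 'p::finite)) = CARD('p)"
  by (simp add: to_jvec_def)

lemma to_nat_on_lt_CARD: "to_nat_on (UNIV :: 'p::finite set) i < CARD('p)"
  using bij_betw_apply[OF to_nat_on_finite[OF finite], of i] by simp

lemma to_jvec_of_jvec: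
  assumes "v \<in> carrier_vec CARD('p)"
  shows "to_jvec (of_jvec v :: real ^ 'p::finite) = v"
proof -
  have "to_nat_on (UNIV :: 'p set) ` UNIV = {..<CARD('p)}"
    using to_nat_on_finite[OF finite, of "UNIV :: 'p set"] by (rule bij_betw_imp_surj_on)
  then have "to_nat_on (UNIV :: 'p set) (from_nat_into UNIV i) = i" if "i < CARD('p)" for i
    using that by (intro to_nat_on_from_nat_into) auto
  then show ?thesis using assms by (intro eq_vecI) (auto simp: to_jvec_def of_jvec_def)
qed

lemma bij_betw_from_nat_into_UNIV: "bij_betw (from_nat_into (UNIV :: 'p::finite set)) {..<CARD('p)} UNIV"
  by (rule bij_betw_from_nat_into_finite) auto

lemma scalar_prod_to_jvec: "scalar_prod (to_jvec x) (to_jvec y) = inner x (y :: real ^ 'p::finite)"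
proof -
  have "scalar_prod (to_jvec x) (to_jvec y) =
      (\<Sum>i<CARD('p). vec_nth x (from_nat_into UNIV i) * vec_nth y (from_nat_into UNIV i))"
    by (simp add: scalar_prod_def to_jvec_def lessThan_atLeast0)
  also have "\<dots> = (\<Sum>i\<in>UNIV. vec_nth x i * vec_nth y i)"
    by (rule sum.reindex_bij_betw[OF bij_betw_from_nat_into_UNIV])
  finally show ?thesis by (simp add: inner_vec_def)
qed

lemma to_jvec_diff: "to_jvec (x - y :: real ^ 'p::finite) = to_jvec x - to_jvec y"
  by (intro eq_vecI) (auto simp: to_jvec_def)

lemma to_jvec_scaleR: "to_jvec (c *\<^sub>R x :: real ^ 'p::finite) = c \<cdot>\<^sub>v to_jvec x"
  by (intro eq_vecI) (auto simp: to_jvec_def)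

lemma to_jvec_add: "to_jvec (x + y :: real ^ 'p::finite) = to_jvec x + to_jvec y"
  by (intro eq_vecI) (auto simp: to_jvec_def)

lemma to_jvec_zero: "to_jvec (0 :: real ^ 'p::finite) = 0\<^sub>v CARD('p)"
  by (intro eq_vecI) (auto simp: to_jvec_def)

section \<open>Dissipation along trajectories\<close>

lemma quad_form_add:
  assumes P: "P \<in> carrier_mat d d" "transpose_mat P = P" and v: "a \<in> carrier_vec d" "b \<in> carrier_vec d"
  shows "quad_form P (a + b) = quad_form P a + 2 * scalar_prod a (P *\<^sub>v b) + quad_form P b"
proof -
  have Pa: "P *\<^sub>v a \<in> carrier_vec d" and Pb: "P *\<^sub>v b \<in> carrier_vec d" using P v by auto
  have "scalar_prod b (P *\<^sub>v a) = scalar_prod (P *\<^sub>v b) a"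
    using transpose_vec_mult_scalar[OF P(1) v] P(2) by simp
  also have "\<dots> = scalar_prod a (P *\<^sub>v b)" by (rule comm_scalar_prod[OF Pb v(1)])
  finally have sym: "scalar_prod b (P *\<^sub>v a) = scalar_prod a (P *\<^sub>v b)" .
  have "quad_form P (a + b) = scalar_prod (a + b) (P *\<^sub>v a + P *\<^sub>v b)"
    by (simp add: mult_add_distrib_mat_vec[OF P(1) v])
  also have "\<dots> = quad_form P a + scalar_prod a (P *\<^sub>v b) + (scalar_prod b (P *\<^sub>v a) + quad_form P b)"
    using v Pa Pb by (simp add: add_scalar_prod_distrib[of _ d] scalar_prod_add_distrib[of _ d])
  finally show ?thesis by (simp add: sym)
qed

text \<open>The content at time \<open>k\<close> of a shift register of length \<open>l\<close> fed
  by \<open>u\<close> and started at zero, oldest value first: block \<open>i\<close> has delay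
  \<open>l - i\<close>.\<close>

definition past_inputs :: "nat \<Rightarrow> (nat \<Rightarrow> real ^ 'p::finite) \<Rightarrow> nat \<Rightarrow> real Matrix.vec" where
  "past_inputs l u k = block_vec CARD('p) l (\<lambda>i r. to_jvec (delayed u k (l - i)) $ r)"

lemma past_inputs_carrier [simp, intro]:
  "past_inputs l (u :: nat \<Rightarrow> real ^ 'p::finite) k \<in> carrier_vec (l * CARD('p))"
  by (simp add: past_inputs_def)

text \<open>Delays grow by one and the last block takes the new value. The case distinction is that
  of \<open>filter_step\<close>, so the register and the filter state agree literally.\<close>

lemma past_inputs_Suc:
  fixes u :: "nat \<Rightarrow> real ^ 'p::finite"
  shows "past_inputs l u (Suc k) = block_vec CARD('p) l
    (\<lambda>i r. if i + 1 < l then to_jvec (delayed u k (l - (i + 1))) $ r else to_jvec (u k) $ r)"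
  unfolding past_inputs_def
proof (rule block_vec_cong)
  fix i r assume "i < l"
  then have "l - i = Suc (l - (i + 1))" by simp
  then show "to_jvec (delayed u (Suc k) (l - i)) $ r =
      (if i + 1 < l then to_jvec (delayed u k (l - (i + 1))) $ r else to_jvec (u k) $ r)"
    using \<open>i < l\<close> by (auto simp: delayed_Suc delayed_zero)
qed

lemma past_inputs_0:
  fixes u :: "nat \<Rightarrow> real ^ 'p::finite"
  shows "past_inputs l u 0 = 0\<^sub>v (l * CARD('p))"
  unfolding past_inputs_def block_vec_zero[symmetric]
  by (rule block_vec_cong) (simp add: delayed_initial to_jvec_zero)

lemma sum_to_jvec: "(\<Sum>r<CARD('p). to_jvec x $ r * to_jvec y $ r) = inner x (y :: real ^ 'p::finite)"
  unfolding scalar_prod_to_jvec[symmetric] by (simp add: scalar_prod_def lessThan_atLeast0)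

text \<open>Matrix dimensions are expressed by the number \<open>p\<close>, signals by the index
  type \<open>'p\<close>; the equation between them is unfolded only where the two meet.\<close>

locale lmi_system =
  fixes p np lp lm ny :: nat and m L :: real and Acl B C Cp P Mp Mm M0 :: "real mat"
    and ptype :: "'p::finite itself"
  assumes p: "p = CARD('p)" and m: "0 < m" and mL: "m \<le> L"
    and Acl: "Acl \<in> carrier_mat np np" and B: "B \<in> carrier_mat np p"
    and C: "C \<in> carrier_mat p np" and Cp: "Cp \<in> carrier_mat ny np"
    and P: "P \<in> carrier_mat ((lm * p + lp * p) + np) ((lm * p + lp * p) + np)"
    and P_pos: "pos_definite P"
    and Mm: "Mm \<in> carrier_mat p (lm * p)" and M0: "M0 \<in> carrier_mat p p" and Mp: "Mp \<in> carrier_mat p (lp * p)"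
    and lmi: "neg_definite (transpose_mat (lmi_outer p np lp lm m L Acl B C Cp) *
      diag_block_mat [P, - P, M_Delta p lp lm Mm M0 Mp, 1\<^sub>m ny] * lmi_outer p np lp lm m L Acl B C Cp)"
    and multiplier: "Mm @\<^sub>c M0 @\<^sub>c Mp \<in> multiplier_set 1 lp lm p"
begin

abbreviation d :: nat where "d \<equiv> (lm * p + lp * p) + np"

lemma p_pos: "p > 0"
  unfolding p by simp

lemma P_sym: "transpose_mat P = P"
  using P_pos by (simp add: pos_definite_def)

lemma P_nonneg: "v \<in> carrier_vec d \<Longrightarrow> quad_form P v \<ge> 0"
  using P_pos P unfolding pos_definite_def
  by (cases "v = 0\<^sub>v d") (auto intro: less_imp_le)

text \<open>Strict definiteness becomes a uniform margin \<epsilon> in state and input. The filter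
  contents \<open>f\<close>, \<open>g\<close> are arbitrary here; along a trajectory they become
  past values of \<open>u\<close> and \<open>w\<close>.\<close>

lemma lmi_inequality:
  obtains \<epsilon> where "\<epsilon> > 0"
    and "\<And>f g \<xi> w. \<xi> \<in> carrier_vec np \<Longrightarrow> w \<in> carrier_vec p \<Longrightarrow>
      (let u = (L - m) \<cdot>\<^sub>v (C *\<^sub>v \<xi>) - w;
           x = (block_vec p lm f @\<^sub>v block_vec p lp g) @\<^sub>v \<xi>;
           x' = (block_vec p lm (\<lambda>i r. if i + 1 < lm then f (i + 1) r else u $ r) @\<^sub>v
                block_vec p lp (\<lambda>i r. if i + 1 < lp then g (i + 1) r else w $ r)) @\<^sub>v (Acl *\<^sub>v \<xi> + B *\<^sub>v w)
       in quad_form P x' - quad_form P x + 2 * (scalar_prod w (M0 *\<^sub>v u) + scalar_prod w (Mm *\<^sub>v block_vec p lm f)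
            + scalar_prod u (Mp *\<^sub>v block_vec p lp (\<lambda>i. g (lp - 1 - i)))) + sq_norm (Cp *\<^sub>v \<xi>)
          \<le> - \<epsilon> * (sq_norm x + sq_norm w))"
proof -
  let ?F = "lmi_outer p np lp lm m L Acl B C Cp" and ?Q = "diag_block_mat [P, - P, M_Delta p lp lm Mm M0 Mp, 1\<^sub>m ny]"
  let ?q = "p + p + (lm * p + p + (p + lp * p))"
  note MD = quad_form_M_Delta[OF Mm M0 Mp]
  have zc: "0\<^sub>v k \<in> carrier_vec k" for k by simp
  have F: "?F \<in> carrier_mat (d + (d + (?q + ny))) (d + p)"
    by (rule lmi_outer_mult(1)[OF Acl B C Cp zc zc])
  have Q: "?Q \<in> carrier_mat (d + (d + (?q + ny))) (d + (d + (?q + ny)))"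
    by (rule quad_form_outer(2)[OF P MD(1)[OF zc zc zc zc] zc zc zc zc])
  have FQF: "transpose_mat ?F * ?Q * ?F \<in> carrier_mat (d + p) (d + p)"
    using F Q by (intro mult_carrier_mat[of _ _ "d + (d + (?q + ny))"]) auto
  obtain \<epsilon> where \<epsilon>: "\<epsilon> > 0" "\<And>v. v \<in> carrier_vec (d + p) \<Longrightarrow> quad_form (transpose_mat ?F * ?Q * ?F) v \<le> - \<epsilon> * sq_norm v"
    by (rule neg_definite_coercive[OF lmi FQF]; rule that; blast)
  show ?thesis
  proof (rule that[OF \<epsilon>(1)])
    fix f g :: "nat \<Rightarrow> nat \<Rightarrow> real" and \<xi> w :: "real Matrix.vec"
    assume \<xi>: "\<xi> \<in> carrier_vec np" and w: "w \<in> carrier_vec p"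
    define u where "u = (L - m) \<cdot>\<^sub>v (C *\<^sub>v \<xi>) - w"
    define x where "x = (block_vec p lm f @\<^sub>v block_vec p lp g) @\<^sub>v \<xi>"
    define x' where "x' = (block_vec p lm (\<lambda>i r. if i + 1 < lm then f (i + 1) r else u $ r) @\<^sub>v
                block_vec p lp (\<lambda>i r. if i + 1 < lp then g (i + 1) r else w $ r)) @\<^sub>v (Acl *\<^sub>v \<xi> + B *\<^sub>v w)"
    define z where "z = (u @\<^sub>v w) @\<^sub>v (block_vec p lm f @\<^sub>v w) @\<^sub>v (u @\<^sub>v block_vec p lp (\<lambda>i. g (lp - 1 - i)))"
    have u: "u \<in> carrier_vec p" using C \<xi> w by (simp add: u_def)
    have x: "x \<in> carrier_vec d" using \<xi> by (auto simp: x_def)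
    have x': "x' \<in> carrier_vec d" unfolding x'_def
      by (intro append_carrier_vec block_vec_carrier add_carrier_vec mult_mat_vec_carrier[OF Acl \<xi>] mult_mat_vec_carrier[OF B w])
    have z: "z \<in> carrier_vec ?q" using u w by (auto simp: z_def)
    have xw: "x @\<^sub>v w \<in> carrier_vec (d + p)" using x w by auto
    have Fx: "?F *\<^sub>v (x @\<^sub>v w) = x' @\<^sub>v x @\<^sub>v z @\<^sub>v (Cp *\<^sub>v \<xi>)"
      unfolding x_def x'_def z_def u_def by (rule lmi_outer_mult(2)[OF Acl B C Cp \<xi> w])
    have "quad_form P x' - quad_form P x + quad_form (M_Delta p lp lm Mm M0 Mp) z + sq_norm (Cp *\<^sub>v \<xi>)
        = quad_form (transpose_mat ?F * ?Q * ?F) (x @\<^sub>v w)"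
      unfolding quad_form_congruence[OF F Q xw] Fx
      by (rule quad_form_outer(1)[OF P MD(1)[OF zc zc zc zc] x' x z mult_mat_vec_carrier[OF Cp \<xi>], symmetric])
    also have "\<dots> \<le> - \<epsilon> * sq_norm (x @\<^sub>v w)" by (rule \<epsilon>(2)[OF xw])
    also have "sq_norm (x @\<^sub>v w) = sq_norm x + sq_norm w" by (rule scalar_prod_append[OF x w x w])
    moreover have "quad_form (M_Delta p lp lm Mm M0 Mp) z = 2 * (scalar_prod w (M0 *\<^sub>v u)
        + scalar_prod w (Mm *\<^sub>v block_vec p lm f) + scalar_prod u (Mp *\<^sub>v block_vec p lp (\<lambda>i. g (lp - 1 - i))))"
      unfolding z_def by (rule MD(2)[OF u w block_vec_carrier block_vec_carrier])
    ultimately show "let u = (L - m) \<cdot>\<^sub>v (C *\<^sub>v \<xi>) - w;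
           x = (block_vec p lm f @\<^sub>v block_vec p lp g) @\<^sub>v \<xi>;
           x' = (block_vec p lm (\<lambda>i r. if i + 1 < lm then f (i + 1) r else u $ r) @\<^sub>v
                block_vec p lp (\<lambda>i r. if i + 1 < lp then g (i + 1) r else w $ r)) @\<^sub>v (Acl *\<^sub>v \<xi> + B *\<^sub>v w)
       in quad_form P x' - quad_form P x + 2 * (scalar_prod w (M0 *\<^sub>v u) + scalar_prod w (Mm *\<^sub>v block_vec p lm f)
            + scalar_prod u (Mp *\<^sub>v block_vec p lp (\<lambda>i. g (lp - 1 - i)))) + sq_norm (Cp *\<^sub>v \<xi>)
          \<le> - \<epsilon> * (sq_norm x + sq_norm w)"
      unfolding Let_def u_def[symmetric] x_def[symmetric] x'_def[symmetric] by simp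
  qed
qed

definition ext_state :: "(nat \<Rightarrow> real ^ 'p) \<Rightarrow> (nat \<Rightarrow> real ^ 'p) \<Rightarrow> (nat \<Rightarrow> real Matrix.vec) \<Rightarrow> nat \<Rightarrow> real Matrix.vec" where
  "ext_state u w \<xi> k = (past_inputs lm u k @\<^sub>v past_inputs lp w k) @\<^sub>v \<xi> k"

text \<open>The successor of the extended state before the perturbation is added. It is determined
  by the signals up to time \<open>k\<close>, on which the later independence argument
  rests.\<close>

definition ext_drift :: "(nat \<Rightarrow> real ^ 'p) \<Rightarrow> (nat \<Rightarrow> real ^ 'p) \<Rightarrow> (nat \<Rightarrow> real Matrix.vec) \<Rightarrow> nat \<Rightarrow> real Matrix.vec" where
  "ext_drift u w \<xi> k = (past_inputs lm u (Suc k) @\<^sub>v past_inputs lp w (Suc k)) @\<^sub>v (Acl *\<^sub>v \<xi> k + B *\<^sub>v to_jvec (w k))"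

definition inject :: "real Matrix.vec \<Rightarrow> real Matrix.vec" where
  "inject e = 0\<^sub>v (lm * p + lp * p) @\<^sub>v e"

lemma inject_carrier [simp, intro]: "e \<in> carrier_vec np \<Longrightarrow> inject e \<in> carrier_vec d"
  by (simp add: inject_def)

lemma past_pair_carrier:
  "past_inputs lm (u :: nat \<Rightarrow> real ^ 'p) k @\<^sub>v past_inputs lp (w :: nat \<Rightarrow> real ^ 'p) k \<in> carrier_vec (lm * p + lp * p)"
  unfolding p by (intro append_carrier_vec past_inputs_carrier)

lemma ext_state_carrier: "\<xi> k \<in> carrier_vec np \<Longrightarrow> ext_state u w \<xi> k \<in> carrier_vec d"
  unfolding ext_state_def by (intro append_carrier_vec[OF past_pair_carrier])

lemma ext_drift_carrier:
  assumes "\<xi> k \<in> carrier_vec np" shows "ext_drift u w \<xi> k \<in> carrier_vec d"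
  unfolding ext_drift_def
  by (rule append_carrier_vec[OF past_pair_carrier]) (use assms Acl B p in auto)

lemma ext_state_Suc:
  assumes "\<xi> k \<in> carrier_vec np" "e \<in> carrier_vec np" "\<xi> (Suc k) = Acl *\<^sub>v \<xi> k + B *\<^sub>v to_jvec (w k) + e"
  shows "ext_state u w \<xi> (Suc k) = ext_drift u w \<xi> k + inject e"
  unfolding ext_state_def ext_drift_def inject_def
  by (subst append_vec_add[OF past_pair_carrier _ _ assms(2)])
    (use assms Acl B p past_pair_carrier[of u "Suc k" w] in auto)

lemma trajectory_dissipation:
  obtains \<epsilon> where "\<epsilon> > 0"
    and "\<And>(H :: real ^ 'p \<Rightarrow> real) y w u \<xi> e K. H \<in> S_class m L \<Longrightarrow>
      (\<And>k. \<xi> k \<in> carrier_vec np) \<Longrightarrow> (\<And>k. e k \<in> carrier_vec np) \<Longrightarrow>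
      (\<And>k. to_jvec (y k) = C *\<^sub>v \<xi> k) \<Longrightarrow> (\<And>k. w k = slope H m (y k)) \<Longrightarrow>
      (\<And>k. u k = (L - m) *\<^sub>R y k - w k) \<Longrightarrow>
      (\<And>k. \<xi> (Suc k) = Acl *\<^sub>v \<xi> k + B *\<^sub>v to_jvec (w k) + e k) \<Longrightarrow>
      (\<Sum>k<K. sq_norm (Cp *\<^sub>v \<xi> k)) + \<epsilon> * (\<Sum>k<K. sq_norm (ext_state u w \<xi> k) + sq_norm (to_jvec (w k)))
        \<le> quad_form P (ext_state u w \<xi> 0)
          + (\<Sum>k<K. 2 * scalar_prod (ext_drift u w \<xi> k) (P *\<^sub>v inject (e k)) + quad_form P (inject (e k)))"
proof (rule lmi_inequality, rule multiplier_scalars[OF multiplier p_pos Mm M0 Mp], goal_cases)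
  case (1 \<epsilon> c)
  note \<epsilon> = 1(2) and lmi' = 1(3) and c = 1(4,5,6) and c0 = 1(7) and cm = 1(8) and cp = 1(9)
  show ?case
  proof (rule that[OF \<epsilon>])
    fix H :: "real ^ 'p \<Rightarrow> real" and y w u :: "nat \<Rightarrow> real ^ 'p" and \<xi> e :: "nat \<Rightarrow> real Matrix.vec" and K
    assume H: "H \<in> S_class m L" and \<xi>: "\<And>k. \<xi> k \<in> carrier_vec np" and e: "\<And>k. e k \<in> carrier_vec np"
      and y: "\<And>k. to_jvec (y k) = C *\<^sub>v \<xi> k" and w: "\<And>k. w k = slope H m (y k)"
      and u: "\<And>k. u k = (L - m) *\<^sub>R y k - w k"
      and step: "\<And>k. \<xi> (Suc k) = Acl *\<^sub>v \<xi> k + B *\<^sub>v to_jvec (w k) + e k"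
    \<comment> \<open>Half of the quadratic form of \<open>M_Delta\<close>. The coefficient with
      index \<open>i - lm\<close> goes with a delay of \<open>u\<close> by \<open>lm - i\<close>,
      the one with index \<open>i + 1\<close> with a delay of \<open>w\<close> by
      \<open>i + 1\<close>.\<close>
    define iqc where "iqc k = c 0 * inner (w k) (u k) + (\<Sum>i<lm. c (int i - int lm) * inner (w k) (delayed u k (lm - i)))
           + (\<Sum>i<lp. c (int i + 1) * inner (u k) (delayed w k (i + 1)))" for k
    have one_step: "quad_form P (ext_state u w \<xi> (Suc k)) - quad_form P (ext_state u w \<xi> k) + 2 * iqc k + sq_norm (Cp *\<^sub>v \<xi> k)
        + \<epsilon> * (sq_norm (ext_state u w \<xi> k) + sq_norm (to_jvec (w k)))
      \<le> 2 * scalar_prod (ext_drift u w \<xi> k) (P *\<^sub>v inject (e k)) + quad_form P (inject (e k))" for k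
    proof -
      have wk: "to_jvec (w k) \<in> carrier_vec p" and uk: "to_jvec (u k) \<in> carrier_vec p" unfolding p by auto
      have U: "(L - m) \<cdot>\<^sub>v (C *\<^sub>v \<xi> k) - to_jvec (w k) = to_jvec (u k)"
        by (simp add: u to_jvec_diff to_jvec_scaleR y)
      let ?f = "\<lambda>i r. to_jvec (delayed u k (lm - i)) $ r" and ?g = "\<lambda>i r. to_jvec (delayed w k (lp - i)) $ r"
      have iqc: "scalar_prod (to_jvec (w k)) (M0 *\<^sub>v to_jvec (u k)) + scalar_prod (to_jvec (w k)) (Mm *\<^sub>v block_vec p lm ?f)
            + scalar_prod (to_jvec (u k)) (Mp *\<^sub>v block_vec p lp (\<lambda>i. ?g (lp - 1 - i))) = iqc k"
        unfolding c0[OF uk wk] cm[OF wk] cp[OF uk] iqc_def unfolding p sum_to_jvec scalar_prod_to_jvec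
        by (auto intro!: sum.cong arg_cong2[of _ _ _ _ "(+)"])
      have D: "quad_form P (ext_drift u w \<xi> k) - quad_form P (ext_state u w \<xi> k) + 2 * iqc k + sq_norm (Cp *\<^sub>v \<xi> k)
          \<le> - \<epsilon> * (sq_norm (ext_state u w \<xi> k) + sq_norm (to_jvec (w k)))"
        using lmi'[OF \<xi>[of k] wk, of ?f ?g] unfolding Let_def U iqc
        unfolding ext_state_def ext_drift_def past_inputs_Suc unfolding past_inputs_def p .
      have "quad_form P (ext_state u w \<xi> (Suc k)) = quad_form P (ext_drift u w \<xi> k)
          + 2 * scalar_prod (ext_drift u w \<xi> k) (P *\<^sub>v inject (e k)) + quad_form P (inject (e k))"
        unfolding ext_state_Suc[where \<xi> = \<xi> and k = k and e = "e k" and w = w and u = u, OF \<xi> e step]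
        by (rule quad_form_add[OF P P_sym ext_drift_carrier[of \<xi> k, OF \<xi>] inject_carrier[OF e]])
      with D show ?thesis by simp
    qed
    have iqc_nonneg: "(\<Sum>k<K. iqc k) \<ge> 0"
    proof -
      obtain \<psi> :: "real ^ 'p \<Rightarrow> real" where \<psi>: "\<And>x. \<psi> x \<ge> 0" "\<psi> 0 = 0"
        "\<And>x y. inner (slope H m x) (((L - m) *\<^sub>R x - slope H m x) - ((L - m) *\<^sub>R y - slope H m y)) \<ge> \<psi> x - \<psi> y"
        using slope_storage[OF H m mL] by blast
      show ?thesis unfolding iqc_def
      proof (rule zames_falb_nonneg[of "\<lambda>k. \<psi> (y k)"])
        show "\<psi> (y i) - \<psi> (y j) \<le> inner (w i) (u i - u j)" for i j
          using \<psi>(3)[of "y i" "y j"] by (simp add: u w)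
        show "\<psi> (y i) \<le> inner (w i) (u i)" for i
          using \<psi>(3)[of "y i" 0] \<psi>(2) by (simp add: u w slope_zero[OF H m mL])
      qed (use \<psi>(1) c in auto)
    qed
    define V where "V k = quad_form P (ext_state u w \<xi> k)" for k
    define r where "r k = sq_norm (ext_state u w \<xi> k) + sq_norm (to_jvec (w k))" for k
    define s where "s k = 2 * scalar_prod (ext_drift u w \<xi> k) (P *\<^sub>v inject (e k)) + quad_form P (inject (e k))" for k
    have "(\<Sum>k<K. (V (Suc k) - V k) + 2 * iqc k + sq_norm (Cp *\<^sub>v \<xi> k) + \<epsilon> * r k) \<le> (\<Sum>k<K. s k)"
      using one_step by (intro sum_mono) (simp add: V_def r_def s_def)
    then have "V K - V 0 + 2 * (\<Sum>k<K. iqc k) + (\<Sum>k<K. sq_norm (Cp *\<^sub>v \<xi> k)) + \<epsilon> * (\<Sum>k<K. r k) \<le> (\<Sum>k<K. s k)"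
      by (simp only: sum.distrib sum_distrib_left sum_lessThan_telescope)
    then show "(\<Sum>k<K. sq_norm (Cp *\<^sub>v \<xi> k)) + \<epsilon> * (\<Sum>k<K. sq_norm (ext_state u w \<xi> k) + sq_norm (to_jvec (w k)))
        \<le> quad_form P (ext_state u w \<xi> 0)
          + (\<Sum>k<K. 2 * scalar_prod (ext_drift u w \<xi> k) (P *\<^sub>v inject (e k)) + quad_form P (inject (e k)))"
      using iqc_nonneg P_nonneg[OF ext_state_carrier[of \<xi> K u w, OF \<xi>]] unfolding V_def r_def s_def by linarith
  qed
qed

end

section \<open>Well-posedness and gain\<close>

text \<open>Solves the loop equation forward in time. The values from \<open>k\<close> on are filled
  with 0, which a strictly causal \<open>T\<close> cannot see at time \<open>k\<close>.\<close>

fun loop_solution :: "((nat \<Rightarrow> 'a::ab_group_add) \<Rightarrow> nat \<Rightarrow> 'a) \<Rightarrow> (nat \<Rightarrow> 'a) \<Rightarrow> nat \<Rightarrow> 'a" where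
  "loop_solution T v k = v k + T (\<lambda>i. if i < k then loop_solution T v i else 0) k"

declare loop_solution.simps [simp del]

text \<open>At time \<open>k\<close> the loop equation determines \<open>q k\<close> from earlier
  values. Uniqueness up to a horizon \<open>T\<close>, by strong induction, yields injectivity and
  causality of the inverse at once.\<close>

lemma well_posed_strictly_causal:
  fixes G :: "(nat \<Rightarrow> 'b) \<Rightarrow> nat \<Rightarrow> 'a::real_normed_vector"
  assumes G: "\<And>u v k. (\<forall>i<k. u i = v i) \<Longrightarrow> G u k = G v k"
    and F: "\<And>q k. F q k = \<phi> (q k)"
  shows "well_posed G F"
proof -
  have GF: "G (F q) k = G (F q') k" if "\<forall>i<k. q i = q' i" for q q' k
    by (rule G) (use that in \<open>simp add: F\<close>)
  have unique: "\<forall>k\<le>T. q k = q' k" if "\<forall>k\<le>T. loop_map G F q k = loop_map G F q' k" for q q' T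
  proof (intro allI)
    fix k show "k \<le> T \<longrightarrow> q k = q' k"
    proof (induction k rule: less_induct)
      case (less k)
      show ?case
      proof
        assume k: "k \<le> T"
        then have "\<forall>i<k. q i = q' i" using less by auto
        then show "q k = q' k" using GF[of k q q'] that k by (auto simp: loop_map_def)
      qed
    qed
  qed
  have "inj (loop_map G F)"
    by (rule injI, rule ext) (metis unique order_refl)
  moreover have "surj (loop_map G F)"
  proof (rule surjI)
    fix v
    let ?q = "loop_solution (\<lambda>q. G (F q)) v"
    show "loop_map G F ?q = v"
    proof
      fix k
      have "?q k = v k + G (F ?q) k"
        by (subst loop_solution.simps) (auto intro!: GF)
      then show "loop_map G F ?q k = v k" by (simp add: loop_map_def)
    qed
  qed
  ultimately have bij: "bij (loop_map G F)" by (rule bijI)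
  have "causal (inv_into UNIV (loop_map G F))"
    unfolding causal_def
    by (intro allI impI, rule unique[rule_format])
      (simp_all add: surj_f_inv_f[OF bij_is_surj[OF bij]])
  with bij show ?thesis by (simp add: well_posed_def)
qed

lemma lti_state_cong: "\<forall>i<k. u i = v i \<Longrightarrow> lti_state A B u k = lti_state A B v k"
  by (induction k) auto

text \<open>Uniform bounds on partial sums suffice: they also provide the summability of the output,
  which is not known beforehand.\<close>

lemma bounded_l2_gainI:
  fixes F :: "(nat \<Rightarrow> 'a::real_normed_vector) \<Rightarrow> nat \<Rightarrow> 'b::real_normed_vector"
  assumes c: "c \<ge> 0"
    and bound: "\<And>u K. summable (\<lambda>k. (norm (u k))\<^sup>2) \<Longrightarrow> (\<Sum>k<K. (norm (F u k))\<^sup>2) \<le> c * (\<Sum>k. (norm (u k))\<^sup>2)"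
  shows "bounded_l2_gain F"
  unfolding bounded_l2_gain_def
proof (intro exI allI impI conjI)
  fix u :: "nat \<Rightarrow> 'a" assume u: "summable (\<lambda>k. (norm (u k))\<^sup>2)"
  show F: "summable (\<lambda>k. (norm (F u k))\<^sup>2)"
    by (rule bounded_imp_summable[where B = "c * (\<Sum>k. (norm (u k))\<^sup>2)"])
      (use bound[OF u, of "Suc _"] in \<open>auto simp: lessThan_Suc_atMost\<close>)
  have "(\<Sum>k. (norm (F u k))\<^sup>2) \<le> c * (\<Sum>k. (norm (u k))\<^sup>2)"
    by (rule suminf_le_const[OF F bound[OF u]])
  then show "sqrt (\<Sum>k. (norm (F u k))\<^sup>2) \<le> sqrt c * sqrt (\<Sum>k. (norm (u k))\<^sup>2)"
    by (simp flip: real_sqrt_mult)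
qed

lemma quad_form_bound:
  assumes X: "X \<in> carrier_mat n n"
  obtains c where "c \<ge> 0" "\<And>v. v \<in> carrier_vec n \<Longrightarrow> quad_form X v \<le> c * sq_norm v"
proof -
  obtain c where c: "c \<ge> 0" "\<And>v. v \<in> carrier_vec n \<Longrightarrow> sq_norm (X *\<^sub>v v) \<le> c * sq_norm v"
    by (rule mat_mult_bound[OF X]; rule that; blast)
  show ?thesis
  proof (rule that)
    show "(1 + c) / 2 \<ge> 0" using c by simp
    fix v :: "real Matrix.vec" assume v: "v \<in> carrier_vec n"
    have "2 * quad_form X v \<le> 1 * sq_norm v + sq_norm (X *\<^sub>v v) / 1"
      by (rule scalar_prod_Young) (use v X in auto)
    with c(2)[OF v] show "quad_form X v \<le> (1 + c) / 2 * sq_norm v" by (simp add: distrib_right)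
  qed
qed

section \<open>Energy bound and l2-gain of the closed loop\<close>

context lmi_system
begin

lemma sq_norm_inject: "e \<in> carrier_vec np \<Longrightarrow> sq_norm (inject e) = sq_norm e"
  unfolding inject_def by (subst scalar_prod_append[of _ "lm * p + lp * p" _ np]) auto

lemma ext_state_0: "ext_state u w \<xi> 0 = inject (\<xi> 0)"
  unfolding ext_state_def inject_def past_inputs_0 zero_append_zero_vec p[symmetric] ..

lemma sq_norm_le_ext_state: "\<xi> k \<in> carrier_vec np \<Longrightarrow> sq_norm (\<xi> k) \<le> sq_norm (ext_state u w \<xi> k)"
  unfolding ext_state_def
  by (subst scalar_prod_append[OF past_pair_carrier _ past_pair_carrier]) (auto simp: sq_norm_nonneg)

text \<open>The drift is the top block of the outer factor applied to state and input, so a norm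
  bound for that matrix is enough.\<close>

lemma ext_drift_bound:
  obtains c where "c \<ge> 0"
    and "\<And>u w y \<xi> k. \<xi> k \<in> carrier_vec np \<Longrightarrow> to_jvec (y :: real ^ 'p) = C *\<^sub>v \<xi> k \<Longrightarrow> u k = (L - m) *\<^sub>R y - w k \<Longrightarrow>
      sq_norm (ext_drift u w \<xi> k) \<le> c * (sq_norm (ext_state u w \<xi> k) + sq_norm (to_jvec (w k)))"
proof -
  let ?F = "lmi_outer p np lp lm m L Acl B C Cp"
  have zc: "0\<^sub>v k \<in> carrier_vec k" for k by simp
  note F = lmi_outer_mult(1)[OF Acl B C Cp zc zc, where lm = lm and lp = lp and m = m and L = L]
  obtain c where c: "c \<ge> 0" "\<And>v. v \<in> carrier_vec (d + p) \<Longrightarrow> sq_norm (?F *\<^sub>v v) \<le> c * sq_norm v"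
    by (rule mat_mult_bound[OF F]; rule that; blast)
  show ?thesis
  proof (rule that[OF c(1)])
    fix u w :: "nat \<Rightarrow> real ^ 'p" and y :: "real ^ 'p" and \<xi> k
    assume \<xi>: "\<xi> k \<in> carrier_vec np" and y: "to_jvec y = C *\<^sub>v \<xi> k" and u: "u k = (L - m) *\<^sub>R y - w k"
    let ?f = "\<lambda>i r. to_jvec (delayed u k (lm - i)) $ r" and ?g = "\<lambda>i r. to_jvec (delayed w k (lp - i)) $ r"
    have wk: "to_jvec (w k) \<in> carrier_vec p" unfolding p by auto
    have U: "(L - m) \<cdot>\<^sub>v (C *\<^sub>v \<xi> k) - to_jvec (w k) = to_jvec (u k)"
      by (simp add: u to_jvec_diff to_jvec_scaleR y)
    have x: "ext_state u w \<xi> k \<in> carrier_vec d" and x': "ext_drift u w \<xi> k \<in> carrier_vec d"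
      using \<xi> by (auto intro: ext_state_carrier ext_drift_carrier)
    have "\<exists>r. ?F *\<^sub>v (ext_state u w \<xi> k @\<^sub>v to_jvec (w k)) = ext_drift u w \<xi> k @\<^sub>v r"
      using lmi_outer_mult(2)[OF Acl B C Cp \<xi> wk, where lm = lm and lp = lp and f = ?f and g = ?g and m = m and L = L] unfolding U
      unfolding ext_state_def ext_drift_def past_inputs_Suc unfolding past_inputs_def p by blast
    then obtain r where r: "?F *\<^sub>v (ext_state u w \<xi> k @\<^sub>v to_jvec (w k)) = ext_drift u w \<xi> k @\<^sub>v r" by blast
    have "sq_norm (ext_drift u w \<xi> k) \<le> sq_norm (ext_drift u w \<xi> k @\<^sub>v r)"
      by (subst scalar_prod_append[OF x' carrier_vecI x' carrier_vecI]) (auto simp: sq_norm_nonneg)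
    also have "\<dots> \<le> c * sq_norm (ext_state u w \<xi> k @\<^sub>v to_jvec (w k))"
      unfolding r[symmetric] by (rule c(2)) (use x wk in auto)
    also have "sq_norm (ext_state u w \<xi> k @\<^sub>v to_jvec (w k)) = sq_norm (ext_state u w \<xi> k) + sq_norm (to_jvec (w k))"
      by (rule scalar_prod_append[OF x wk x wk])
    finally show "sq_norm (ext_drift u w \<xi> k) \<le> c * (sq_norm (ext_state u w \<xi> k) + sq_norm (to_jvec (w k)))" .
  qed
qed

text \<open>Young's inequality splits the cross term; the part in the drift is bounded by the energy
  that the dissipation inequality controls, and a small weight lets it be moved to the left
  side.\<close>

lemma state_energy_bound:
  obtains c where "c \<ge> 0"
    and "\<And>(H :: real ^ 'p \<Rightarrow> real) y w \<xi> e K. H \<in> S_class m L \<Longrightarrow>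
      (\<And>k. \<xi> k \<in> carrier_vec np) \<Longrightarrow> (\<And>k. e k \<in> carrier_vec np) \<Longrightarrow>
      (\<And>k. to_jvec (y k) = C *\<^sub>v \<xi> k) \<Longrightarrow> (\<And>k. w k = slope H m (y k)) \<Longrightarrow>
      (\<And>k. \<xi> (Suc k) = Acl *\<^sub>v \<xi> k + B *\<^sub>v to_jvec (w k) + e k) \<Longrightarrow>
      (\<Sum>k<K. sq_norm (\<xi> k)) \<le> c * (sq_norm (\<xi> 0) + (\<Sum>k<K. sq_norm (e k)))"
proof (rule trajectory_dissipation, rule ext_drift_bound, goal_cases)
  case (1 \<epsilon> cD)
  note \<epsilon> = 1(2) and diss = 1(3) and cD = 1(4,5)
  obtain cV where cV: "cV \<ge> 0" "\<And>v. v \<in> carrier_vec d \<Longrightarrow> quad_form P v \<le> cV * sq_norm v"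
    by (rule quad_form_bound[OF P]; rule that; blast)
  obtain cP where cP: "cP \<ge> 0" "\<And>v. v \<in> carrier_vec d \<Longrightarrow> sq_norm (P *\<^sub>v v) \<le> cP * sq_norm v"
    by (rule mat_mult_bound[OF P]; rule that; blast)
  \<comment> \<open>Chosen so that \<open>\<delta> * cD\<close> uses at most half of the margin; the
    added 1 covers \<open>cD = 0\<close>.\<close>
  define \<delta> where "\<delta> = \<epsilon> / (2 * (cD + 1))"
  have "\<epsilon> / 2 * (cD / (cD + 1)) \<le> \<epsilon> / 2 * 1" using \<epsilon> cD(1) by (intro mult_left_mono) auto
  then have \<delta>: "\<delta> > 0" "\<delta> * cD \<le> \<epsilon> / 2" using \<epsilon> cD(1) by (simp_all add: \<delta>_def)
  \<comment> \<open>The cost of a perturbation: \<open>cP / \<delta>\<close> from Young's inequality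
    and \<open>cV\<close> from its own quadratic term. It also dominates the initial
    storage.\<close>
  define \<kappa> where "\<kappa> = cP / \<delta> + cV"
  define c where "c = 2 / \<epsilon> * \<kappa>"
  have cc: "cP / \<delta> \<ge> 0" using cP(1) \<delta>(1) by simp
  show ?case
  proof (rule that)
    show "c \<ge> 0" unfolding c_def \<kappa>_def using \<epsilon> cc cV(1) by (intro mult_nonneg_nonneg) auto
    fix H :: "real ^ 'p \<Rightarrow> real" and y w :: "nat \<Rightarrow> real ^ 'p" and \<xi> e :: "nat \<Rightarrow> real Matrix.vec" and K
    assume H: "H \<in> S_class m L" and \<xi>: "\<And>k. \<xi> k \<in> carrier_vec np" and e: "\<And>k. e k \<in> carrier_vec np"
      and y: "\<And>k. to_jvec (y k) = C *\<^sub>v \<xi> k" and w: "\<And>k. w k = slope H m (y k)"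
      and step: "\<And>k. \<xi> (Suc k) = Acl *\<^sub>v \<xi> k + B *\<^sub>v to_jvec (w k) + e k"
    define u where "u k = (L - m) *\<^sub>R y k - w k" for k
    define r where "r k = sq_norm (ext_state u w \<xi> k) + sq_norm (to_jvec (w k))" for k
    have cross: "2 * scalar_prod (ext_drift u w \<xi> k) (P *\<^sub>v inject (e k)) + quad_form P (inject (e k))
        \<le> \<epsilon> / 2 * r k + \<kappa> * sq_norm (e k)" for k
    proof -
      have ie: "inject (e k) \<in> carrier_vec d" using e by auto
      have "2 * scalar_prod (ext_drift u w \<xi> k) (P *\<^sub>v inject (e k))
          \<le> \<delta> * sq_norm (ext_drift u w \<xi> k) + sq_norm (P *\<^sub>v inject (e k)) / \<delta>"
        by (rule scalar_prod_Young[OF ext_drift_carrier[of \<xi> k, OF \<xi>] mult_mat_vec_carrier[OF P ie] \<delta>(1)])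
      also have "\<delta> * sq_norm (ext_drift u w \<xi> k) \<le> \<delta> * (cD * r k)"
        unfolding r_def using \<delta>(1) cD(2)[of \<xi> k, OF \<xi> y, of u w] by (intro mult_left_mono) (auto simp: u_def)
      also have "\<delta> * (cD * r k) \<le> \<epsilon> / 2 * r k"
        using mult_right_mono[OF \<delta>(2), of "r k"] by (simp add: r_def sq_norm_nonneg mult.assoc)
      also have "sq_norm (P *\<^sub>v inject (e k)) / \<delta> \<le> cP * sq_norm (e k) / \<delta>"
        using cP(2)[OF ie] \<delta>(1) by (intro divide_right_mono) (auto simp: sq_norm_inject[OF e])
      finally show ?thesis using cV(2)[OF ie] by (simp add: sq_norm_inject[OF e] distrib_right \<kappa>_def)
    qed
    have "\<epsilon> * (\<Sum>k<K. r k) \<le> (\<Sum>k<K. sq_norm (Cp *\<^sub>v \<xi> k)) + \<epsilon> * (\<Sum>k<K. r k)"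
      by (simp add: sum_nonneg sq_norm_nonneg)
    also have "\<dots> \<le> quad_form P (ext_state u w \<xi> 0)
          + (\<Sum>k<K. 2 * scalar_prod (ext_drift u w \<xi> k) (P *\<^sub>v inject (e k)) + quad_form P (inject (e k)))"
      unfolding r_def
      by (rule diss[where H = H and \<xi> = \<xi> and e = e and y = y and w = w and u = u and K = K])
        (rule H \<xi> e y w u_def step)+
    also have "\<dots> \<le> cV * sq_norm (\<xi> 0) + (\<Sum>k<K. \<epsilon> / 2 * r k + \<kappa> * sq_norm (e k))"
      using cV(2)[OF inject_carrier[OF \<xi>[of 0]]]
      by (intro add_mono[OF _ sum_mono[OF cross]]) (simp add: ext_state_0 sq_norm_inject[OF \<xi>])
    also have "\<dots> = cV * sq_norm (\<xi> 0) + \<epsilon> / 2 * (\<Sum>k<K. r k) + \<kappa> * (\<Sum>k<K. sq_norm (e k))"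
      by (simp add: sum.distrib sum_distrib_left)
    also have "cV * sq_norm (\<xi> 0) \<le> \<kappa> * sq_norm (\<xi> 0)"
      using cc by (intro mult_right_mono) (auto simp: sq_norm_nonneg \<kappa>_def)
    finally have tot: "\<epsilon> * (\<Sum>k<K. r k) \<le> \<kappa> * sq_norm (\<xi> 0) + \<epsilon> / 2 * (\<Sum>k<K. r k) + \<kappa> * (\<Sum>k<K. sq_norm (e k))" by simp
    have "\<epsilon> / 2 * (\<Sum>k<K. r k) \<le> \<kappa> * (sq_norm (\<xi> 0) + (\<Sum>k<K. sq_norm (e k)))"
    proof -
      have "\<epsilon> * (\<Sum>k<K. r k) = \<epsilon> / 2 * (\<Sum>k<K. r k) + \<epsilon> / 2 * (\<Sum>k<K. r k)" by simp
      with tot show ?thesis unfolding distrib_left by linarith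
    qed
    then have "2 / \<epsilon> * (\<epsilon> / 2 * (\<Sum>k<K. r k)) \<le> 2 / \<epsilon> * (\<kappa> * (sq_norm (\<xi> 0) + (\<Sum>k<K. sq_norm (e k))))"
      using \<epsilon> by (intro mult_left_mono) auto
    then have "(\<Sum>k<K. r k) \<le> c * (sq_norm (\<xi> 0) + (\<Sum>k<K. sq_norm (e k)))"
      using \<epsilon> by (simp add: c_def mult.assoc)
    moreover have "(\<Sum>k<K. sq_norm (\<xi> k)) \<le> (\<Sum>k<K. r k)"
    proof (rule sum_mono)
      fix k show "sq_norm (\<xi> k) \<le> r k"
        unfolding r_def using sq_norm_le_ext_state[of \<xi> k u w, OF \<xi>] sq_norm_nonneg[of "to_jvec (w k)"] by linarith
    qed
    ultimately show "(\<Sum>k<K. sq_norm (\<xi> k)) \<le> c * (sq_norm (\<xi> 0) + (\<Sum>k<K. sq_norm (e k)))" by simp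
  qed
qed

lemma lti_state_carrier: "lti_state Acl B (w :: nat \<Rightarrow> real ^ 'p) k \<in> carrier_vec np"
proof (induction k)
  case (Suc k)
  have "to_jvec (w k) \<in> carrier_vec p" unfolding p by simp
  then show ?case using Suc Acl B by auto
qed (use Acl in auto)

lemma lti_output:
  "lti Acl B C (0\<^sub>m p p) w k = (of_jvec (C *\<^sub>v lti_state Acl B w k) :: real ^ 'p)" for w :: "nat \<Rightarrow> real ^ 'p"
proof -
  have "C *\<^sub>v lti_state Acl B w k + 0\<^sub>m p p *\<^sub>v to_jvec (w k) = C *\<^sub>v lti_state Acl B w k"
    using C p by (intro eq_vecI) auto
  then show ?thesis by (simp add: lti_def)
qed

lemma Delta_well_posed:
  assumes H: "H \<in> S_class m L"
  shows "well_posed (lti Acl B C (0\<^sub>m p p)) (Delta m (H :: real ^ 'p \<Rightarrow> real))"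
proof (rule well_posed_strictly_causal)
  show "lti Acl B C (0\<^sub>m p p) u k = (lti Acl B C (0\<^sub>m p p) v k :: real ^ 'p)"
    if "\<forall>i<k. u i = v i" for u v :: "nat \<Rightarrow> real ^ 'p" and k
    unfolding lti_output lti_state_cong[OF that] ..
  show "Delta m H q k = slope H m (q k)" for q k by (rule Delta_eq_slope[OF H m mL])
qed

text \<open>Since \<open>C D\<^sup>\<dagger> = I\<close>, replacing the state \<open>s\<^sub>k\<close> by \<open>s\<^sub>k + D\<^sup>\<dagger> y\<^sub>i\<^sub>n\<^sub>,\<^sub>k\<close> turns the output
  disturbance \<open>y\<^sub>i\<^sub>n\<close> into a state disturbance.\<close>

lemma Delta_bounded_gain:
  assumes H: "H \<in> S_class m L" and Ddag: "Ddag \<in> carrier_mat np p" "C * Ddag = 1\<^sub>m p"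
  shows "bounded_l2_gain (inv_into UNIV (loop_map (lti Acl B C (0\<^sub>m p p)) (Delta m (H :: real ^ 'p \<Rightarrow> real))))"
proof (rule state_energy_bound, goal_cases)
  case (1 c)
  note c = 1(1) and energy = 1(2)
  let ?T = "loop_map (lti Acl B C (0\<^sub>m p p)) (Delta m H)"
  have AD: "Acl * Ddag \<in> carrier_mat np p" using Acl Ddag by simp
  obtain c1 where c1: "c1 \<ge> 0" "\<And>v. v \<in> carrier_vec p \<Longrightarrow> sq_norm (Ddag *\<^sub>v v) \<le> c1 * sq_norm v"
    by (rule mat_mult_bound[OF Ddag(1)]; rule that; blast)
  obtain c2 where c2: "c2 \<ge> 0" "\<And>v. v \<in> carrier_vec p \<Longrightarrow> sq_norm ((- (Acl * Ddag)) *\<^sub>v v) \<le> c2 * sq_norm v"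
    by (rule mat_mult_bound[OF uminus_carrier_iff_mat[THEN iffD2, OF AD]]; rule that; blast)
  obtain c3 where c3: "c3 \<ge> 0" "\<And>v. v \<in> carrier_vec np \<Longrightarrow> sq_norm (C *\<^sub>v v) \<le> c3 * sq_norm v"
    by (rule mat_mult_bound[OF C]; rule that; blast)
  show ?case
  proof (rule bounded_l2_gainI)
    \<comment> \<open>\<open>3 * c1\<close> collects one \<open>c1\<close> from the initial state
      and two from the perturbation, \<open>2 * c2\<close> its other half; \<open>c3\<close> passes
      from state to output.\<close>
    show "c3 * (c * (3 * c1 + 2 * c2)) \<ge> 0" using c c1 c2 c3 by (intro mult_nonneg_nonneg) auto
    fix v :: "nat \<Rightarrow> real ^ 'p" and K assume v: "summable (\<lambda>k. (norm (v k))\<^sup>2)"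
    let ?q = "inv_into UNIV ?T v" and ?Y = "\<Sum>k. (norm (v k))\<^sup>2"
    define w where "w = Delta m H ?q"
    define s where "s = lti_state Acl B w"
    define \<xi> where "\<xi> k = s k + Ddag *\<^sub>v to_jvec (v k)" for k
    \<comment> \<open>The defect of the shifted state in the undisturbed recursion. It involves the
      disturbance at two successive times, hence the shifted partial sums below.\<close>
    define e where "e k = Ddag *\<^sub>v to_jvec (v (Suc k)) + (- (Acl * Ddag)) *\<^sub>v to_jvec (v k)" for k
    have surj: "surj ?T" using Delta_well_posed[OF H] unfolding well_posed_def by (simp add: bij_is_surj)
    have q: "?q k = v k + of_jvec (C *\<^sub>v s k)" for k
    proof -
      have "?T ?q k = v k" by (simp add: surj_f_inv_f[OF surj])
      then show ?thesis unfolding loop_map_def lti_output w_def[symmetric] s_def[symmetric] by (simp add: algebra_simps)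
    qed
    have s: "s k \<in> carrier_vec np" for k unfolding s_def by (rule lti_state_carrier)
    have jv: "to_jvec (x :: real ^ 'p) \<in> carrier_vec p" for x unfolding p by simp
    have Dv: "Ddag *\<^sub>v to_jvec (v k) \<in> carrier_vec np" for k using Ddag jv by auto
    have \<xi>: "\<xi> k \<in> carrier_vec np" for k unfolding \<xi>_def using s Dv by simp
    have e: "e k \<in> carrier_vec np" for k unfolding e_def using Dv AD jv by auto
    have C\<xi>: "to_jvec (?q k) = C *\<^sub>v \<xi> k" for k
    proof -
      have "C *\<^sub>v \<xi> k = C *\<^sub>v s k + C *\<^sub>v (Ddag *\<^sub>v to_jvec (v k))"
        unfolding \<xi>_def by (rule mult_add_distrib_mat_vec[OF C s Dv])
      also have "C *\<^sub>v (Ddag *\<^sub>v to_jvec (v k)) = to_jvec (v k)"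
        using assoc_mult_mat_vec[OF C Ddag(1) jv] Ddag(2) jv by simp
      finally have "C *\<^sub>v \<xi> k = C *\<^sub>v s k + to_jvec (v k)" .
      moreover have "to_jvec (of_jvec (C *\<^sub>v s k) :: real ^ 'p) = C *\<^sub>v s k"
        by (rule to_jvec_of_jvec) (use C s p in auto)
      ultimately show ?thesis unfolding q to_jvec_add
        by (simp add: comm_add_vec[OF jv mult_mat_vec_carrier[OF C s]])
    qed
    have step: "\<xi> (Suc k) = Acl *\<^sub>v \<xi> k + B *\<^sub>v to_jvec (w k) + e k" for k
    proof -
      have A\<xi>: "Acl *\<^sub>v \<xi> k = Acl *\<^sub>v s k + (Acl * Ddag) *\<^sub>v to_jvec (v k)"
        unfolding \<xi>_def using mult_add_distrib_mat_vec[OF Acl s Dv] assoc_mult_mat_vec[OF Acl Ddag(1) jv] by simp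
      have N: "(- (Acl * Ddag)) *\<^sub>v to_jvec (v k) = - ((Acl * Ddag) *\<^sub>v to_jvec (v k))"
        by (rule uminus_mult_mat_vec) (use Ddag(1) p in simp)
      have "\<xi> (Suc k) = (Acl *\<^sub>v s k + B *\<^sub>v to_jvec (w k)) + Ddag *\<^sub>v to_jvec (v (Suc k))"
        by (simp add: \<xi>_def s_def)
      also have "\<dots> = Acl *\<^sub>v \<xi> k + B *\<^sub>v to_jvec (w k) + e k"
      proof -
        have "(a + b) + c = (a + d) + b + (c + - d)"
          if "a \<in> carrier_vec np" "b \<in> carrier_vec np" "c \<in> carrier_vec np" "d \<in> carrier_vec np" for a b c d :: "real Matrix.vec"
          using that by (intro eq_vecI) auto
        from this[OF mult_mat_vec_carrier[OF Acl s] mult_mat_vec_carrier[OF B jv] Dv mult_mat_vec_carrier[OF AD jv]]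
        show ?thesis unfolding A\<xi> e_def N .
      qed
      finally show ?thesis .
    qed
    have sq: "sq_norm (to_jvec x) = (norm x)\<^sup>2" for x :: "real ^ 'p"
      by (simp add: scalar_prod_to_jvec power2_norm_eq_inner)
    have partial: "(\<Sum>k<K. (norm (v k))\<^sup>2) \<le> ?Y" for K by (rule sum_le_suminf[OF v]) auto
    have "(\<Sum>k<K. (norm (v (Suc k)))\<^sup>2) \<le> (\<Sum>k<Suc K. (norm (v k))\<^sup>2)"
      by (subst sum.lessThan_Suc_shift) simp
    then have partial': "(\<Sum>k<K. (norm (v (Suc k)))\<^sup>2) \<le> ?Y" using partial order.trans by blast
    have "sq_norm (e k) \<le> 2 * (c1 * (norm (v (Suc k)))\<^sup>2) + 2 * (c2 * (norm (v k))\<^sup>2)" for k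
    proof -
      have "- (Acl * Ddag) \<in> carrier_mat np p" using AD by simp
      then have "sq_norm (e k) \<le> 2 * sq_norm (Ddag *\<^sub>v to_jvec (v (Suc k))) + 2 * sq_norm ((- (Acl * Ddag)) *\<^sub>v to_jvec (v k))"
        unfolding e_def by (intro sq_norm_add_le[OF Dv] mult_mat_vec_carrier[OF _ jv])
      then show ?thesis
        using c1(2)[OF jv[of "v (Suc k)"]] c2(2)[OF jv[of "v k"]] unfolding sq by linarith
    qed
    then have "(\<Sum>k<K. sq_norm (e k)) \<le> (\<Sum>k<K. 2 * (c1 * (norm (v (Suc k)))\<^sup>2) + 2 * (c2 * (norm (v k))\<^sup>2))"
      by (intro sum_mono)
    also have "\<dots> = 2 * (c1 * (\<Sum>k<K. (norm (v (Suc k)))\<^sup>2)) + 2 * (c2 * (\<Sum>k<K. (norm (v k))\<^sup>2))"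
      by (simp only: sum.distrib sum_distrib_left)
    also have "\<dots> \<le> 2 * (c1 * ?Y) + 2 * (c2 * ?Y)"
      using c1(1) c2(1) partial partial' by (intro add_mono mult_left_mono) auto
    finally have E: "(\<Sum>k<K. sq_norm (e k)) \<le> 2 * (c1 * ?Y) + 2 * (c2 * ?Y)" .
    have "sq_norm (\<xi> 0) \<le> c1 * (norm (v 0))\<^sup>2"
    proof -
      have "\<xi> 0 = Ddag *\<^sub>v to_jvec (v 0)"
        using Acl Dv[of 0] by (simp add: \<xi>_def s_def)
      then show ?thesis using c1(2)[OF jv[of "v 0"]] by (simp add: sq)
    qed
    also have "\<dots> \<le> c1 * ?Y" using c1(1) partial[of 1] by (intro mult_left_mono) auto
    finally have X0: "sq_norm (\<xi> 0) \<le> c1 * ?Y" .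
    have "(\<Sum>k<K. (norm (?q k))\<^sup>2) \<le> (\<Sum>k<K. c3 * sq_norm (\<xi> k))"
      using c3(2)[OF \<xi>] by (intro sum_mono) (simp flip: sq add: C\<xi>)
    also have "\<dots> = c3 * (\<Sum>k<K. sq_norm (\<xi> k))" by (simp add: sum_distrib_left)
    also have "\<dots> \<le> c3 * (c * (sq_norm (\<xi> 0) + (\<Sum>k<K. sq_norm (e k))))"
    proof (rule mult_left_mono[OF energy[where H = H and y = ?q and w = w and \<xi> = \<xi> and e = e and K = K] c3(1)])
      show "w k = slope H m (?q k)" for k unfolding w_def by (rule Delta_eq_slope[OF H m mL])
    qed (rule H \<xi> e C\<xi> step)+
    also have "\<dots> \<le> c3 * (c * (c1 * ?Y + (2 * (c1 * ?Y) + 2 * (c2 * ?Y))))"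
      using c3(1) c X0 E by (intro mult_left_mono add_mono) auto
    also have "\<dots> = c3 * (c * (3 * c1 + 2 * c2)) * ?Y" by (simp add: algebra_simps)
    finally show "(\<Sum>k<K. (norm (?q k))\<^sup>2) \<le> c3 * (c * (3 * c1 + 2 * c2)) * ?Y" .
  qed
qed

end

section \<open>White noise\<close>

text \<open>The class of quantities known before time \<open>k\<close>. Measurability on the finite
  product and insensitivity to \<open>restrict\<close> give independence from the noise at time
  \<open>k\<close>; the quadratic bound gives finite second moments. Restriction is explicit because
  the product space consists of extensional functions.\<close>

definition past_functional :: "nat \<Rightarrow> ((nat \<Rightarrow> real ^ 'w::finite) \<Rightarrow> real) \<Rightarrow> bool" where
  "past_functional k T \<longleftrightarrow> T \<in> borel_measurable (PiM {..<k} (\<lambda>_. borel)) \<and>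
     (\<forall>v. T (restrict v {..<k}) = T v) \<and> (\<exists>c\<ge>0. \<forall>v. (T v)\<^sup>2 \<le> c * (\<Sum>i<k. (norm (v i))\<^sup>2))"

lemma past_functional_zero: "past_functional k (\<lambda>_. 0)"
  unfolding past_functional_def by (auto intro!: exI[of _ 0])

lemma past_functional_scale:
  assumes "past_functional k T" shows "past_functional k (\<lambda>v. a * T v)"
proof -
  obtain c where c: "c \<ge> 0" "\<And>v. (T v)\<^sup>2 \<le> c * (\<Sum>i<k. (norm (v i))\<^sup>2)"
    using assms unfolding past_functional_def by blast
  have "(a * T v)\<^sup>2 \<le> (a\<^sup>2 * c) * (\<Sum>i<k. (norm (v i))\<^sup>2)" for v
    unfolding power_mult_distrib mult.assoc by (rule mult_left_mono[OF c(2)]) simp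
  moreover have "a\<^sup>2 * c \<ge> 0" using c(1) by simp
  ultimately show ?thesis using assms unfolding past_functional_def by auto
qed

lemma past_functional_add:
  assumes "past_functional k T" "past_functional k U" shows "past_functional k (\<lambda>v. T v + U v)"
proof -
  obtain c where c: "c \<ge> 0" "\<And>v. (T v)\<^sup>2 \<le> c * (\<Sum>i<k. (norm (v i))\<^sup>2)"
    using assms unfolding past_functional_def by blast
  obtain e where e: "e \<ge> 0" "\<And>v. (U v)\<^sup>2 \<le> e * (\<Sum>i<k. (norm (v i))\<^sup>2)"
    using assms unfolding past_functional_def by blast
  have "(T v + U v)\<^sup>2 \<le> (2 * c + 2 * e) * (\<Sum>i<k. (norm (v i))\<^sup>2)" for v
  proof -
    have "(T v + U v)\<^sup>2 \<le> 2 * (T v)\<^sup>2 + 2 * (U v)\<^sup>2"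
      using zero_le_power2[of "T v - U v"] by (simp add: power2_sum power2_diff)
    with c(2)[of v] e(2)[of v] show ?thesis unfolding distrib_right mult.assoc by linarith
  qed
  moreover have "2 * c + 2 * e \<ge> 0" using c(1) e(1) by simp
  ultimately show ?thesis using assms unfolding past_functional_def by auto
qed

lemma past_functional_sum:
  assumes "\<And>i. i \<in> I \<Longrightarrow> past_functional k (T i)" shows "past_functional k (\<lambda>v. \<Sum>i\<in>I. T i v)"
  using assms
  by (induction I rule: infinite_finite_induct) (auto simp: past_functional_zero past_functional_add)

lemma past_functional_mono:
  assumes T: "past_functional j T" and jk: "j \<le> k" shows "past_functional k T"
proof -
  obtain c where c: "c \<ge> 0" "\<And>v. (T v)\<^sup>2 \<le> c * (\<Sum>i<j. (norm (v i))\<^sup>2)"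
    using assms unfolding past_functional_def by blast
  have meas: "T \<in> borel_measurable (PiM {..<j} (\<lambda>_. borel))" and restr: "\<And>v. T (restrict v {..<j}) = T v"
    using T unfolding past_functional_def by auto
  have "(\<lambda>v. T (restrict v {..<j})) \<in> borel_measurable (PiM {..<k} (\<lambda>_. borel))"
    by (rule measurable_compose[OF measurable_restrict_subset meas]) (use jk in auto)
  then have 1: "T \<in> borel_measurable (PiM {..<k} (\<lambda>_. borel))" by (simp add: restr)
  have 2: "T (restrict v {..<k}) = T v" for v
  proof -
    have "restrict (restrict v {..<k}) {..<j} = restrict v {..<j}" using jk by auto
    then show ?thesis using restr[of v] restr[of "restrict v {..<k}"] by simp
  qed
  have 3: "(T v)\<^sup>2 \<le> c * (\<Sum>i<k. (norm (v i))\<^sup>2)" for v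
    using c(2)[of v] by (rule order.trans) (use c(1) jk in \<open>auto intro!: mult_left_mono sum_mono2\<close>)
  show ?thesis unfolding past_functional_def using 1 2 3 c(1) by blast
qed

lemma borel_measurable_of_components:
  fixes f :: "'a \<Rightarrow> real ^ 'p::finite"
  assumes "\<And>i. (\<lambda>x. vec_nth (f x) i) \<in> borel_measurable M"
  shows "f \<in> borel_measurable M"
  by (rule borel_measurable_euclidean_space[THEN iffD2]) (auto simp: Basis_vec_def inner_axis assms)

lemma borel_measurable_component:
  fixes f :: "'a \<Rightarrow> real ^ 'p::finite"
  assumes "f \<in> borel_measurable M" shows "(\<lambda>x. vec_nth (f x) i) \<in> borel_measurable M"
proof -
  have "(\<lambda>x. inner (f x) (axis i 1)) \<in> borel_measurable M" using assms by simp
  then show ?thesis by (simp add: inner_axis)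
qed

lemma component_le_norm_power2: "(vec_nth (x :: real ^ 'p::finite) i)\<^sup>2 \<le> (norm x)\<^sup>2"
  using component_le_norm_cart[of x i] by (metis abs_ge_zero power2_abs power_mono)

lemma norm_power2_eq_sum: "(norm (x :: real ^ 'p::finite))\<^sup>2 = (\<Sum>i\<in>UNIV. (vec_nth x i)\<^sup>2)"
  by (simp add: norm_vec_def L2_set_def sum_nonneg)

lemma past_functional_input:
  "past_functional (Suc k) (\<lambda>v :: nat \<Rightarrow> real ^ 'w::finite. vec_nth (v k) i)"
  unfolding past_functional_def
proof (intro conjI exI allI)
  show "(\<lambda>v :: nat \<Rightarrow> real ^ 'w. vec_nth (v k) i) \<in> borel_measurable (PiM {..<Suc k} (\<lambda>_. borel))"
    by (rule borel_measurable_component[of "\<lambda>v. v k"], rule measurable_component_singleton) simp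
  fix v :: "nat \<Rightarrow> real ^ 'w"
  show "(vec_nth (v k) i)\<^sup>2 \<le> 1 * (\<Sum>i<Suc k. (norm (v i))\<^sup>2)"
    using component_le_norm_power2[of "v k" i] by (simp add: add_increasing sum_nonneg)
qed simp_all

text \<open>The nonlinearity preserves the class: continuity keeps measurability, and a Lipschitz
  bound with \<open>\<phi> 0 = 0\<close> keeps linear growth.\<close>

lemma past_functional_Lipschitz:
  fixes y :: "(nat \<Rightarrow> real ^ 'w::finite) \<Rightarrow> real ^ 'p::finite" and \<phi> :: "real ^ 'p \<Rightarrow> real ^ 'p"
  assumes y: "\<And>i. past_functional k (\<lambda>v. vec_nth (y v) i)"
    and zero: "\<phi> 0 = 0" and K: "\<And>a b. norm (\<phi> a - \<phi> b) \<le> K * norm (a - b)"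
  shows "past_functional k (\<lambda>v. vec_nth (\<phi> (y v)) i)"
proof -
  have "\<forall>i. \<exists>c\<ge>0. \<forall>v. (vec_nth (y v) i)\<^sup>2 \<le> c * (\<Sum>j<k. (norm (v j))\<^sup>2)"
    using y unfolding past_functional_def by blast
  then obtain c where c: "\<And>i. c i \<ge> 0" "\<And>i v. (vec_nth (y v) i)\<^sup>2 \<le> c i * (\<Sum>j<k. (norm (v j))\<^sup>2)"
    by metis
  have K0: "(norm (\<phi> a))\<^sup>2 \<le> K\<^sup>2 * (norm a)\<^sup>2" for a
    using power_mono[OF K[of a 0] norm_ge_zero, of 2] by (simp add: zero power_mult_distrib)
  \<comment> \<open>The constant \<open>K\<close> carries no sign assumption, whereas a Lipschitz
    constant has to be nonnegative; hence \<open>max K 0\<close>.\<close>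
  have "continuous_on UNIV \<phi>"
  proof (rule lipschitz_on_continuous_on[of "max K 0"])
    show "lipschitz_on (max K 0) UNIV \<phi>"
    proof (rule lipschitz_onI)
      fix a b
      have "norm (\<phi> a - \<phi> b) \<le> max K 0 * norm (a - b)"
        using K[of a b] by (rule order.trans) (auto intro!: mult_right_mono)
      then show "dist (\<phi> a) (\<phi> b) \<le> max K 0 * dist a b" by (simp add: dist_norm)
    qed simp
  qed
  then have \<phi>: "\<phi> \<in> borel_measurable borel" by (rule borel_measurable_continuous_onI)
  have ym: "y \<in> borel_measurable (PiM {..<k} (\<lambda>_. borel))"
    by (rule borel_measurable_of_components) (use y in \<open>auto simp: past_functional_def\<close>)
  have yr: "y (restrict v {..<k}) = y v" for v
    using y unfolding past_functional_def Finite_Cartesian_Product.vec_eq_iff by blast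
  have bound: "(vec_nth (\<phi> (y v)) i)\<^sup>2 \<le> (K\<^sup>2 * (\<Sum>j\<in>UNIV. c j)) * (\<Sum>j<k. (norm (v j))\<^sup>2)" for v
  proof -
    have "(vec_nth (\<phi> (y v)) i)\<^sup>2 \<le> K\<^sup>2 * (norm (y v))\<^sup>2"
      using component_le_norm_power2 K0 by (rule order.trans)
    also have "(norm (y v))\<^sup>2 \<le> (\<Sum>j\<in>UNIV. c j * (\<Sum>j<k. (norm (v j))\<^sup>2))"
      unfolding norm_power2_eq_sum[of "y v"] by (intro sum_mono c(2))
    finally show ?thesis by (simp add: sum_distrib_right mult.assoc mult_left_mono)
  qed
  have "K\<^sup>2 * (\<Sum>j\<in>UNIV. c j) \<ge> 0" using c(1) by (intro mult_nonneg_nonneg sum_nonneg) auto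
  with bound show ?thesis unfolding past_functional_def
    by (intro conjI exI[of _ "K\<^sup>2 * (\<Sum>j\<in>UNIV. c j)"] allI)
      (auto simp: yr intro!: borel_measurable_component[OF measurable_compose[OF ym \<phi>]])
qed

section \<open>Moments of the noise and of functionals of its past\<close>

context
  fixes M :: "'o measure" and wp :: "nat \<Rightarrow> 'o \<Rightarrow> real ^ 'w::finite"
  assumes noise: "white_noise M wp"
begin

lemma noise_prob_space: "prob_space M"
  using noise by (simp add: white_noise_def)

lemma noise_measurable: "wp k \<in> borel_measurable M"
proof -
  have "prob_space.indep_vars M (\<lambda>_. borel) wp UNIV" using noise by (simp add: white_noise_def)
  then show ?thesis unfolding prob_space.indep_vars_def2[OF noise_prob_space] by blast
qed

lemma noise_square_integrable: "integrable M (\<lambda>\<omega>. (norm (wp k \<omega>))\<^sup>2)"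
  using noise by (simp add: white_noise_def)

lemma noise_integrable: "integrable M (wp k)"
proof (rule Bochner_Integration.integrable_bound)
  interpret prob_space M by (rule noise_prob_space)
  show "integrable M (\<lambda>\<omega>. 1 + (norm (wp k \<omega>))\<^sup>2)" using noise_square_integrable by simp
  have "a \<le> 1 + a\<^sup>2" for a :: real using zero_le_power2[of "a - 1"] by (simp add: power2_diff) (smt (verit) zero_le_power2)
  then show "AE \<omega> in M. norm (wp k \<omega>) \<le> norm (1 + (norm (wp k \<omega>))\<^sup>2)" by (auto simp: abs_of_nonneg)
qed (rule noise_measurable)

lemma noise_component_mean: "(LINT \<omega>|M. vec_nth (wp k \<omega>) i) = 0"
proof -
  have "(LINT \<omega>|M. inner (wp k \<omega>) (axis i 1)) = inner (LINT \<omega>|M. wp k \<omega>) (axis i 1)"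
    by (rule integral_inner_left) (rule noise_integrable)
  also have "(LINT \<omega>|M. wp k \<omega>) = 0" using noise by (simp add: white_noise_def)
  finally show ?thesis by (simp add: inner_axis)
qed

lemma noise_component_product_integrable: "integrable M (\<lambda>\<omega>. vec_nth (wp k \<omega>) i * vec_nth (wp k \<omega>) j)"
proof (rule Bochner_Integration.integrable_bound[OF noise_square_integrable])
  show "AE \<omega> in M. norm (vec_nth (wp k \<omega>) i * vec_nth (wp k \<omega>) j) \<le> norm ((norm (wp k \<omega>))\<^sup>2)"
    by (auto simp: abs_mult power2_eq_square intro!: mult_mono component_le_norm_cart)
qed (intro borel_measurable_times borel_measurable_component noise_measurable)

lemma noise_component_covariance:
  "(LINT \<omega>|M. vec_nth (wp k \<omega>) i * vec_nth (wp k \<omega>) j) = (if i = j then 1 else 0)"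
  using noise by (simp add: white_noise_def)

lemma past_functional_measurable:
  assumes T: "past_functional k T" shows "(\<lambda>\<omega>. T (\<lambda>j. wp j \<omega>)) \<in> borel_measurable M"
proof -
  have "(\<lambda>\<omega>. restrict (\<lambda>j. wp j \<omega>) {..<k}) \<in> measurable M (PiM {..<k} (\<lambda>_. borel))"
    by (intro measurable_restrict noise_measurable)
  then have "(\<lambda>\<omega>. T (restrict (\<lambda>j. wp j \<omega>) {..<k})) \<in> borel_measurable M"
    by (rule measurable_compose) (use T in \<open>simp add: past_functional_def\<close>)
  then show ?thesis using T by (simp add: past_functional_def)
qed

lemma past_functional_square_integrable:
  assumes T: "past_functional k T" shows "integrable M (\<lambda>\<omega>. (T (\<lambda>j. wp j \<omega>))\<^sup>2)"
proof -
  obtain c where c: "c \<ge> 0" "\<And>v. (T v)\<^sup>2 \<le> c * (\<Sum>i<k. (norm (v i))\<^sup>2)"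
    using T unfolding past_functional_def by blast
  show ?thesis
  proof (rule Bochner_Integration.integrable_bound)
    show "integrable M (\<lambda>\<omega>. c * (\<Sum>i<k. (norm (wp i \<omega>))\<^sup>2))"
      by (intro integrable_mult_right Bochner_Integration.integrable_sum noise_square_integrable)
    show "AE \<omega> in M. norm ((T (\<lambda>j. wp j \<omega>))\<^sup>2) \<le> norm (c * (\<Sum>i<k. (norm (wp i \<omega>))\<^sup>2))"
      using c by (auto simp: abs_of_nonneg sum_nonneg)
    show "(\<lambda>\<omega>. (T (\<lambda>j. wp j \<omega>))\<^sup>2) \<in> borel_measurable M"
      using past_functional_measurable[OF T] by simp
  qed
qed

text \<open>The noise values with index below \<open>k\<close> and the single value at
  \<open>k\<close> are disjoint groups of an independent family, so the expectation factors, and the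
  second factor has mean zero.\<close>

lemma past_functional_noise_uncorrelated:
  assumes T: "past_functional k T"
  shows "integrable M (\<lambda>\<omega>. T (\<lambda>j. wp j \<omega>) * vec_nth (wp k \<omega>) i)"
    and "(LINT \<omega>|M. T (\<lambda>j. wp j \<omega>) * vec_nth (wp k \<omega>) i) = 0"
proof -
  interpret prob_space M by (rule noise_prob_space)
  have ind: "indep_vars (\<lambda>_. borel) wp UNIV" using noise by (simp add: white_noise_def)
  have "indep_var (PiM {..<k} (\<lambda>_. borel)) (\<lambda>\<omega>. restrict (\<lambda>i. wp i \<omega>) {..<k})
      (PiM {k} (\<lambda>_. borel)) (\<lambda>\<omega>. restrict (\<lambda>i. wp i \<omega>) {k})"
    by (rule indep_var_restrict[OF ind]) auto
  then have "indep_var borel (T \<circ> (\<lambda>\<omega>. restrict (\<lambda>i. wp i \<omega>) {..<k}))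
      borel ((\<lambda>f. vec_nth (f k) i) \<circ> (\<lambda>\<omega>. restrict (\<lambda>i. wp i \<omega>) {k}))"
  proof (rule indep_var_compose)
    show "T \<in> borel_measurable (PiM {..<k} (\<lambda>_. borel))" using T by (simp add: past_functional_def)
    show "(\<lambda>f :: nat \<Rightarrow> real ^ 'w. vec_nth (f k) i) \<in> borel_measurable (PiM {k} (\<lambda>_. borel))"
      by (rule borel_measurable_component[of "\<lambda>f. f k"], rule measurable_component_singleton) simp
  qed
  moreover have "T \<circ> (\<lambda>\<omega>. restrict (\<lambda>i. wp i \<omega>) {..<k}) = (\<lambda>\<omega>. T (\<lambda>j. wp j \<omega>))"
    using T by (auto simp: past_functional_def fun_eq_iff)
  moreover have "(\<lambda>f. vec_nth (f k) i) \<circ> (\<lambda>\<omega>. restrict (\<lambda>i. wp i \<omega>) {k}) = (\<lambda>\<omega>. vec_nth (wp k \<omega>) i)"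
    by (simp add: fun_eq_iff)
  ultimately have iv: "indep_var borel (\<lambda>\<omega>. T (\<lambda>j. wp j \<omega>)) borel (\<lambda>\<omega>. vec_nth (wp k \<omega>) i)" by simp
  have i1: "integrable M (\<lambda>\<omega>. T (\<lambda>j. wp j \<omega>))"
    by (rule square_integrable_imp_integrable[OF past_functional_measurable[OF T] past_functional_square_integrable[OF T]])
  have i2: "integrable M (\<lambda>\<omega>. vec_nth (wp k \<omega>) i)"
    by (rule square_integrable_imp_integrable[OF borel_measurable_component[OF noise_measurable]])
      (use noise_component_product_integrable[of k i i] in \<open>simp add: power2_eq_square\<close>)
  show "integrable M (\<lambda>\<omega>. T (\<lambda>j. wp j \<omega>) * vec_nth (wp k \<omega>) i)"
    by (rule indep_var_integrable[OF iv i1 i2])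
  show "(LINT \<omega>|M. T (\<lambda>j. wp j \<omega>) * vec_nth (wp k \<omega>) i) = 0"
    using indep_var_lebesgue_integral[OF iv i1 i2] by (simp add: noise_component_mean)
qed

text \<open>Identity covariance leaves only the diagonal entries of \<open>R\<close>.\<close>

lemma noise_quad_form:
  assumes R: "R \<in> carrier_mat CARD('w) CARD('w)"
  shows "integrable M (\<lambda>\<omega>. quad_form R (to_jvec (wp k \<omega>)))"
    and "(LINT \<omega>|M. quad_form R (to_jvec (wp k \<omega>))) = mat_trace R"
proof -
  let ?e = "from_nat_into (UNIV :: 'w set)"
  \<comment> \<open>The covariance compares elements of the index type, the trace compares
    positions; injectivity of the enumeration identifies the two.\<close>
  have inj: "?e i = ?e j \<longleftrightarrow> i = j" if "i < CARD('w)" "j < CARD('w)" for i j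
    using bij_betw_imp_inj_on[OF bij_betw_from_nat_into_UNIV[where 'p = 'w]] that by (auto simp: inj_on_def)
  have q: "quad_form R (to_jvec (wp k \<omega>)) =
      (\<Sum>i<CARD('w). \<Sum>j<CARD('w). R $$ (i, j) * (vec_nth (wp k \<omega>) (?e i) * vec_nth (wp k \<omega>) (?e j)))" for \<omega>
    unfolding quad_form_eq_sum[OF R to_jvec_carrier] by (auto simp: to_jvec_def mult_ac intro!: sum.cong)
  show "integrable M (\<lambda>\<omega>. quad_form R (to_jvec (wp k \<omega>)))"
    unfolding q by (intro Bochner_Integration.integrable_sum integrable_mult_right noise_component_product_integrable)
  have "(LINT \<omega>|M. quad_form R (to_jvec (wp k \<omega>))) =
      (\<Sum>i<CARD('w). \<Sum>j<CARD('w). R $$ (i, j) * (if ?e i = ?e j then 1 else 0))"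
    unfolding q
    by (simp add: Bochner_Integration.integral_sum Bochner_Integration.integrable_sum noise_component_product_integrable noise_component_covariance
        del: mult_cancel_left1)
  also have "\<dots> = (\<Sum>i<CARD('w). \<Sum>j<CARD('w). if i = j then R $$ (i, j) else 0)"
    by (intro sum.cong refl) (auto simp: inj)
  also have "\<dots> = mat_trace R" using R by (simp add: mat_trace_def)
  finally show "(LINT \<omega>|M. quad_form R (to_jvec (wp k \<omega>))) = mat_trace R" .
qed

end

section \<open>Performance\<close>

lemma past_functional_mult_mat_vec:
  fixes x :: "(nat \<Rightarrow> real ^ 'w::finite) \<Rightarrow> real Matrix.vec"
  assumes M: "M \<in> carrier_mat r c" and x: "\<And>v. x v \<in> carrier_vec c"
    and xj: "\<And>j. j < c \<Longrightarrow> past_functional k (\<lambda>v. x v $ j)" and i: "i < r"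
  shows "past_functional k (\<lambda>v. (M *\<^sub>v x v) $ i)"
proof -
  have "(M *\<^sub>v x v) $ i = (\<Sum>j<c. M $$ (i, j) * x v $ j)" for v
    using M x[of v] i by (auto simp: scalar_prod_def lessThan_atLeast0 intro!: sum.cong)
  then show ?thesis by (auto intro!: past_functional_sum past_functional_scale xj)
qed

lemma past_functional_add_vec:
  fixes x y :: "(nat \<Rightarrow> real ^ 'w::finite) \<Rightarrow> real Matrix.vec"
  assumes "\<And>v. y v \<in> carrier_vec c" "i < c"
    and "past_functional k (\<lambda>v. x v $ i)" "past_functional k (\<lambda>v. y v $ i)"
  shows "past_functional k (\<lambda>v. (x v + y v) $ i)"
  using past_functional_add[OF assms(3,4)] assms(1,2) by (simp add: carrier_vecD[OF assms(1)])

section \<open>The closed loop as a function of its noise\<close>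

locale driven_lmi_system = lmi_system p np lp lm ny m L Acl B C Cp P Mp Mm M0 ptype
  for p np lp lm ny m L Acl B C Cp P Mp Mm M0 and ptype :: "'p::finite itself" +
  fixes Bp :: "real mat" and H :: "real ^ 'p \<Rightarrow> real" and wtype :: "'w::finite itself"
  assumes Bp: "Bp \<in> carrier_mat np CARD('w)" and H: "H \<in> S_class m L"
begin

text \<open>The zero-state trajectory as an explicit function of the input sequence, so that it can
  be studied as a functional of the noise without a probability space.\<close>

primrec response :: "(nat \<Rightarrow> real ^ 'w) \<Rightarrow> nat \<Rightarrow> real Matrix.vec" where
  "response v 0 = 0\<^sub>v np"
| "response v (Suc k) = Acl *\<^sub>v response v k + B *\<^sub>v to_jvec (slope H m (of_jvec (C *\<^sub>v response v k)))
     + Bp *\<^sub>v to_jvec (v k)"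

definition outp :: "(nat \<Rightarrow> real ^ 'w) \<Rightarrow> nat \<Rightarrow> real ^ 'p" where
  "outp v k = of_jvec (C *\<^sub>v response v k)"

definition nonl :: "(nat \<Rightarrow> real ^ 'w) \<Rightarrow> nat \<Rightarrow> real ^ 'p" where
  "nonl v k = slope H m (outp v k)"

definition filt :: "(nat \<Rightarrow> real ^ 'w) \<Rightarrow> nat \<Rightarrow> real ^ 'p" where
  "filt v k = (L - m) *\<^sub>R outp v k - nonl v k"

lemma response_Suc:
  "response v (Suc k) = Acl *\<^sub>v response v k + B *\<^sub>v to_jvec (nonl v k) + Bp *\<^sub>v to_jvec (v k)"
  by (simp add: nonl_def outp_def)

declare response.simps(2) [simp del]

lemma jp: "to_jvec (x :: real ^ 'p) \<in> carrier_vec p"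
  unfolding p by simp

lemma Bp_input: "Bp *\<^sub>v to_jvec (x :: real ^ 'w) \<in> carrier_vec np"
  by (rule mult_mat_vec_carrier[OF Bp]) simp

lemma response_carrier: "response v k \<in> carrier_vec np"
proof (cases k)
  case (Suc j)
  then show ?thesis unfolding Suc response_Suc
    by (intro add_carrier_vec Bp_input mult_mat_vec_carrier[OF B jp]) (rule carrier_vecI, use Acl in simp)
qed simp

lemma outp_eq: "to_jvec (outp v k) = C *\<^sub>v response v k"
  unfolding outp_def
  by (rule to_jvec_of_jvec) (use mult_mat_vec_carrier[OF C response_carrier] p in simp)

lemma to_jvec_index: "i < CARD('a) \<Longrightarrow> to_jvec (x :: real ^ 'a::finite) $ i = vec_nth x (from_nat_into UNIV i)"
  by (simp add: to_jvec_def)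

lemma past_outp:
  assumes "\<And>i. i < np \<Longrightarrow> past_functional k (\<lambda>v. response v k $ i)"
  shows "past_functional k (\<lambda>v. vec_nth (outp v k) i)"
proof -
  have "vec_nth (outp v k) i = (C *\<^sub>v response v k) $ to_nat_on UNIV i" for v
    by (simp add: outp_def of_jvec_def)
  moreover have "past_functional k (\<lambda>v. (C *\<^sub>v response v k) $ to_nat_on (UNIV :: 'p set) i)"
    by (rule past_functional_mult_mat_vec[OF C response_carrier assms]) (use to_nat_on_lt_CARD p in auto)
  ultimately show ?thesis by simp
qed

lemma past_nonl:
  assumes "\<And>i. i < np \<Longrightarrow> past_functional k (\<lambda>v. response v k $ i)"
  shows "past_functional k (\<lambda>v. vec_nth (nonl v k) i)"
  unfolding nonl_def
  by (rule past_functional_Lipschitz[OF past_outp[OF assms] slope_zero[OF H m mL] slope_Lipschitz[OF H m mL]])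

text \<open>The input acts with one step of delay, so the state at time \<open>k\<close> involves
  only the inputs with index below \<open>k\<close>.\<close>

lemma past_response: "i < np \<Longrightarrow> past_functional k (\<lambda>v. response v k $ i)"
proof (induction k arbitrary: i)
  case 0
  then show ?case by (simp add: past_functional_zero)
next
  case (Suc k)
  have 1: "past_functional (Suc k) (\<lambda>v. (Acl *\<^sub>v response v k) $ i)"
    by (rule past_functional_mult_mat_vec[OF Acl response_carrier past_functional_mono[OF Suc.IH]]) (use Suc.prems in auto)
  have 2: "past_functional (Suc k) (\<lambda>v. (B *\<^sub>v to_jvec (nonl v k)) $ i)"
  proof (rule past_functional_mult_mat_vec[OF B jp])
    fix j assume "j < p"
    then show "past_functional (Suc k) (\<lambda>v. to_jvec (nonl v k) $ j)"
      using past_functional_mono[OF past_nonl[OF Suc.IH], of "Suc k"] unfolding p by (simp add: to_jvec_index)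
  qed (use Suc.prems in auto)
  have 3: "past_functional (Suc k) (\<lambda>v :: nat \<Rightarrow> real ^ 'w. (Bp *\<^sub>v to_jvec (v k)) $ i)"
  proof (rule past_functional_mult_mat_vec[where x = "\<lambda>v. to_jvec (v k)", OF Bp to_jvec_carrier])
    fix j assume "j < CARD('w)"
    then show "past_functional (Suc k) (\<lambda>v :: nat \<Rightarrow> real ^ 'w. to_jvec (v k) $ j)"
      by (simp add: to_jvec_index past_functional_input)
  qed (use Suc.prems in auto)
  show ?case unfolding response_Suc
    by (intro past_functional_add_vec[OF Bp_input Suc.prems] past_functional_add_vec[OF _ Suc.prems] 1 2 3
      mult_mat_vec_carrier[OF B jp])
qed

lemma past_filt: "past_functional k (\<lambda>v. vec_nth (filt v k) i)"
proof -
  have eq: "vec_nth (filt v k) i = (L - m) * vec_nth (outp v k) i + (-1) * vec_nth (nonl v k) i" for v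
    by (simp add: filt_def)
  show ?thesis
    unfolding eq by (intro past_functional_add past_functional_scale past_outp past_nonl past_response)
qed

text \<open>The register at time \<open>k + 1\<close> has delays of at least one, so it reads
  \<open>f\<close> at times up to \<open>k\<close> only, and these values involve inputs with index
  below \<open>k\<close>.\<close>

lemma past_past_inputs:
  fixes f :: "(nat \<Rightarrow> real ^ 'w) \<Rightarrow> nat \<Rightarrow> real ^ 'p"
  assumes f: "\<And>j i. past_functional j (\<lambda>v. vec_nth (f v j) i)" and i: "i < l * CARD('p)"
  shows "past_functional k (\<lambda>v. past_inputs l (f v) (Suc k) $ i)"
proof -
  let ?d = "l - i div CARD('p)"
  have d: "?d \<ge> 1" using block_index_div[OF i] by simp
  have r: "i mod CARD('p) < CARD('p)" by (rule block_index_mod[OF i])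
  have eq: "past_inputs l (f v) (Suc k) $ i = (if ?d \<le> Suc k then vec_nth (f v (Suc k - ?d)) (from_nat_into UNIV (i mod CARD('p))) else 0)" for v
    using i r by (simp add: past_inputs_def block_vec_index delayed_def to_jvec_index)
  show ?thesis
  proof (cases "?d \<le> Suc k")
    case True
    have "past_functional k (\<lambda>v. vec_nth (f v (Suc k - ?d)) (from_nat_into UNIV (i mod CARD('p))))"
      by (rule past_functional_mono[OF f]) (use d in simp)
    then show ?thesis unfolding eq using True by simp
  qed (simp add: eq past_functional_zero)
qed

abbreviation drift :: "(nat \<Rightarrow> real ^ 'w) \<Rightarrow> nat \<Rightarrow> real Matrix.vec" where
  "drift v k \<equiv> ext_drift (filt v) (nonl v) (response v) k"

text \<open>This is what makes the cross term vanish in the mean: everything in the next state apart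
  from the injected noise is already known before time \<open>k\<close>.\<close>

lemma past_drift:
  assumes i: "i < d" shows "past_functional k (\<lambda>v. drift v k $ i)"
proof -
  have dims: "dim_vec (past_inputs lm (filt v) (Suc k)) = lm * p" "dim_vec (past_inputs lp (nonl v) (Suc k)) = lp * p" for v
    by (simp_all add: past_inputs_def p)
  have eq: "drift v k $ i = (if i < lm * p then past_inputs lm (filt v) (Suc k) $ i
      else if i < lm * p + lp * p then past_inputs lp (nonl v) (Suc k) $ (i - lm * p)
      else (Acl *\<^sub>v response v k + B *\<^sub>v to_jvec (nonl v k)) $ (i - (lm * p + lp * p)))" for v
    using i dims[of v] B by (auto simp: ext_drift_def)
  consider "i < lm * p" | "\<not> i < lm * p" "i < lm * p + lp * p" | "\<not> i < lm * p" "\<not> i < lm * p + lp * p" by linarith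
  then show ?thesis
  proof cases
    case 1
    then show ?thesis unfolding eq using past_past_inputs[of filt, OF past_filt, of i lm] by (simp add: p)
  next
    case 2
    then show ?thesis unfolding eq
      using past_past_inputs[of nonl, OF past_nonl[OF past_response], of "i - lm * p" lp] by (simp add: p)
  next
    case 3
    let ?i = "i - (lm * p + lp * p)"
    have i': "?i < np" using 3 i by simp
    have "past_functional k (\<lambda>v. (Acl *\<^sub>v response v k + B *\<^sub>v to_jvec (nonl v k)) $ ?i)"
    proof (rule past_functional_add_vec[OF mult_mat_vec_carrier[OF B jp] i'])
      show "past_functional k (\<lambda>v. (Acl *\<^sub>v response v k) $ ?i)"
        by (rule past_functional_mult_mat_vec[OF Acl response_carrier past_response i'])
      show "past_functional k (\<lambda>v. (B *\<^sub>v to_jvec (nonl v k)) $ ?i)"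
        by (rule past_functional_mult_mat_vec[OF B jp _ i'])
          (use past_nonl[OF past_response] in \<open>simp add: to_jvec_index p\<close>)
    qed
    then show ?thesis unfolding eq using 3 by simp
  qed
qed

definition Bc2 :: "real mat" where
  "Bc2 = 0\<^sub>m (lm * p + lp * p) CARD('w) @\<^sub>r Bp"

lemma Bc2: "Bc2 \<in> carrier_mat d CARD('w)"
  unfolding Bc2_def by (rule carrier_append_rows[OF zero_carrier_mat Bp])

lemma inject_input: "inject (Bp *\<^sub>v to_jvec (x :: real ^ 'w)) = Bc2 *\<^sub>v to_jvec x"
  unfolding Bc2_def inject_def
  by (subst mat_mult_append[OF zero_carrier_mat Bp to_jvec_carrier])
    (auto intro!: eq_vecI arg_cong2[of _ _ _ _ append_vec])

text \<open>The initial storage is zero and the \<epsilon> term is dropped. Moving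
  \<open>P * Bc2\<close> to the other side of the scalar product separates a functional of the past
  from the current noise.\<close>

lemma response_energy:
  "(\<Sum>k<K. sq_norm (Cp *\<^sub>v response v k)) \<le>
    (\<Sum>k<K. 2 * scalar_prod (transpose_mat (P * Bc2) *\<^sub>v drift v k) (to_jvec (v k))
      + quad_form (transpose_mat Bc2 * P * Bc2) (to_jvec (v k)))"
proof (rule trajectory_dissipation, goal_cases)
  case (1 \<epsilon>)
  let ?X = "ext_state (filt v) (nonl v) (response v)"
  have "(\<Sum>k<K. sq_norm (Cp *\<^sub>v response v k)) + \<epsilon> * (\<Sum>k<K. sq_norm (?X k) + sq_norm (to_jvec (nonl v k)))
    \<le> quad_form P (?X 0) + (\<Sum>k<K. 2 * scalar_prod (drift v k) (P *\<^sub>v inject (Bp *\<^sub>v to_jvec (v k)))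
        + quad_form P (inject (Bp *\<^sub>v to_jvec (v k))))"
    by (rule 1(2)[where H = H and y = "outp v" and e = "\<lambda>k. Bp *\<^sub>v to_jvec (v k)"])
      (rule H response_carrier Bp_input outp_eq nonl_def filt_def response_Suc)+
  moreover have "quad_form P (?X 0) = 0"
  proof -
    have "?X 0 = 0\<^sub>v d" by (simp add: ext_state_0 inject_def zero_append_zero_vec)
    then show ?thesis using P by simp
  qed
  moreover have "\<epsilon> * (\<Sum>k<K. sq_norm (?X k) + sq_norm (to_jvec (nonl v k))) \<ge> 0"
    using 1(1) by (intro mult_nonneg_nonneg sum_nonneg add_nonneg_nonneg sq_norm_nonneg) auto
  moreover have "scalar_prod (drift v k) (P *\<^sub>v inject (Bp *\<^sub>v to_jvec (v k)))
      = scalar_prod (transpose_mat (P * Bc2) *\<^sub>v drift v k) (to_jvec (v k))" for k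
    unfolding inject_input assoc_mult_mat_vec[OF P Bc2 to_jvec_carrier, symmetric]
    by (rule transpose_vec_mult_scalar[symmetric, OF mult_carrier_mat[OF P Bc2] to_jvec_carrier
          ext_drift_carrier[of "response v" k, OF response_carrier]])
  moreover have "quad_form P (inject (Bp *\<^sub>v to_jvec (v k))) = quad_form (transpose_mat Bc2 * P * Bc2) (to_jvec (v k))" for k
    unfolding inject_input by (rule quad_form_congruence[symmetric, OF Bc2 P to_jvec_carrier])
  ultimately show ?case by simp
qed

lemma expected_energy:
  fixes M :: "'o measure" and wp :: "nat \<Rightarrow> 'o \<Rightarrow> real ^ 'w"
  assumes noise: "white_noise M wp"
  shows "integrable M (\<lambda>\<omega>. sq_norm (Cp *\<^sub>v response (\<lambda>j. wp j \<omega>) k))"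
    and "(\<Sum>k<K. LINT \<omega>|M. sq_norm (Cp *\<^sub>v response (\<lambda>j. wp j \<omega>) k))
      \<le> real K * mat_trace (transpose_mat Bc2 * P * Bc2)"
proof -
  let ?R = "transpose_mat Bc2 * P * Bc2" and ?G = "transpose_mat (P * Bc2)"
  have R: "?R \<in> carrier_mat CARD('w) CARD('w)"
    using Bc2 P by (intro mult_carrier_mat[of _ _ d]) auto
  have G: "?G \<in> carrier_mat CARD('w) d" using mult_carrier_mat[OF P Bc2] by simp
  \<comment> \<open>Each component of the output is a linear combination of past functionals and
    thus has a finite second moment.\<close>
  have "integrable M (\<lambda>\<omega>. \<Sum>i<ny. ((Cp *\<^sub>v response (\<lambda>j. wp j \<omega>) k) $ i)\<^sup>2)" for k
    by (intro Bochner_Integration.integrable_sum past_functional_square_integrable[OF noise, where k = k]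
        past_functional_mult_mat_vec[OF Cp response_carrier past_response]) auto
  then show int: "integrable M (\<lambda>\<omega>. sq_norm (Cp *\<^sub>v response (\<lambda>j. wp j \<omega>) k))" for k
    unfolding sq_norm_eq[OF mult_mat_vec_carrier[OF Cp response_carrier]] .
  let ?c = "\<lambda>k \<omega>. scalar_prod (?G *\<^sub>v drift (\<lambda>j. wp j \<omega>) k) (to_jvec (wp k \<omega>))"
  have c: "?c k \<omega> = (\<Sum>i<CARD('w). (?G *\<^sub>v drift (\<lambda>j. wp j \<omega>) k) $ i * vec_nth (wp k \<omega>) (from_nat_into UNIV i))" for k \<omega>
    by (auto simp: scalar_prod_def lessThan_atLeast0 to_jvec_def intro!: sum.cong)
  have Gp: "past_functional k (\<lambda>v. (?G *\<^sub>v drift v k) $ i)" if "i < CARD('w)" for i k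
    by (rule past_functional_mult_mat_vec[OF G ext_drift_carrier past_drift that]) (rule response_carrier)
  note unc = past_functional_noise_uncorrelated[OF noise Gp]
  have ci: "integrable M (?c k)" for k
    unfolding c by (intro Bochner_Integration.integrable_sum unc) auto
  have c0: "(LINT \<omega>|M. ?c k \<omega>) = 0" for k
    unfolding c by (subst Bochner_Integration.integral_sum) (use unc in auto)
  note q = noise_quad_form[OF noise R]
  have "(\<Sum>k<K. LINT \<omega>|M. sq_norm (Cp *\<^sub>v response (\<lambda>j. wp j \<omega>) k)) =
      (LINT \<omega>|M. (\<Sum>k<K. sq_norm (Cp *\<^sub>v response (\<lambda>j. wp j \<omega>) k)))"
    by (rule Bochner_Integration.integral_sum[symmetric]) (rule int)
  also have "\<dots> \<le> (LINT \<omega>|M. (\<Sum>k<K. 2 * ?c k \<omega> + quad_form ?R (to_jvec (wp k \<omega>))))"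
    by (intro integral_mono Bochner_Integration.integrable_sum int Bochner_Integration.integrable_add
        integrable_mult_right ci q(1) response_energy)
  also have "\<dots> = (\<Sum>k<K. 2 * (LINT \<omega>|M. ?c k \<omega>) + (LINT \<omega>|M. quad_form ?R (to_jvec (wp k \<omega>))))"
    by (subst Bochner_Integration.integral_sum) (simp_all add: ci q(1))
  also have "\<dots> = real K * mat_trace ?R" unfolding c0 q(2) by simp
  finally show "(\<Sum>k<K. LINT \<omega>|M. sq_norm (Cp *\<^sub>v response (\<lambda>j. wp j \<omega>) k)) \<le> real K * mat_trace ?R" .
qed

text \<open>The signals in \<open>zero_state_response\<close> are existentially quantified; any
  witness satisfies the recursion of \<open>response\<close> from the same initial state.\<close>

lemma zero_state_response_eq:
  assumes "zero_state_response Acl B Bp C Cp (Delta m H) v yp"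
  shows "yp k = Cp *\<^sub>v response v k"
proof -
  from assms obtain \<xi> w y where \<xi>0: "\<xi> 0 = 0\<^sub>v (dim_row Acl)" and w: "w = Delta m H y"
    and step: "\<And>k. \<xi> (Suc k) = Acl *\<^sub>v \<xi> k + B *\<^sub>v to_jvec (w k) + Bp *\<^sub>v to_jvec (v k)"
    and y: "\<And>k. y k = of_jvec (C *\<^sub>v \<xi> k)" and yp: "\<And>k. yp k = Cp *\<^sub>v \<xi> k"
    unfolding zero_state_response_def by blast
  have "\<xi> k = response v k" for k
  proof (induction k)
    case 0
    show ?case using \<xi>0 Acl by simp
  next
    case (Suc k)
    show ?case unfolding step response.simps w Delta_eq_slope[OF H m mL] y Suc ..
  qed
  then show ?thesis by (simp add: yp)
qed

lemma H2_bound: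
  fixes M :: "'o measure" and wp :: "nat \<Rightarrow> 'o \<Rightarrow> real ^ 'w"
  assumes noise: "white_noise M wp" and \<gamma>: "\<gamma> > 0"
    and resp: "\<forall>\<omega>\<in>space M. zero_state_response Acl B Bp C Cp (Delta m H) (\<lambda>k. wp k \<omega>) (\<lambda>k. yp k \<omega>)"
    and trace: "mat_trace (transpose_mat Bc2 * P * Bc2) \<le> \<gamma>\<^sup>2"
  shows "integrable M (\<lambda>\<omega>. sq_norm (yp k \<omega>))"
    and "limsup (\<lambda>K. ereal (sqrt (1 / real K * (\<Sum>k=0..K. LINT \<omega>|M. sq_norm (yp k \<omega>))))) \<le> ereal \<gamma>"
proof -
  have yp: "yp k \<omega> = Cp *\<^sub>v response (\<lambda>j. wp j \<omega>) k" if "\<omega> \<in> space M" for k \<omega>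
    using zero_state_response_eq resp that by blast
  have "integrable M (\<lambda>\<omega>. sq_norm (yp k \<omega>)) \<longleftrightarrow> integrable M (\<lambda>\<omega>. sq_norm (Cp *\<^sub>v response (\<lambda>j. wp j \<omega>) k))" for k
    by (rule Bochner_Integration.integrable_cong) (simp_all add: yp)
  then show "integrable M (\<lambda>\<omega>. sq_norm (yp k \<omega>))" using expected_energy(1)[OF noise] by simp
  have E: "(LINT \<omega>|M. sq_norm (yp k \<omega>)) = (LINT \<omega>|M. sq_norm (Cp *\<^sub>v response (\<lambda>j. wp j \<omega>) k))" for k
    by (rule Bochner_Integration.integral_cong) (simp_all add: yp)
  \<comment> \<open>\<open>K + 1\<close> terms are averaged with weight \<open>1 / K\<close>, whence
    the factor on the right. At \<open>K = 0\<close> both sides are 0 by the convention for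
    division.\<close>
  have bound: "sqrt (1 / real K * (\<Sum>k=0..K. LINT \<omega>|M. sq_norm (yp k \<omega>))) \<le> sqrt ((real K + 1) / real K) * \<gamma>" for K
  proof -
    have "{0..K} = {..<Suc K}" by auto
    then have "(\<Sum>k=0..K. LINT \<omega>|M. sq_norm (yp k \<omega>)) \<le> real (Suc K) * mat_trace (transpose_mat Bc2 * P * Bc2)"
      unfolding E using expected_energy(2)[OF noise, of "Suc K"] by simp
    also have "\<dots> \<le> real (Suc K) * \<gamma>\<^sup>2" by (rule mult_left_mono[OF trace]) simp
    finally have "sqrt (1 / real K * (\<Sum>k=0..K. LINT \<omega>|M. sq_norm (yp k \<omega>))) \<le> sqrt (1 / real K * (real (Suc K) * \<gamma>\<^sup>2))"
      by (intro real_sqrt_le_mono mult_left_mono) auto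
    also have "1 / real K * (real (Suc K) * \<gamma>\<^sup>2) = (real K + 1) / real K * \<gamma>\<^sup>2" by simp
    also have "sqrt \<dots> = sqrt ((real K + 1) / real K) * \<gamma>"
      using \<gamma> by (simp only: real_sqrt_mult real_sqrt_abs)
    finally show ?thesis .
  qed
  have "(\<lambda>K. sqrt (1 + 1 / real K) * \<gamma>) \<longlonglongrightarrow> sqrt (1 + 0) * \<gamma>"
    by (intro tendsto_intros lim_1_over_n)
  then have lim: "(\<lambda>K. sqrt (1 + 1 / real K) * \<gamma>) \<longlonglongrightarrow> \<gamma>" by simp
  \<comment> \<open>The two expressions differ at \<open>K = 0\<close>, where the left one is
    \<open>\<gamma>\<close> and the right one 0.\<close>
  have "\<forall>\<^sub>F K in sequentially. sqrt (1 + 1 / real K) * \<gamma> = sqrt ((real K + 1) / real K) * \<gamma>"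
    using eventually_gt_at_top[of 0] by eventually_elim (simp add: add_divide_distrib)
  with lim have "(\<lambda>K. sqrt ((real K + 1) / real K) * \<gamma>) \<longlonglongrightarrow> \<gamma>"
    by (rule Lim_transform_eventually)
  then have "limsup (\<lambda>K. ereal (sqrt ((real K + 1) / real K) * \<gamma>)) = ereal \<gamma>"
    by (intro lim_imp_Limsup) auto
  then show "limsup (\<lambda>K. ereal (sqrt (1 / real K * (\<Sum>k=0..K. LINT \<omega>|M. sq_norm (yp k \<omega>))))) \<le> ereal \<gamma>"
    using Limsup_mono[of "\<lambda>K. ereal (sqrt (1 / real K * (\<Sum>k=0..K. LINT \<omega>|M. sq_norm (yp k \<omega>))))"
      "\<lambda>K. ereal (sqrt ((real K + 1) / real K) * \<gamma>)" sequentially] bound by simp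
qed

end

section \<open>The selector in the trace condition and the final assembly\<close>

lemma selector_mult:
  assumes N: "transpose_mat N = 0\<^sub>m np k @\<^sub>c 1\<^sub>m np" and Bp: "Bp \<in> carrier_mat np nw"
  defines "Bc \<equiv> 0\<^sub>m k nw @\<^sub>r Bp"
  shows "N * transpose_mat N * Bc = Bc" and "N \<in> carrier_mat (k + np) np"
proof -
  have NT: "transpose_mat N \<in> carrier_mat np (k + np)" unfolding N by (rule append_cols_carrier) auto
  then show Nc: "N \<in> carrier_mat (k + np) np" by (simp add: transpose_carrier_mat)
  have N_eq: "N $$ (i, j) = (if i = k + j then 1 else 0)" if "i < k + np" "j < np" for i j
  proof -
    have "N $$ (i, j) = transpose_mat N $$ (j, i)" using Nc that by simp
    also have "\<dots> = (if i < k then 0 else (1\<^sub>m np :: real mat) $$ (j, i - k))"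
      unfolding N using that by (subst append_cols_index[of _ np k _ np]) auto
    finally show ?thesis using that by auto
  qed
  have Bc: "Bc \<in> carrier_mat (k + np) nw" unfolding Bc_def using Bp by auto
  have low: "transpose_mat N * Bc = Bp"
  proof (rule eq_matI)
    fix i j assume ij: "i < dim_row Bp" "j < dim_col Bp"
    then have "(transpose_mat N * Bc) $$ (i, j) = (\<Sum>l<k + np. N $$ (l, i) * Bc $$ (l, j))"
      using Nc Bc Bp by (auto simp: scalar_prod_def lessThan_atLeast0 intro!: sum.cong)
    also have "\<dots> = (\<Sum>l<k + np. if l = k + i then Bc $$ (l, j) else 0)"
      using ij Bp by (intro sum.cong refl) (auto simp: N_eq)
    also have "\<dots> = Bp $$ (i, j)"
      using ij Bp by (simp add: Bc_def append_rows_def)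
    finally show "(transpose_mat N * Bc) $$ (i, j) = Bp $$ (i, j)" .
  qed (use Nc Bc Bp in auto)
  have "N * Bp = Bc"
  proof (rule eq_matI)
    fix i j assume "i < dim_row Bc" "j < dim_col Bc"
    then have ij: "i < k + np" "j < nw" using Bc by auto
    then have "(N * Bp) $$ (i, j) = (\<Sum>l<np. N $$ (i, l) * Bp $$ (l, j))"
      using Nc Bp by (auto simp: scalar_prod_def lessThan_atLeast0 intro!: sum.cong)
    also have "\<dots> = (\<Sum>l<np. if l = i - k then (if i < k then 0 else Bp $$ (l, j)) else 0)"
      using ij by (intro sum.cong refl) (auto simp: N_eq)
    also have "\<dots> = Bc $$ (i, j)" using ij Bp by (auto simp: Bc_def append_rows_def)
    finally show "(N * Bp) $$ (i, j) = Bc $$ (i, j)" .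
  qed (use Nc Bc Bp in auto)
  then show "N * transpose_mat N * Bc = Bc"
    using low assoc_mult_mat[OF Nc NT Bc] by simp
qed

text \<open>\<open>N * transpose_mat N\<close> projects onto the plant coordinates. The noise enters
  only there, so \<open>Bc\<close> is fixed by the projection and the trace condition concerns the
  matrix that appears in the energy estimate.\<close>

lemma selector_congruence:
  assumes N: "transpose_mat N = 0\<^sub>m np k @\<^sub>c 1\<^sub>m np" and Bp: "Bp \<in> carrier_mat np nw"
    and P: "P \<in> carrier_mat (k + np) (k + np)"
  defines "Bc \<equiv> 0\<^sub>m k nw @\<^sub>r Bp"
  shows "transpose_mat Bc * N * transpose_mat N * P * N * transpose_mat N * Bc = transpose_mat Bc * P * Bc"
proof -
  note sel = selector_mult[OF N Bp, folded Bc_def]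
  have Bc: "Bc \<in> carrier_mat (k + np) nw" unfolding Bc_def using Bp by auto
  have NT: "transpose_mat N \<in> carrier_mat np (k + np)" using sel(2) by simp
  have NN: "N * transpose_mat N \<in> carrier_mat (k + np) (k + np)" using sel(2) by simp
  have "transpose_mat (N * transpose_mat N * Bc) = transpose_mat Bc * (N * transpose_mat N)"
    using transpose_mult[OF NN Bc] transpose_mult[OF sel(2) NT] by simp
  then have left: "transpose_mat Bc * N * transpose_mat N = transpose_mat Bc"
    unfolding sel(1) using assoc_mult_mat[OF transpose_carrier_mat[THEN iffD2, OF Bc] sel(2) NT] by simp
  have BP: "transpose_mat Bc * P \<in> carrier_mat nw (k + np)" using Bc P by simp
  have "transpose_mat Bc * P * N * transpose_mat N * Bc = transpose_mat Bc * P * (N * transpose_mat N * Bc)"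
    using assoc_mult_mat[OF BP sel(2) NT] assoc_mult_mat[OF BP NN Bc] by simp
  then show ?thesis unfolding left sel(1) .
qed

theorem theorem6:
  fixes n ny lp lm p nc :: nat
    and m L \<gamma> :: real
    and A B C D Ddag Bp Cp Acl N P Mp Mm M0 \<Phi> :: "real mat"
    and \<Delta>s :: "((nat \<Rightarrow> real ^ 'p::finite) \<Rightarrow> (nat \<Rightarrow> real ^ 'p)) set"
  assumes p_def: "p = CARD('p)"
    and "n \<ge> 1" and "ny \<ge> 1"
    and "L \<ge> m" and "m > 0"
    and "A \<in> carrier_mat (n * p) (n * p)"
    and "B \<in> carrier_mat (n * p) p"
    and "C \<in> carrier_mat p (n * p)"
    and "D \<in> carrier_mat p (n * p)"
    and "Ddag \<in> carrier_mat (n * p) p"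
    and "D * Ddag = 1\<^sub>m p"
    and "C * Ddag = 1\<^sub>m p"
    and "(A - 1\<^sub>m (n * p)) * Ddag = 0\<^sub>m (n * p) p"
    and "Bp \<in> carrier_mat (n * p) CARD('w::finite)"
    and "Cp \<in> carrier_mat ny (n * p)"
    and Acl_def: "Acl = A + m \<cdot>\<^sub>m (B * C)"
    and "\<forall>\<mu>. eigenvalue (map_mat complex_of_real Acl) \<mu> \<longrightarrow> cmod \<mu> < 1"
    and \<Delta>s_def: "\<Delta>s = Delta m ` S_class m L"
    and nc_def: "nc = p * (n + lm + lp)"
    and N_def: "transpose_mat N = 0\<^sub>m (n * p) ((lm + lp) * p) @\<^sub>c 1\<^sub>m (n * p)"
    and "P \<in> carrier_mat nc nc" and "P = transpose_mat P"
    and "Mp \<in> carrier_mat p (p * lp)"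
    and "Mm \<in> carrier_mat p (p * lm)"
    and "M0 \<in> carrier_mat p p"
    and "\<gamma> > 0"
    and \<Phi>_def: "\<Phi> = lmi_outer p (n * p) lp lm m L Acl B C Cp"
    and "neg_definite
      (transpose_mat \<Phi> * diag_block_mat [P, - P, M_Delta p lp lm Mm M0 Mp, 1\<^sub>m ny] * \<Phi>)"
    and "mat_trace (transpose_mat (B_c2 p lp lm Bp) * N * transpose_mat N * P *
      N * transpose_mat N * B_c2 p lp lm Bp) \<le> \<gamma>\<^sup>2"
    and "pos_definite P"
    and "Mm @\<^sub>c M0 @\<^sub>c Mp \<in> multiplier_set 1 lp lm p"
  shows "robustly_stable (lti Acl B C (0\<^sub>m p p)) \<Delta>s
    \<and> robust_H2_performance TYPE('o) TYPE('w) Acl B Bp C Cp \<Delta>s \<gamma>"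
proof -
  have comm: "p * lm = lm * p" "p * lp = lp * p" by simp_all
  have kk: "(lm + lp) * p = lm * p + lp * p" by (simp add: distrib_right)
  have nc: "nc = (lm * p + lp * p) + n * p" unfolding nc_def by (simp add: algebra_simps)
  have Acl: "Acl \<in> carrier_mat (n * p) (n * p)"
    unfolding Acl_def using assms(6,7,8) by auto
  have P: "P \<in> carrier_mat ((lm * p + lp * p) + n * p) ((lm * p + lp * p) + n * p)" using assms(21) unfolding nc .
  have Mp: "Mp \<in> carrier_mat p (lp * p)" and Mm: "Mm \<in> carrier_mat p (lm * p)"
    using assms(23,24) unfolding comm .
  interpret lmi_system p "n * p" lp lm ny m L Acl B C Cp P Mp Mm M0 "TYPE('p)"
    by unfold_locales (fact assms(1,4,5,7,8,15,25,30,31) Acl P Mp Mm assms(28)[unfolded \<Phi>_def])+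
  have stable: "robustly_stable (lti Acl B C (0\<^sub>m p p)) \<Delta>s"
    unfolding robustly_stable_def \<Delta>s_def
    using Delta_well_posed Delta_bounded_gain[OF _ assms(10,12)] by blast
  have perf: "(\<forall>k. integrable M (\<lambda>\<omega>. sq_norm (yp k \<omega>))) \<and>
      limsup (\<lambda>K. ereal (sqrt (1 / real K * (\<Sum>k=0..K. LINT \<omega>|M. sq_norm (yp k \<omega>))))) \<le> ereal \<gamma>"
    if F: "F \<in> \<Delta>s" and noise: "white_noise M wp"
      and resp: "\<forall>\<omega>\<in>space M. zero_state_response Acl B Bp C Cp F (\<lambda>k. wp k \<omega>) (\<lambda>k. yp k \<omega>)"
    for F and M :: "'o measure" and wp :: "nat \<Rightarrow> 'o \<Rightarrow> real ^ 'w" and yp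
  proof -
    obtain H where H: "H \<in> S_class m L" and FH: "F = Delta m H" using F unfolding \<Delta>s_def by blast
    interpret driven_lmi_system p "n * p" lp lm ny m L Acl B C Cp P Mp Mm M0 "TYPE('p)" Bp H "TYPE('w)"
      by unfold_locales (fact assms(14) H)+
    have "B_c2 p lp lm Bp = Bc2"
      unfolding B_c2_def Bc2_def kk using assms(14) by simp
    then have "transpose_mat (B_c2 p lp lm Bp) * N * transpose_mat N * P * N * transpose_mat N * B_c2 p lp lm Bp
        = transpose_mat Bc2 * P * Bc2"
      using selector_congruence[OF N_def[unfolded kk] assms(14) P] unfolding Bc2_def by simp
    then have trace: "mat_trace (transpose_mat Bc2 * P * Bc2) \<le> \<gamma>\<^sup>2"
      using assms(29) by simp
    show ?thesis
      using H2_bound[OF noise assms(26) resp[unfolded FH] trace] by blast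
  qed
  show ?thesis
    unfolding robust_H2_performance_def
    using stable perf unfolding p_def by blast
qed

end
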